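(* Consider the semi-discrete chain $t_{1x}=f(x,t,t_1,t_x)$ with $f_{t_x}\neq 0$ and $f_{t_xt_x}\neq 0$. Its characteristic $x$-ring $L_x$ has dimension four if and only if both of the following identities hold (as identities in the independent variables $x,t,t_1,t_2,t_x$): $$D\left(\frac{f_{t_xt_xt_x}}{f_{t_xt_x}}\right)=\frac{f_{t_xt_xt_x}f_{t_x}-3f_{t_xt_x}^2}{f_{t_xt_x}f_{t_x}^2}$$ and $$D\left(\frac{f_{xt_x}+t_xf_{t_xt}+ff_{t_xt_1}-f_t-f_{t_x}f_{t_1}}{f_{t_xt_x}}\right)=\frac{f_{xt_x}+t_xf_{t_xt}+ff_{t_xt_1}-f_t-f_{t_x}f_{t_1}}{f_{t_xt_x}}\,f_{t_x}-\left(f_x+t_xf_t+ff_{t_1}\right).$$ In this case the characteristic ring $L_x$ is generated by the vector fields $X,K,C_1,C_2$, where $C_1=[X,K]$ and $C_2=[X,C_1]$.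
   Context: Chain and notation: the unknown $t=t(n,x)$ depends on a discrete variable $n\in\mathbb{Z}$ and a continuous variable $x$; $t_m=t(n+m,x)$ for $m\in\mathbb{Z}$ (so $t_0=t$), $t_x=\partial t/\partial x$, $t_{mx}=\partial t_m/\partial x$. The chain is $t_{1x}=f(x,t,t_1,t_x)$. Subscripts on $f$ denote partial derivatives with respect to its arguments $x,t,t_1,t_x$. The considerations are local, $f$ is (locally) analytic, $f_{t_x}\neq0$, and $x$, $t_x$ and all $t_m$, $m\in\mathbb{Z}$, are regarded as independent variables ("dynamical variables"). A condition such as $f_{t_xt_x}\ne0$ means that the function does not vanish on the domain considered. Since $f_{t_x}\neq 0$, the equation $t_x=f(x,t_{-1},t,t_{-1x})$ can be solved for $t_{-1x}$, giving $t_{-1x}=g(x,t_{-1},t,t_x)$. Shift operator: $D$ acts on functions of the dynamical variables by $D:\ x\mapsto x,\ t_m\mapsto t_{m+1},\ t_x\mapsto f(x,t,t_1,t_x)$; for example $D\,h(x,t,t_1,t_x)=h(x,t_1,t_2,f(x,t,t_1,t_x))$. Its inverse is $D^{-1}:\ x\mapsto x,\ t_m\mapsto t_{m-1},\ t_x\mapsto g(x,t_{-1},t,t_x)$. Vector fields: $$X=\frac{\partial}{\partial t_x},\qquad K=\frac{\partial}{\partial x}+t_x\frac{\partial}{\partial t}+\sum_{k\ge1}\left(D^{k-1}f\right)\frac{\partial}{\partial t_k}+\sum_{k\ge1}\left(D^{-(k-1)}g\right)\frac{\partial}{\partial t_{-k}}.$$ The characteristic $x$-ring $L_x$ is the Lie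 ring generated by $X$ and $K$ (under commutators), where linear combinations with coefficients that are locally analytic functions, each depending on finitely many of the dynamical variables, are allowed. Its dimension is the maximal number of its elements that are linearly independent over such functions. "Generated by $X,K,C_1,C_2$" means that these vector fields form a basis of $L_x$ over such functions. *)

theory Defs
  imports "HOL-Analysis.Analysis"
begin

text \<open>
  The dynamical variables are \<open>x\<close>, \<open>t\<^sub>x\<close> and \<open>t\<^sub>m\<close> for all integers \<open>m\<close>. A point of the
  space of dynamical variables assigns a real number to each of them; this space carries the
  product topology, so a neighbourhood of a point constrains only finitely many variables.
\<close>

datatype dvar = Vx | Vtx | Vt int

type_synonym jet = "dvar \<Rightarrow> real"

type_synonym vfield = "dvar \<Rightarrow> jet \<Rightarrow> real"

text \<open>
  \<open>analytic_in I h p\<close>: on a polydisc around \<open>p\<close> in the variables \<open>I\<close>, \<open>h\<close> is the sum of a power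
  series in these variables. As \<open>q\<close> is unrestricted outside \<open>I\<close>, the function \<open>h\<close> then depends,
  near \<open>p\<close>, on the variables in \<open>I\<close> only.
\<close>

definition analytic_in :: "dvar set \<Rightarrow> (jet \<Rightarrow> real) \<Rightarrow> jet \<Rightarrow> bool" where
  "analytic_in I h p \<longleftrightarrow>
     (\<exists>c. \<exists>r>0. \<forall>q. (\<forall>i\<in>I. \<bar>q i - p i\<bar> < r) \<longrightarrow>
        ((\<lambda>\<alpha> :: dvar \<Rightarrow> nat. c \<alpha> * (\<Prod>i\<in>I. (q i - p i) ^ \<alpha> i)) has_sum h q)
          {\<alpha>. \<forall>i. i \<notin> I \<longrightarrow> \<alpha> i = 0})"

definition locally_analytic :: "jet \<Rightarrow> (jet \<Rightarrow> real) \<Rightarrow> bool" where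
  "locally_analytic p h \<longleftrightarrow> (\<exists>I. finite I \<and> analytic_in I h p)"

definition pd :: "dvar \<Rightarrow> (jet \<Rightarrow> real) \<Rightarrow> jet \<Rightarrow> real" where
  "pd j h q = deriv (\<lambda>s. h (q(j := s))) (q j)"

text \<open>
  \<open>on_jets f m\<close> is the function \<open>f(x, t\<^sub>m, t\<^sub>m\<^sub>+\<^sub>1, t\<^sub>x)\<close> of the dynamical variables. Thus the right-hand
  side of the chain is \<open>on_jets f 0\<close>, and the function \<open>g(x, t\<^sub>-\<^sub>1, t, t\<^sub>x)\<close> is \<open>on_jets g (-1)\<close>.
\<close>

definition on_jets :: "(real \<Rightarrow> real \<Rightarrow> real \<Rightarrow> real \<Rightarrow> real) \<Rightarrow> int \<Rightarrow> jet \<Rightarrow> real" where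
  "on_jets f m q = f (q Vx) (q (Vt m)) (q (Vt (m + 1))) (q Vtx)"

definition jets_over :: "(real \<times> real \<times> real \<times> real) set \<Rightarrow> jet set" where
  "jets_over U = {q. (q Vx, q (Vt 0), q (Vt 1), q Vtx) \<in> U}"

text \<open>
  \<open>D\<close> is composition with \<open>shift\<close>, so \<open>D\<^sup>k f\<close> is analytic near a base point \<open>p\<close> only if \<open>f\<close> is analytic
  at the iterated shifts of \<open>p\<close>. A base point for which all coefficients of \<open>K\<close> are defined therefore
  comes with a two-sided orbit under \<open>shift\<close> inside the domain of \<open>f\<close>.
\<close>

fun shift :: "(real \<Rightarrow> real \<Rightarrow> real \<Rightarrow> real \<Rightarrow> real) \<Rightarrow> jet \<Rightarrow> jet" where
  "shift f q Vx = q Vx"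
| "shift f q (Vt m) = q (Vt (m + 1))"
| "shift f q Vtx = on_jets f 0 q"

fun shift_back :: "(real \<Rightarrow> real \<Rightarrow> real \<Rightarrow> real \<Rightarrow> real) \<Rightarrow> jet \<Rightarrow> jet" where
  "shift_back g q Vx = q Vx"
| "shift_back g q (Vt m) = q (Vt (m - 1))"
| "shift_back g q Vtx = on_jets g (-1) q"

definition D :: "(real \<Rightarrow> real \<Rightarrow> real \<Rightarrow> real \<Rightarrow> real) \<Rightarrow> (jet \<Rightarrow> real) \<Rightarrow> jet \<Rightarrow> real" where
  "D f h = (\<lambda>q. h (shift f q))"

definition Dinv :: "(real \<Rightarrow> real \<Rightarrow> real \<Rightarrow> real \<Rightarrow> real) \<Rightarrow> (jet \<Rightarrow> real) \<Rightarrow> jet \<Rightarrow> real" where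
  "Dinv g h = (\<lambda>q. h (shift_back g q))"

text \<open>
  A vector field is a formal, possibly infinite sum of the derivations along the dynamical
  variables, given by its family of coefficients. Coefficients only matter as germs at a base
  point \<open>p\<close>; the neighbourhood in \<open>vf_eq\<close> may depend on the coefficient.
\<close>

definition vf_eq :: "jet \<Rightarrow> vfield \<Rightarrow> vfield \<Rightarrow> bool" where
  "vf_eq p V W \<longleftrightarrow> (\<forall>j. \<forall>\<^sub>F q in nhds p. V j q = W j q)"

text \<open>
  The sum in \<open>vf_app\<close> is finite near \<open>p\<close> whenever \<open>h\<close> depends, near \<open>p\<close>, on finitely many
  variables.
\<close>

definition vf_app :: "vfield \<Rightarrow> (jet \<Rightarrow> real) \<Rightarrow> jet \<Rightarrow> real" where
  "vf_app V h q = (\<Sum>j | pd j h q \<noteq> 0. V j q * pd j h q)"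

definition bracket :: "vfield \<Rightarrow> vfield \<Rightarrow> vfield" where
  "bracket V W = (\<lambda>j q. vf_app V (W j) q - vf_app W (V j) q)"

definition Xfield :: vfield where
  "Xfield = (\<lambda>j q. if j = Vtx then 1 else 0)"

fun Kfield :: "(real \<Rightarrow> real \<Rightarrow> real \<Rightarrow> real \<Rightarrow> real) \<Rightarrow> (real \<Rightarrow> real \<Rightarrow> real \<Rightarrow> real \<Rightarrow> real) \<Rightarrow> vfield"
  where
  "Kfield f g Vx q = 1"
| "Kfield f g Vtx q = 0"
| "Kfield f g (Vt m) q =
     (if m = 0 then q Vtx
      else if m > 0 then (D f ^^ nat (m - 1)) (on_jets f 0) q
      else (Dinv g ^^ nat (- m - 1)) (on_jets g (-1)) q)"

inductive_set Lx ::
  "(real \<Rightarrow> real \<Rightarrow> real \<Rightarrow> real \<Rightarrow> real) \<Rightarrow> (real \<Rightarrow> real \<Rightarrow> real \<Rightarrow> real \<Rightarrow> real) \<Rightarrow> jet \<Rightarrow> vfield set"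
  for f g :: "real \<Rightarrow> real \<Rightarrow> real \<Rightarrow> real \<Rightarrow> real" and p :: jet where
  X: "Xfield \<in> Lx f g p"
| K: "Kfield f g \<in> Lx f g p"
| bracket: "V \<in> Lx f g p \<Longrightarrow> W \<in> Lx f g p \<Longrightarrow> bracket V W \<in> Lx f g p"
| add: "V \<in> Lx f g p \<Longrightarrow> W \<in> Lx f g p \<Longrightarrow> (\<lambda>j q. V j q + W j q) \<in> Lx f g p"
| scale: "locally_analytic p a \<Longrightarrow> V \<in> Lx f g p \<Longrightarrow> (\<lambda>j q. a q * V j q) \<in> Lx f g p"

definition lincomb :: "(nat \<Rightarrow> jet \<Rightarrow> real) \<Rightarrow> vfield list \<Rightarrow> vfield" where
  "lincomb a Vs = (\<lambda>j q. \<Sum>i<length Vs. a i q * (Vs ! i) j q)"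

definition lin_indep :: "jet \<Rightarrow> vfield list \<Rightarrow> bool" where
  "lin_indep p Vs \<longleftrightarrow>
     (\<forall>a. (\<forall>i<length Vs. locally_analytic p (a i)) \<and> vf_eq p (lincomb a Vs) (\<lambda>j q. 0) \<longrightarrow>
        (\<forall>i<length Vs. \<forall>\<^sub>F q in nhds p. a i q = 0))"

definition has_dimension :: "jet \<Rightarrow> vfield set \<Rightarrow> nat \<Rightarrow> bool" where
  "has_dimension p L n \<longleftrightarrow>
     (\<exists>Vs. set Vs \<subseteq> L \<and> lin_indep p Vs \<and> length Vs = n) \<and>
     (\<forall>Vs. set Vs \<subseteq> L \<and> lin_indep p Vs \<longrightarrow> length Vs \<le> n)"

definition is_basis :: "jet \<Rightarrow> vfield set \<Rightarrow> vfield list \<Rightarrow> bool" where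
  "is_basis p L Vs \<longleftrightarrow>
     set Vs \<subseteq> L \<and> lin_indep p Vs \<and>
     (\<forall>Z\<in>L. \<exists>a. (\<forall>i<length Vs. locally_analytic p (a i)) \<and> vf_eq p Z (lincomb a Vs))"

text \<open>
  The quotient \<open>(f\<^bsub>x t_x\<^esub> + t\<^sub>x f\<^bsub>t t_x\<^esub> + f f\<^bsub>t_x t_1\<^esub> - f\<^sub>t - f\<^bsub>t_x\<^esub> f\<^bsub>t_1\<^esub>) / f\<^bsub>t_x t_x\<^esub>\<close>, where \<open>F\<close> is
  \<open>f(x, t, t\<^sub>1, t\<^sub>x)\<close> as a function of the dynamical variables.
\<close>

definition mu :: "(jet \<Rightarrow> real) \<Rightarrow> jet \<Rightarrow> real" where
  "mu F q =
     (pd Vtx (pd Vx F) q + q Vtx * pd Vtx (pd (Vt 0) F) q + F q * pd (Vt 1) (pd Vtx F) q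
        - pd (Vt 0) F q - pd Vtx F q * pd (Vt 1) F q)
     / pd Vtx (pd Vtx F) q"

end

theory Submission
  imports Defs "HOL-Complex_Analysis.Complex_Analysis"
begin

text \<open>
  Write \<open>T\<^sub>k\<close> for the coefficient of \<open>K\<close> along \<open>t\<^sub>k\<close>, so that \<open>T\<^sub>0 = t\<^sub>x\<close>, \<open>T\<^sub>1 = f\<close> and \<open>D T\<^sub>k = T\<^sub>k\<^sub>+\<^sub>1\<close>
  for all integers \<open>k\<close>. The fields \<open>X, K, C\<^sub>1, C\<^sub>2\<close> are always independent, and by the Jacobi identity they
  span \<open>L\<^sub>x\<close> as soon as \<open>[X, C\<^sub>2] = \<lambda> C\<^sub>2\<close> and \<open>[K, C\<^sub>1] = \<mu> C\<^sub>2\<close>; the coefficients along \<open>t\<^sub>1\<close> force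
  \<open>\<lambda> = f\<^bsub>sss\<^esub> / f\<^bsub>ss\<^esub>\<close> and \<open>\<mu>\<close> to be the quotient of the second identity, where \<open>s = t\<^sub>x\<close>. Along \<open>t\<^sub>k\<close> the
  relations read \<open>A T\<^sub>k = 0\<close> and \<open>B T\<^sub>k = 0\<close> with \<open>A = X\<^sup>3 - \<lambda> X\<^sup>2\<close> and \<open>B = 2 K X - X K - \<mu> X\<^sup>2\<close>. From
  \<open>X D = f\<^sub>s D X\<close> and \<open>K D = D K + K(f) D X\<close> one gets
  \<open>A D = f\<^sub>s\<^sup>3 (D A + \<tau> D X\<^sup>2)\<close> and \<open>B D = f\<^sub>s (D B + \<sigma> D X\<^sup>2)\<close>, where \<open>\<tau> = 0\<close> and \<open>\<sigma> = 0\<close> are the two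
  identities. Since \<open>A\<close> and \<open>B\<close> annihilate \<open>T\<^sub>0\<close> and \<open>T\<^sub>1\<close>, while \<open>X\<^sup>2 T\<^sub>1\<close> and \<open>X\<^sup>2 T\<^sub>-\<^sub>1\<close> do not vanish, the relations at one
  point of the orbit are equivalent to the identities at all points of the orbit.

  Analyticity of several variables is handled through the Banach algebra of absolutely convergent
  power series on the unit polydisc: dilation, recentring and composition are all substitutions of
  elements of the algebra into a series, and \<open>g\<close> is obtained from a fixed point in it.
\<close>

section \<open>The Banach algebra of absolutely summable families\<close>

text \<open>The main obstacle is that \<open>D\<close> moves the base point: the germ of
  \<open>D f u\<close> at \<open>P m\<close> is built from the germ of \<open>u\<close> at
  \<open>P (m + 1)\<close>. The dimension concerns the single germ at \<open>P 0\<close>, so every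
  operator rule is stated at an arbitrary \<open>P m\<close>, and facts travel only because
  \<open>shift\<close> is locally invertible along the orbit. Of \<open>g\<close> only a left
  inverse property is assumed; its analyticity and the right inverse property have to be derived.
  The factor \<open>f_s\<close> in \<open>X D\<close> arises because \<open>t_x\<close> enters the
  shifted variables only through \<open>t_x -> f\<close>. The extra term in \<open>K D\<close>
  arises because \<open>K\<close> kills \<open>t_x\<close> but not \<open>f\<close>. The
  coefficients \<lambda> and \<mu> are exactly those that cancel the \<open>D X\<close> terms in
  \<open>A D\<close> and \<open>B D\<close>, so that a scalar times \<open>D X^2\<close> is the
  whole defect. The second obstacle is that the coefficients of a linear relation may vanish at the
  base point, so they cannot be inverted. Cancellation in the ring of germs, which is an integral
  domain by analytic continuation, replaces division throughout.\<close>

typedef 'i l1 = "{c :: 'i \<Rightarrow> real. (\<lambda>i. \<bar>c i\<bar>) summable_on UNIV}"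
  morphisms cf Abs_l1
  by (rule exI[of _ "\<lambda>_. 0"]) auto

lemma cf_summable: "(\<lambda>i. \<bar>cf c i\<bar>) summable_on UNIV"
  using cf[of c] by simp

lemma cf_Abs_l1: "(\<lambda>i. \<bar>c i\<bar>) summable_on UNIV \<Longrightarrow> cf (Abs_l1 c) = c"
  by (simp add: Abs_l1_inverse)

lemma l1_eqI: "(\<And>i. cf c i = cf d i) \<Longrightarrow> c = d"
  by (metis cf_inject ext)

instantiation l1 :: (type) real_normed_vector
begin

definition zero_l1 :: "'a l1" where "zero_l1 = Abs_l1 (\<lambda>_. 0)"
definition plus_l1 :: "'a l1 \<Rightarrow> 'a l1 \<Rightarrow> 'a l1" where "plus_l1 c d = Abs_l1 (\<lambda>i. cf c i + cf d i)"
definition minus_l1 :: "'a l1 \<Rightarrow> 'a l1 \<Rightarrow> 'a l1" where "minus_l1 c d = Abs_l1 (\<lambda>i. cf c i - cf d i)"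
definition uminus_l1 :: "'a l1 \<Rightarrow> 'a l1" where "uminus_l1 c = Abs_l1 (\<lambda>i. - cf c i)"
definition scaleR_l1 :: "real \<Rightarrow> 'a l1 \<Rightarrow> 'a l1" where "scaleR_l1 a c = Abs_l1 (\<lambda>i. a * cf c i)"
definition norm_l1 :: "'a l1 \<Rightarrow> real" where "norm_l1 c = (\<Sum>\<^sub>\<infinity>i. \<bar>cf c i\<bar>)"
definition sgn_l1 :: "'a l1 \<Rightarrow> 'a l1" where "sgn_l1 c = scaleR (inverse (norm c)) c"
definition dist_l1 :: "'a l1 \<Rightarrow> 'a l1 \<Rightarrow> real" where "dist_l1 c d = norm (c - d)"
definition uniformity_l1 :: "('a l1 \<times> 'a l1) filter"
  where "uniformity_l1 = (INF e\<in>{0<..}. principal {(x, y). dist x y < e})"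
definition open_l1 :: "'a l1 set \<Rightarrow> bool"
  where "open_l1 U \<longleftrightarrow> (\<forall>x\<in>U. eventually (\<lambda>(x', y). x' = x \<longrightarrow> y \<in> U) uniformity)"

lemma cf_zero [simp]: "cf 0 i = 0"
  by (simp add: zero_l1_def cf_Abs_l1)

lemma cf_plus [simp]: "cf (c + d) i = cf c i + cf d i"
proof -
  have "(\<lambda>i. \<bar>cf c i + cf d i\<bar>) summable_on UNIV"
    by (rule summable_on_comparison_test[OF summable_on_add[OF cf_summable[of c] cf_summable[of d]]]) auto
  then show ?thesis by (simp add: plus_l1_def cf_Abs_l1)
qed

lemma cf_scaleR [simp]: "cf (a *\<^sub>R c) i = a * cf c i"
proof -
  have "(\<lambda>i. \<bar>a * cf c i\<bar>) summable_on UNIV"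
    using summable_on_cmult_right[OF cf_summable[of c], of "\<bar>a\<bar>"] by (simp add: abs_mult)
  then show ?thesis by (simp add: scaleR_l1_def cf_Abs_l1)
qed

lemma cf_uminus [simp]: "cf (- c) i = - cf c i"
  using cf_summable[of c] by (simp add: uminus_l1_def cf_Abs_l1)

lemma cf_minus [simp]: "cf (c - d) i = cf c i - cf d i"
proof -
  have "c - d = c + - d" by (simp add: minus_l1_def plus_l1_def)
  then show ?thesis by simp
qed

instance
proof
  fix a b :: real and x y z :: "'a l1"
  show "(norm x = 0) = (x = 0)"
  proof
    assume "norm x = 0"
    then have "\<bar>cf x i\<bar> = 0" for i
      using nonneg_infsum_le_0D[OF _ cf_summable[of x], of i] by (simp add: norm_l1_def)
    then show "x = 0" by (intro l1_eqI) auto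
  qed (simp add: norm_l1_def)
  show "norm (x + y) \<le> norm x + norm y"
  proof -
    have "norm (x + y) \<le> (\<Sum>\<^sub>\<infinity>i. \<bar>cf x i\<bar> + \<bar>cf y i\<bar>)"
      unfolding norm_l1_def by (intro infsum_mono summable_on_add cf_summable) auto
    also have "\<dots> = norm x + norm y"
      unfolding norm_l1_def by (intro infsum_add cf_summable)
    finally show ?thesis .
  qed
  show "norm (a *\<^sub>R x) = \<bar>a\<bar> * norm x"
    by (simp add: norm_l1_def abs_mult infsum_cmult_right')
qed (auto intro!: l1_eqI simp: algebra_simps sgn_l1_def dist_l1_def uniformity_l1_def open_l1_def)

end

lemma norm_cf_le: "\<bar>cf c i\<bar> \<le> norm c"
proof -
  have "sum (\<lambda>i. \<bar>cf c i\<bar>) {i} \<le> norm c"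
    unfolding norm_l1_def by (rule finite_sum_le_infsum[OF cf_summable]) auto
  then show ?thesis by simp
qed

lemma l1_sum_le: "finite F \<Longrightarrow> (\<Sum>i\<in>F. \<bar>cf c i\<bar>) \<le> norm c"
  unfolding norm_l1_def by (rule finite_sum_le_infsum[OF cf_summable]) auto

text \<open>Bounds over finite index sets survive coordinatewise limits; the completeness proof
  rests on this.\<close>

lemma l1_norm_leI:
  assumes "\<And>F. finite F \<Longrightarrow> (\<Sum>i\<in>F. \<bar>c i\<bar>) \<le> B"
  shows "(\<lambda>i. \<bar>c i\<bar>) summable_on UNIV" "norm (Abs_l1 c) \<le> B"
proof -
  show s: "(\<lambda>i. \<bar>c i\<bar>) summable_on UNIV"
    using assms by (intro nonneg_bdd_above_summable_on) (auto simp: bdd_above_def)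
  show "norm (Abs_l1 c) \<le> B"
    unfolding norm_l1_def cf_Abs_l1[OF s] using assms by (intro infsum_le_finite_sums[OF s]) auto
qed

instance l1 :: (type) banach
proof
  fix X :: "nat \<Rightarrow> 'a l1"
  assume C: "Cauchy X"
  have "Cauchy (\<lambda>n. cf (X n) i)" for i
    unfolding Cauchy_def
  proof (intro allI impI)
    fix e :: real assume "e > 0"
    then obtain M where M: "\<forall>m\<ge>M. \<forall>n\<ge>M. dist (X m) (X n) < e"
      using C unfolding Cauchy_def by blast
    have "dist (cf (X m) i) (cf (X n) i) \<le> dist (X m) (X n)" for m n
      using norm_cf_le[of "X m - X n" i] by (simp add: dist_norm)
    then show "\<exists>M. \<forall>m\<ge>M. \<forall>n\<ge>M. dist (cf (X m) i) (cf (X n) i) < e"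
      using M by (meson le_less_trans)
  qed
  then have "\<exists>l. (\<lambda>n. cf (X n) i) \<longlonglongrightarrow> l" for i
    by (simp add: Cauchy_convergent_iff convergent_def)
  then obtain l where l: "\<And>i. (\<lambda>n. cf (X n) i) \<longlonglongrightarrow> l i" by metis
  \<comment> \<open>Uniformity in the finite set \<open>F\<close> is what the coordinatewise limit
    preserves; it yields both membership of the limit in the space and convergence in norm.\<close>
  have key: "\<exists>M. \<forall>n\<ge>M. \<forall>F. finite F \<longrightarrow> (\<Sum>i\<in>F. \<bar>l i - cf (X n) i\<bar>) \<le> e" if "e > 0" for e
  proof -
    obtain M where M: "\<forall>m\<ge>M. \<forall>n\<ge>M. dist (X m) (X n) < e"
      using C \<open>e > 0\<close> unfolding Cauchy_def by blast
    have "(\<Sum>i\<in>F. \<bar>l i - cf (X n) i\<bar>) \<le> e" if "n \<ge> M" "finite F" for n F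
    proof (rule LIMSEQ_le_const2)
      show "(\<lambda>m. \<Sum>i\<in>F. \<bar>cf (X m) i - cf (X n) i\<bar>) \<longlonglongrightarrow> (\<Sum>i\<in>F. \<bar>l i - cf (X n) i\<bar>)"
        by (intro tendsto_intros l)
      show "\<exists>N. \<forall>m\<ge>N. (\<Sum>i\<in>F. \<bar>cf (X m) i - cf (X n) i\<bar>) \<le> e"
      proof (intro exI[of _ M] allI impI)
        fix m assume "m \<ge> M"
        have "(\<Sum>i\<in>F. \<bar>cf (X m - X n) i\<bar>) \<le> norm (X m - X n)" by (rule l1_sum_le[OF that(2)])
        also have "\<dots> \<le> e" using M \<open>m \<ge> M\<close> \<open>n \<ge> M\<close> by (force simp: dist_norm)
        finally show "(\<Sum>i\<in>F. \<bar>cf (X m) i - cf (X n) i\<bar>) \<le> e" by simp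
      qed
    qed
    then show ?thesis by blast
  qed
  have "(\<lambda>i. \<bar>l i\<bar>) summable_on UNIV"
  proof -
    obtain M where M: "\<And>F. finite F \<Longrightarrow> (\<Sum>i\<in>F. \<bar>l i - cf (X M) i\<bar>) \<le> 1"
      using key[of 1] by auto
    have "(\<Sum>i\<in>F. \<bar>l i\<bar>) \<le> 1 + norm (X M)" if "finite F" for F
    proof -
      have "(\<Sum>i\<in>F. \<bar>l i\<bar>) \<le> (\<Sum>i\<in>F. \<bar>l i - cf (X M) i\<bar> + \<bar>cf (X M) i\<bar>)"
        by (intro sum_mono) auto
      also have "\<dots> \<le> 1 + norm (X M)"
        unfolding sum.distrib by (intro add_mono M l1_sum_le that)
      finally show ?thesis .
    qed
    then show ?thesis by (rule l1_norm_leI)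
  qed
  then have cfL: "cf (Abs_l1 l) = l" by (rule cf_Abs_l1)
  have "X \<longlonglongrightarrow> Abs_l1 l"
    unfolding lim_sequentially
  proof (intro allI impI)
    fix e :: real assume "e > 0"
    then obtain M where M: "\<And>n F. n \<ge> M \<Longrightarrow> finite F \<Longrightarrow> (\<Sum>i\<in>F. \<bar>l i - cf (X n) i\<bar>) \<le> e / 2"
      using key[of "e / 2"] by auto
    have "dist (X n) (Abs_l1 l) < e" if "n \<ge> M" for n
    proof -
      have "norm (Abs_l1 (\<lambda>i. l i - cf (X n) i)) \<le> e / 2"
        by (rule l1_norm_leI(2)) (use M that in auto)
      moreover have "Abs_l1 (\<lambda>i. l i - cf (X n) i) = Abs_l1 l - X n"
        by (simp add: minus_l1_def cfL)
      ultimately show ?thesis using \<open>e > 0\<close> by (simp add: dist_norm norm_minus_commute)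
    qed
    then show "\<exists>no. \<forall>n\<ge>no. dist (X n) (Abs_l1 l) < e" by blast
  qed
  then show "convergent X" by (auto simp: convergent_def)
qed

definition unit_l1 :: "'i \<Rightarrow> 'i l1" where
  "unit_l1 i = Abs_l1 (\<lambda>j. if j = i then 1 else 0)"

lemma cf_unit_l1 [simp]: "cf (unit_l1 i) j = (if j = i then 1 else 0)"
proof -
  have "(\<lambda>j. \<bar>if j = i then 1 else (0::real)\<bar>) summable_on UNIV"
    by (rule finite_nonzero_values_imp_summable_on) auto
  then show ?thesis by (simp add: unit_l1_def cf_Abs_l1)
qed

lemma norm_unit_l1 [simp]: "norm (unit_l1 i) = 1"
proof -
  have "norm (unit_l1 i) = (\<Sum>\<^sub>\<infinity>j\<in>{i}. (1::real))"
    unfolding norm_l1_def by (rule infsum_cong_neutral) auto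
  then show ?thesis by simp
qed

text \<open>The bounded linear extension of a bounded family prescribed on the unit vectors.
  Products, substitutions and derivatives of power series are all of this form.\<close>

definition lin_ext :: "('i \<Rightarrow> 'b::banach) \<Rightarrow> 'i l1 \<Rightarrow> 'b" where
  "lin_ext e c = (\<Sum>\<^sub>\<infinity>i. cf c i *\<^sub>R e i)"

lemma lin_abs_summable:
  assumes "\<And>i. norm (e i) \<le> M"
  shows "(\<lambda>i. norm (cf c i *\<^sub>R e i)) summable_on UNIV"
proof (rule summable_on_comparison_test)
  show "(\<lambda>i. M * \<bar>cf c i\<bar>) summable_on UNIV" by (rule summable_on_cmult_right[OF cf_summable])
  show "norm (cf c i *\<^sub>R e i) \<le> M * \<bar>cf c i\<bar>" for i
    using mult_right_mono[OF assms[of i], of "\<bar>cf c i\<bar>"] by (simp add: mult.commute)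
qed auto

lemma lin_has_sum:
  assumes "\<And>i. norm (e i) \<le> M"
  shows "((\<lambda>i. cf c i *\<^sub>R e i) has_sum lin_ext e c) UNIV"
  unfolding lin_ext_def by (rule has_sum_infsum[OF abs_summable_summable[OF lin_abs_summable[OF assms]]])

lemma lin_unit [simp]: "lin_ext e (unit_l1 i) = e i"
proof -
  have "lin_ext e (unit_l1 i) = (\<Sum>\<^sub>\<infinity>j\<in>{i}. e j)"
    unfolding lin_ext_def by (rule infsum_cong_neutral) auto
  then show ?thesis by simp
qed

lemma lin_add:
  assumes "\<And>i. norm (e i) \<le> M"
  shows "lin_ext e (c + d) = lin_ext e c + lin_ext e d"
  using has_sum_add[OF lin_has_sum[OF assms, of c] lin_has_sum[OF assms, of d]]
  unfolding lin_ext_def by (simp add: scaleR_left_distrib infsumI)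

lemma lin_scale:
  assumes "\<And>i. norm (e i) \<le> M"
  shows "lin_ext e (a *\<^sub>R c) = a *\<^sub>R lin_ext e c"
  using infsum_scaleR_right[of a "\<lambda>i. cf c i *\<^sub>R e i" UNIV] unfolding lin_ext_def by simp

lemma lin_norm_le:
  assumes "\<And>i. norm (e i) \<le> M"
  shows "norm (lin_ext e c) \<le> M * norm c"
proof -
  have "norm (lin_ext e c) \<le> (\<Sum>\<^sub>\<infinity>i. norm (cf c i *\<^sub>R e i))"
    unfolding lin_ext_def by (rule norm_infsum_bound[OF lin_abs_summable[OF assms]])
  also have "\<dots> \<le> (\<Sum>\<^sub>\<infinity>i. M * \<bar>cf c i\<bar>)"
  proof (rule infsum_mono[OF lin_abs_summable[OF assms] summable_on_cmult_right[OF cf_summable]])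
    show "norm (cf c i *\<^sub>R e i) \<le> M * \<bar>cf c i\<bar>" for i
      using mult_right_mono[OF assms[of i], of "\<bar>cf c i\<bar>"] by (simp add: mult.commute)
  qed
  also have "\<dots> = M * norm c" by (simp add: norm_l1_def infsum_cmult_right')
  finally show ?thesis .
qed

lemma bounded_linear_lin:
  assumes "\<And>i. norm (e i) \<le> M"
  shows "bounded_linear (lin_ext e)"
  by (rule bounded_linear_intro[of _ M])
    (use lin_norm_le[OF assms] in \<open>simp_all add: lin_add[OF assms] lin_scale[OF assms] mult.commute\<close>)

lemma lin_unit_l1_id: "lin_ext unit_l1 c = c"
proof (rule l1_eqI)
  fix j
  have bl: "bounded_linear (\<lambda>d::'a l1. cf d j)"
    by (rule bounded_linear_intro[of _ 1]) (auto simp: norm_cf_le)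
  have "((\<lambda>i. cf (cf c i *\<^sub>R unit_l1 i) j) has_sum cf (lin_ext unit_l1 c) j) UNIV"
    by (rule has_sum_bounded_linear[OF bl]) (rule lin_has_sum[of _ 1], simp)
  moreover have "((\<lambda>i. cf (cf c i *\<^sub>R unit_l1 i) j) has_sum cf c j) UNIV"
    by (rule has_sum_finite_neutralI[of "{j}"]) auto
  ultimately show "cf (lin_ext unit_l1 c) j = cf c j" by (rule has_sum_unique)
qed

text \<open>Every element is the sum of its multiples of unit vectors, and bounded linear maps
  commute with that sum. Identities and estimates for power series thereby reduce to
  monomials.\<close>

lemma l1_linear_ext:
  assumes f: "bounded_linear f" and g: "bounded_linear g" and eq: "\<And>i. f (unit_l1 i) = g (unit_l1 i)"
  shows "f c = g c"
proof -
  have s: "((\<lambda>i. cf c i *\<^sub>R unit_l1 i) has_sum c) UNIV"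
    using lin_has_sum[of unit_l1 1 c] by (simp add: lin_unit_l1_id)
  have "((\<lambda>i. f (cf c i *\<^sub>R unit_l1 i)) has_sum f c) UNIV"
    and "((\<lambda>i. g (cf c i *\<^sub>R unit_l1 i)) has_sum g c) UNIV"
    using has_sum_bounded_linear[OF f s] has_sum_bounded_linear[OF g s] .
  moreover have "f (cf c i *\<^sub>R unit_l1 i) = g (cf c i *\<^sub>R unit_l1 i)" for i
    using eq by (simp add: linear_simps[OF f] linear_simps[OF g])
  ultimately show ?thesis using has_sum_unique by fastforce
qed

section \<open>Convolution product and ring structure\<close>

instantiation l1 :: (comm_monoid_add) times
begin
text \<open>Convolution, encoded as the bilinear extension of addition of indices, so that no double
  series has to be rearranged.\<close>

definition times_l1 :: "'a l1 \<Rightarrow> 'a l1 \<Rightarrow> 'a l1" where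
  "c * d = lin_ext (\<lambda>i. lin_ext (\<lambda>j. unit_l1 (i + j)) d) c"
instance ..
end

instantiation l1 :: (comm_monoid_add) one
begin
definition one_l1 :: "'a l1" where "1 = unit_l1 0"
instance ..
end

lemma l1_shift_norm: "norm (lin_ext (\<lambda>j. unit_l1 (i + j)) d) \<le> norm d"
  using lin_norm_le[of "\<lambda>j. unit_l1 (i + j)" 1 d] by simp

lemma unit_times_unit: "unit_l1 i * unit_l1 j = unit_l1 (i + j)"
  by (simp add: times_l1_def)

lemma l1_norm_times: "norm (c * d) \<le> norm c * norm d" for c d :: "'a::comm_monoid_add l1"
  unfolding times_l1_def using lin_norm_le[OF l1_shift_norm] by (simp add: mult.commute)

lemma bounded_bilinear_l1: "bounded_bilinear (\<lambda>c d :: 'a::comm_monoid_add l1. c * d)"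
proof
  fix a a' b b' :: "'a l1" and r :: real
  have e1: "norm (unit_l1 (i + j)) \<le> 1" for i j :: 'a by simp
  show "(a + a') * b = a * b + a' * b"
    unfolding times_l1_def by (rule lin_add[OF l1_shift_norm])
  show "(r *\<^sub>R a) * b = r *\<^sub>R (a * b)"
    unfolding times_l1_def by (rule lin_scale[OF l1_shift_norm])
  show "a * (b + b') = a * b + a * b'"
    unfolding times_l1_def lin_ext_def[of "\<lambda>i. lin_ext (\<lambda>j. unit_l1 (i + j)) (b + b')"]
  proof (rule infsumI)
    show "((\<lambda>i. cf a i *\<^sub>R lin_ext (\<lambda>j. unit_l1 (i + j)) (b + b')) has_sum
       lin_ext (\<lambda>i. lin_ext (\<lambda>j. unit_l1 (i + j)) b) a + lin_ext (\<lambda>i. lin_ext (\<lambda>j. unit_l1 (i + j)) b') a) UNIV"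
      using has_sum_add[OF lin_has_sum[OF l1_shift_norm[of _ b], of a] lin_has_sum[OF l1_shift_norm[of _ b'], of a]]
      by (simp add: lin_add[OF e1] scaleR_right_distrib)
  qed
  show "a * (r *\<^sub>R b) = r *\<^sub>R (a * b)"
    unfolding times_l1_def
    by (simp add: lin_scale[OF e1] lin_ext_def[of _ a] infsum_scaleR_right[symmetric] mult.commute)
  show "\<exists>K. \<forall>a b :: 'a l1. norm (a * b) \<le> norm a * norm b * K"
    by (rule exI[of _ 1]) (simp add: l1_norm_times)
qed

instance l1 :: (comm_monoid_add) real_normed_algebra_1
proof
  interpret B: bounded_bilinear "\<lambda>c d :: 'a l1. c * d" by (rule bounded_bilinear_l1)
  note l = B.bounded_linear_left and r = B.bounded_linear_right
  fix a b c :: "'a l1" and s :: real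
  \<comment> \<open>Associativity is clear on unit vectors; linearity then frees the third, the
    second and the first factor in turn.\<close>
  have 1: "unit_l1 i * unit_l1 j * unit_l1 k = unit_l1 i * (unit_l1 j * unit_l1 k)" for i j k :: 'a
    by (simp add: unit_times_unit add.assoc)
  have 2: "unit_l1 i * unit_l1 j * c = unit_l1 i * (unit_l1 j * c)" for i j :: 'a and c
    by (rule l1_linear_ext[where c = c, OF r bounded_linear_compose[OF r r] 1])
  have 3: "unit_l1 i * b * c = unit_l1 i * (b * c)" for i :: 'a and b c
    by (rule l1_linear_ext[where c = b, OF bounded_linear_compose[OF l r] bounded_linear_compose[OF r l] 2])
  show "a * b * c = a * (b * c)"
    by (rule l1_linear_ext[where c = a, OF bounded_linear_compose[OF l l] l 3])
  show "(a + b) * c = a * c + b * c" by (rule B.add_left)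
  show "a * (b + c) = a * b + a * c" by (rule B.add_right)
  show "(s *\<^sub>R a) * b = s *\<^sub>R (a * b)" by (rule B.scaleR_left)
  show "a * (s *\<^sub>R b) = s *\<^sub>R (a * b)" by (rule B.scaleR_right)
  show "1 * a = a"
    by (rule l1_linear_ext[where c = a, OF r bounded_linear_ident]) (simp add: one_l1_def unit_times_unit)
  show "a * 1 = a"
    by (rule l1_linear_ext[where c = a, OF l bounded_linear_ident]) (simp add: one_l1_def unit_times_unit)
  show "norm (a * b) \<le> norm a * norm b" by (rule l1_norm_times)
  show "norm (1 :: 'a l1) = 1" by (simp add: one_l1_def)
  have "norm (1 :: 'a l1) \<noteq> norm (0 :: 'a l1)" by (simp add: one_l1_def)
  then show "(0 :: 'a l1) \<noteq> 1" by force
qed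

instance l1 :: (comm_monoid_add) comm_ring_1
proof
  fix a b c :: "'a l1"
  have 1: "unit_l1 i * b = b * unit_l1 i" for i :: 'a and b
    by (rule l1_linear_ext[where c = b, OF bounded_linear_mult_right bounded_linear_mult_left])
      (simp add: unit_times_unit add.commute)
  show "a * b = b * a"
    by (rule l1_linear_ext[where c = a, OF bounded_linear_mult_left bounded_linear_mult_right 1])
  show "(a + b) * c = a * c + b * c" by (rule distrib_right)
  show "1 * a = a" by (rule mult_1_left)
qed

section \<open>Power series on the unit polydisc\<close>

text \<open>Exponents are multisets: finite support is built in, exponents add as multisets, and
  estimates go by induction over \<open>add_mset\<close>.\<close>

definition mon :: "('a \<Rightarrow> 'b::comm_monoid_mult) \<Rightarrow> 'a multiset \<Rightarrow> 'b" where
  "mon u \<alpha> = prod_mset (image_mset u \<alpha>)"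

lemma mon_simps [simp]:
  "mon u {#} = 1" "mon u (add_mset i \<alpha>) = u i * mon u \<alpha>" "mon u (\<alpha> + \<beta>) = mon u \<alpha> * mon u \<beta>"
  by (simp_all add: mon_def)

lemma mon_scale: "mon (\<lambda>i. a *\<^sub>R u i) \<alpha> = a ^ size \<alpha> *\<^sub>R mon u \<alpha>"
  for u :: "'a \<Rightarrow> 'b::{real_normed_algebra_1, comm_ring_1}"
  by (induction \<alpha>) auto

lemma norm_mon_le:
  fixes u :: "'a \<Rightarrow> 'b::{real_normed_algebra_1, comm_ring_1}"
  assumes "\<And>i. norm (u i) \<le> m"
  shows "norm (mon u \<alpha>) \<le> m ^ size \<alpha>"
proof (induction \<alpha>)
  case (add i \<alpha>)
  have "norm (mon u (add_mset i \<alpha>)) \<le> norm (u i) * norm (mon u \<alpha>)"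
    by (simp add: norm_mult_ineq)
  also have "\<dots> \<le> m * m ^ size \<alpha>"
    using order_trans[OF norm_ge_zero assms[of i]] by (intro mult_mono add.IH assms) auto
  finally show ?case by simp
qed simp

lemma norm_mon_le_1:
  fixes u :: "'a \<Rightarrow> 'b::{real_normed_algebra_1, comm_ring_1}"
  assumes "\<And>i. norm (u i) \<le> 1"
  shows "norm (mon u \<alpha>) \<le> 1"
  using norm_mon_le[of u 1, OF assms] by simp

lemma norm_mon_le_m:
  fixes u :: "'a \<Rightarrow> 'b::{real_normed_algebra_1, comm_ring_1}"
  assumes "\<And>i. norm (u i) \<le> m" "m \<le> 1" "\<alpha> \<noteq> {#}"
  shows "norm (mon u \<alpha>) \<le> m"
proof -
  obtain i \<beta> where \<alpha>: "\<alpha> = add_mset i \<beta>" using assms(3) multiset_cases by blast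
  have "norm (mon u \<alpha>) \<le> norm (u i) * norm (mon u \<beta>)" unfolding \<alpha> by (simp add: norm_mult_ineq)
  also have "\<dots> \<le> norm (u i) * 1"
    by (intro mult_left_mono norm_mon_le_1[OF order_trans[OF assms(1,2)]]) auto
  finally show ?thesis using assms(1)[of i] by simp
qed

text \<open>The target algebra varies: \<open>real\<close> for values, \<open>complex\<close> for
  analytic continuation, and the series algebra itself for substitution of series into
  series.\<close>

definition ev :: "('a \<Rightarrow> 'b) \<Rightarrow> 'a multiset l1 \<Rightarrow> 'b::{real_normed_algebra_1, comm_ring_1, banach}" where
  "ev u = lin_ext (mon u)"

definition var :: "'a \<Rightarrow> 'a multiset l1" where
  "var i = unit_l1 {#i#}"

lemma norm_var [simp]: "norm (var i) = 1"
  by (simp add: var_def)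

lemma mon_var: "mon var \<alpha> = unit_l1 \<alpha>"
  by (induction \<alpha>) (auto simp: var_def unit_times_unit one_l1_def)

lemma ev_unit [simp]: "ev u (unit_l1 \<alpha>) = mon u \<alpha>"
  by (simp add: ev_def)

lemma ev_var [simp]: "ev u (var i) = u i"
  by (simp add: var_def)

lemma ev_one [simp]: "ev u 1 = 1"
  by (simp add: one_l1_def)

context
  fixes u :: "'a \<Rightarrow> 'b::{real_normed_algebra_1, comm_ring_1, banach}"
  assumes u: "\<And>i. norm (u i) \<le> 1"
begin

lemma bounded_linear_ev: "bounded_linear (ev u)"
  unfolding ev_def by (rule bounded_linear_lin[OF norm_mon_le_1[OF u]])

lemmas ev_linear = linear_simps[OF bounded_linear_ev]

lemma norm_ev_le: "norm (ev u c) \<le> norm c"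
  using lin_norm_le[OF norm_mon_le_1[OF u]] unfolding ev_def by simp

lemma ev_has_sum: "((\<lambda>\<alpha>. cf c \<alpha> *\<^sub>R mon u \<alpha>) has_sum ev u c) UNIV"
  unfolding ev_def by (rule lin_has_sum[OF norm_mon_le_1[OF u]])

lemma ev_mult: "ev u (c * d) = ev u c * ev u d"
proof -
  note comp = bounded_linear_compose
  have 1: "ev u (unit_l1 \<alpha> * d) = mon u \<alpha> * ev u d" for \<alpha> d
    by (rule l1_linear_ext[where c = d, OF comp[OF bounded_linear_ev bounded_linear_mult_right]
        comp[OF bounded_linear_mult_right bounded_linear_ev]]) (simp add: unit_times_unit)
  show ?thesis
    by (rule l1_linear_ext[where c = c, OF comp[OF bounded_linear_ev bounded_linear_mult_left]
        comp[OF bounded_linear_mult_left bounded_linear_ev]]) (simp add: 1)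
qed

lemma ev_mon: "ev u (mon w \<alpha>) = mon (\<lambda>i. ev u (w i)) \<alpha>"
  by (induction \<alpha>) (auto simp: ev_mult)

end

text \<open>Both sides are bounded and linear in \<open>c\<close> and agree on monomials. With
  numerical \<open>v\<close>, a substitution inside the algebra becomes a substitution of
  values.\<close>

lemma ev_ev:
  assumes u: "\<And>i. norm (u i) \<le> 1" and v: "\<And>i. norm (v i) \<le> 1"
  shows "ev v (ev u c) = ev (\<lambda>i. ev v (u i)) c"
proof (rule l1_linear_ext[where c = c])
  show "bounded_linear (\<lambda>c. ev v (ev u c))"
    by (rule bounded_linear_compose[OF bounded_linear_ev[OF v] bounded_linear_ev[OF u]])
  show "bounded_linear (ev (\<lambda>i. ev v (u i)))"
    by (rule bounded_linear_ev) (rule order_trans[OF norm_ev_le[OF v] u])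
qed (simp add: ev_mon[OF v])

section \<open>Termwise differentiation and Taylor estimates\<close>

definition dmon :: "'a \<Rightarrow> ('a \<Rightarrow> 'b) \<Rightarrow> 'a multiset \<Rightarrow> 'b::{real_normed_algebra_1, comm_ring_1, banach}" where
  "dmon j u \<alpha> = of_nat (count \<alpha> j) * mon u (\<alpha> - {#j#})"

text \<open>The partial derivative of the series in the variable \<open>j\<close>, evaluated at
  \<open>u\<close>. Termwise differentiation is bounded only well inside the polydisc, whence the
  bound 1/2 on \<open>u\<close> below.\<close>

definition dev :: "'a \<Rightarrow> ('a \<Rightarrow> 'b) \<Rightarrow> 'a multiset l1 \<Rightarrow> 'b::{real_normed_algebra_1, comm_ring_1, banach}" where
  "dev j u = lin_ext (dmon j u)"

lemma dmon_empty [simp]: "dmon j u {#} = 0"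
  by (simp add: dmon_def)

lemma dmon_add_mset: "dmon j u (add_mset k \<alpha>) = u k * dmon j u \<alpha> + (if k = j then mon u \<alpha> else 0)"
proof (cases "j \<in># \<alpha>")
  case True
  then obtain \<beta> where "\<alpha> = add_mset j \<beta>" by (meson multi_member_split)
  then show ?thesis by (cases "k = j") (auto simp: dmon_def algebra_simps)
qed (auto simp: dmon_def not_in_iff)

text \<open>The multiplicity grows with the degree, but the powers of 1/2 dominate it. Adding a
  factor turns a bound \<open>b\<close> into \<open>b / 2 + 1\<close>, whose fixed point is
  2.\<close>

lemma norm_dmon_le:
  assumes u: "\<And>i. norm (u i) \<le> 1 / 2"
  shows "norm (dmon j u \<alpha>) \<le> 2"
proof (induction \<alpha>)
  case (add k \<alpha>)
  have u1: "norm (u i) \<le> 1" for i using u[of i] by linarith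
  have "norm (dmon j u (add_mset k \<alpha>)) \<le> norm (u k) * norm (dmon j u \<alpha>) + norm (mon u \<alpha>)"
    unfolding dmon_add_mset by (rule norm_triangle_le) (intro add_mono norm_mult_ineq, simp)
  also have "\<dots> \<le> (1/2) * 2 + 1"
    by (intro add_mono mult_mono add.IH norm_mon_le_1 u u1) auto
  finally show ?case by simp
qed simp

lemma bounded_linear_dev: "(\<And>i. norm (u i) \<le> 1 / 2) \<Longrightarrow> bounded_linear (dev j u)"
  unfolding dev_def by (rule bounded_linear_lin[OF norm_dmon_le])

lemma ev_dev:
  fixes u :: "'a \<Rightarrow> 'c multiset l1"
  assumes u: "\<And>i. norm (u i) \<le> 1 / 2" and v: "\<And>i. norm (v i) \<le> 1"
  shows "ev v (dev j u c) = dev j (\<lambda>i. ev v (u i)) c"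
proof (rule l1_linear_ext[where c = c])
  show "bounded_linear (\<lambda>c. ev v (dev j u c))"
    by (rule bounded_linear_compose[OF bounded_linear_ev[OF v] bounded_linear_dev[OF u]])
  show "bounded_linear (dev j (\<lambda>i. ev v (u i)))"
    by (rule bounded_linear_dev) (rule order_trans[OF norm_ev_le[OF v] u])
  fix \<alpha>
  have "ev v (dmon j u \<alpha>) = dmon j (\<lambda>i. ev v (u i)) \<alpha>"
    by (induction \<alpha>) (auto simp: dmon_add_mset ev_linear[OF v] ev_mult[OF v] ev_mon[OF v])
  then show "ev v (dev j u (unit_l1 \<alpha>)) = dev j (\<lambda>i. ev v (u i)) (unit_l1 \<alpha>)"
    by (simp add: dev_def)
qed

text \<open>The bound must not depend on the degree: adding a factor turns \<open>b\<close> into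
  \<open>b / 2 + \<delta>\<close>, whose fixed point is \<open>2 * \<delta>\<close>.\<close>

lemma norm_mon_diff_le:
  fixes u w :: "'a \<Rightarrow> 'b::{real_normed_algebra_1, comm_ring_1}"
  assumes u: "\<And>i. norm (u i) \<le> 1 / 2" and w: "\<And>i. norm (w i) \<le> 1 / 2"
    and d: "\<And>i. norm (w i - u i) \<le> \<delta>"
  shows "norm (mon w \<alpha> - mon u \<alpha>) \<le> 2 * \<delta>"
proof (induction \<alpha>)
  case empty
  show ?case using order_trans[OF norm_ge_zero d] by simp
next
  case (add k \<alpha>)
  have d0: "0 \<le> \<delta>" using order_trans[OF norm_ge_zero d] .
  have u1: "norm (u i) \<le> 1" for i using u[of i] by linarith
  have "mon w (add_mset k \<alpha>) - mon u (add_mset k \<alpha>) = w k * (mon w \<alpha> - mon u \<alpha>) + (w k - u k) * mon u \<alpha>"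
    by (simp add: algebra_simps)
  also have "norm \<dots> \<le> norm (w k) * norm (mon w \<alpha> - mon u \<alpha>) + norm (w k - u k) * norm (mon u \<alpha>)"
    by (rule norm_triangle_le) (intro add_mono norm_mult_ineq)
  also have "\<dots> \<le> (1/2) * (2 * \<delta>) + \<delta> * 1"
    using d0 by (intro add_mono mult_mono add.IH norm_mon_le_1 w d u1) auto
  finally show ?case by simp
qed

text \<open>Adding a factor turns a bound \<open>b\<close> into
  \<open>b / 2 + 2 * \<delta>\<^sup>2\<close>, the new term being an increment times the difference
  bounded in \<open>norm_mon_diff_le\<close>. The fixed point is
  \<open>4 * \<delta>\<^sup>2\<close>.\<close>

lemma norm_mon_taylor_le:
  fixes u w :: "'a \<Rightarrow> 'b::{real_normed_algebra_1, comm_ring_1, banach}"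
  assumes I: "finite I" "\<And>i. i \<notin> I \<Longrightarrow> w i = u i"
    and u: "\<And>i. norm (u i) \<le> 1 / 2" and w: "\<And>i. norm (w i) \<le> 1 / 2"
    and d: "\<And>i. norm (w i - u i) \<le> \<delta>"
  shows "norm (mon w \<alpha> - mon u \<alpha> - (\<Sum>i\<in>I. dmon i u \<alpha> * (w i - u i))) \<le> 4 * \<delta>\<^sup>2"
proof (induction \<alpha>)
  case (add k \<alpha>)
  have d0: "0 \<le> \<delta>" using order_trans[OF norm_ge_zero d] .
  let ?R = "mon w \<alpha> - mon u \<alpha> - (\<Sum>i\<in>I. dmon i u \<alpha> * (w i - u i))"
  have "(\<Sum>i\<in>I. dmon i u (add_mset k \<alpha>) * (w i - u i))
      = (\<Sum>i\<in>I. u k * (dmon i u \<alpha> * (w i - u i)) + (if i = k then mon u \<alpha> * (w k - u k) else 0))"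
    by (rule sum.cong) (auto simp: dmon_add_mset algebra_simps)
  also have "\<dots> = u k * (\<Sum>i\<in>I. dmon i u \<alpha> * (w i - u i)) + mon u \<alpha> * (w k - u k)"
    using I by (auto simp: sum.distrib sum_distrib_left)
  finally have "mon w (add_mset k \<alpha>) - mon u (add_mset k \<alpha>) - (\<Sum>i\<in>I. dmon i u (add_mset k \<alpha>) * (w i - u i))
      = u k * ?R + (w k - u k) * (mon w \<alpha> - mon u \<alpha>)"
    by (simp add: algebra_simps)
  also have "norm \<dots> \<le> norm (u k) * norm ?R + norm (w k - u k) * norm (mon w \<alpha> - mon u \<alpha>)"
    by (rule norm_triangle_le) (intro add_mono norm_mult_ineq)
  also have "\<dots> \<le> (1/2) * (4 * \<delta>\<^sup>2) + \<delta> * (2 * \<delta>)"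
    using d0 by (intro add_mono mult_mono add.IH u d norm_mon_diff_le[OF u w d]) auto
  finally show ?case by (simp add: power2_eq_square)
qed simp

text \<open>The remainder is bounded and linear in \<open>c\<close>, so the degree-free bound on
  monomials carries over to series.\<close>

lemma norm_ev_taylor_le:
  fixes u w :: "'a \<Rightarrow> 'b::{real_normed_algebra_1, comm_ring_1, banach}"
  assumes I: "finite I" "\<And>i. i \<notin> I \<Longrightarrow> w i = u i"
    and u: "\<And>i. norm (u i) \<le> 1 / 2" and w: "\<And>i. norm (w i) \<le> 1 / 2"
    and d: "\<And>i. norm (w i - u i) \<le> \<delta>"
  shows "norm (ev w c - ev u c - (\<Sum>i\<in>I. dev i u c * (w i - u i))) \<le> 4 * \<delta>\<^sup>2 * norm c"
proof -
  have u1: "norm (u i) \<le> 1" and w1: "norm (w i) \<le> 1" for i using u[of i] w[of i] by linarith+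
  let ?e = "\<lambda>\<alpha>. mon w \<alpha> - mon u \<alpha> - (\<Sum>i\<in>I. dmon i u \<alpha> * (w i - u i))"
  note b = norm_mon_taylor_le[where I = I and w = w and u = u, OF I u w d]
  have bl: "bounded_linear (\<lambda>c. ev w c - ev u c - (\<Sum>i\<in>I. dev i u c * (w i - u i)))"
    by (intro bounded_linear_sub bounded_linear_sum bounded_linear_ev u1 w1
        bounded_linear_mult_const bounded_linear_dev u)
  have "ev w c - ev u c - (\<Sum>i\<in>I. dev i u c * (w i - u i)) = lin_ext ?e c"
    by (rule l1_linear_ext[where c = c, OF bl bounded_linear_lin[OF b]]) (auto simp: dev_def)
  then show ?thesis using lin_norm_le[OF b, where c = c] by simp
qed

text \<open>The Lipschitz constant of the remainder shrinks with \<open>m\<close>, which makes the Newton iteration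
  for the implicit function below a contraction.\<close>

lemma norm_ev_diff_le:
  fixes u w :: "'a \<Rightarrow> 'b::{real_normed_algebra_1, comm_ring_1, banach}"
  assumes j: "\<And>i. i \<noteq> j \<Longrightarrow> w i = u i" and m: "m \<le> 1 / 2"
    and u: "\<And>i. norm (u i) \<le> m" and w: "\<And>i. norm (w i) \<le> m"
  shows "norm (ev w c - ev u c - cf c {#j#} *\<^sub>R (w j - u j)) \<le> 3 * m * norm (w j - u j) * norm c"
proof -
  have m0: "0 \<le> m" using order_trans[OF norm_ge_zero u] .
  have u1: "norm (u i) \<le> 1 / 2" and w1: "norm (w i) \<le> 1 / 2" and m1: "m \<le> 1" for i
    using order_trans[OF u m] order_trans[OF w m] m by simp_all
  have u2: "norm (u i) \<le> 1" and w2: "norm (w i) \<le> 1" for i using u1[of i] w1[of i] by linarith+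
  have d: "norm (w i - u i) \<le> norm (w j - u j)" for i
    using j[of i] by (cases "i = j") auto
  \<comment> \<open>The monomial \<open>{#j#}\<close> carries the whole linear part, since the other
    coordinates agree. In each remaining nonconstant monomial an extra factor of norm at most
    \<open>m\<close> is left over; the 3 is 2 from the difference bound plus 1.\<close>
  let ?e = "\<lambda>\<alpha>. mon w \<alpha> - mon u \<alpha> - (if \<alpha> = {#j#} then w j - u j else 0)"
  have b: "norm (?e \<alpha>) \<le> 3 * m * norm (w j - u j)" for \<alpha>
  proof (cases \<alpha>)
    case (add k \<beta>)
    show ?thesis
    proof (cases "\<beta> = {#}")
      case True
      then show ?thesis using add j[of k] m0 by auto
    next
      case False
      have "?e \<alpha> = w k * (mon w \<beta> - mon u \<beta>) + (w k - u k) * mon u \<beta>"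
        using add False by (simp add: algebra_simps)
      also have "norm \<dots> \<le> norm (w k) * norm (mon w \<beta> - mon u \<beta>) + norm (w k - u k) * norm (mon u \<beta>)"
        by (rule norm_triangle_le) (intro add_mono norm_mult_ineq)
      also have "\<dots> \<le> m * (2 * norm (w j - u j)) + norm (w j - u j) * m"
        using m0 by (intro add_mono mult_mono w d norm_mon_diff_le[OF u1 w1 d]
            norm_mon_le_m[OF u m1 False]) auto
      finally show ?thesis by (simp add: algebra_simps)
    qed
  qed (use m0 in simp)
  have cb: "bounded_linear (\<lambda>c::'a multiset l1. cf c \<alpha>)" for \<alpha>
    by (rule bounded_linear_intro[of _ 1]) (auto simp: norm_cf_le)
  have bl: "bounded_linear (\<lambda>c. ev w c - ev u c - cf c {#j#} *\<^sub>R (w j - u j))"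
    by (intro bounded_linear_sub bounded_linear_ev u2 w2 bounded_linear_scaleR_const cb)
  have "ev w c - ev u c - cf c {#j#} *\<^sub>R (w j - u j) = lin_ext ?e c"
    by (rule l1_linear_ext[where c = c, OF bl bounded_linear_lin[OF b]]) auto
  then show ?thesis using lin_norm_le[OF b, where c = c] by simp
qed

text \<open>Every nonconstant monomial contains a factor of norm at most \<open>m\<close>. This
  gives continuity at the centre and makes a series small, up to its constant term, after a
  dilation.\<close>

lemma norm_ev_minus_const_le:
  fixes u :: "'a \<Rightarrow> 'b::{real_normed_algebra_1, comm_ring_1, banach}"
  assumes m: "m \<le> 1" and u: "\<And>i. norm (u i) \<le> m"
  shows "norm (ev u c - cf c {#} *\<^sub>R 1) \<le> m * norm c"
proof -
  have m0: "0 \<le> m" using order_trans[OF norm_ge_zero u] .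
  have u1: "norm (u i) \<le> 1" for i using order_trans[OF u m] .
  have b: "norm (mon u \<alpha> - (if \<alpha> = {#} then 1 else 0)) \<le> m" for \<alpha>
    using norm_mon_le_m[OF u m] m0 by auto
  have cb: "bounded_linear (\<lambda>c::'a multiset l1. cf c \<alpha>)" for \<alpha>
    by (rule bounded_linear_intro[of _ 1]) (auto simp: norm_cf_le)
  have bl: "bounded_linear (\<lambda>c. ev u c - cf c {#} *\<^sub>R (1::'b))"
    by (intro bounded_linear_sub bounded_linear_ev u1 bounded_linear_scaleR_const cb)
  have "ev u c - cf c {#} *\<^sub>R 1 = lin_ext (\<lambda>\<alpha>. mon u \<alpha> - (if \<alpha> = {#} then 1 else 0)) c"
    by (rule l1_linear_ext[where c = c, OF bl bounded_linear_lin[OF b]]) auto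
  then show ?thesis using lin_norm_le[OF b, where c = c] by simp
qed

lemma ev_zero: "(\<And>i. u i = 0) \<Longrightarrow> ev u c = cf c {#} *\<^sub>R 1"
  using norm_ev_minus_const_le[of 0 u c] by simp

definition half :: "'a \<Rightarrow> 'a multiset l1" where
  "half i = (1/2) *\<^sub>R var i"

lemma norm_half [simp]: "norm (half i) = 1 / 2"
  by (simp add: half_def)

text \<open>Formal derivative, precomposed with the dilation by \<open>1/2\<close> so that it stays summable.\<close>

definition fderiv :: "'a \<Rightarrow> 'a multiset l1 \<Rightarrow> 'a multiset l1" where
  "fderiv j = dev j half"

lemma of_nat_scaleR: "of_nat n * x = real n *\<^sub>R x" for x :: "'b::real_normed_algebra_1"
  by (induction n) (auto simp: algebra_simps)

lemma fderiv_unit: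
  "fderiv (j :: 'a) (unit_l1 \<alpha>) = (real (count \<alpha> j) * (1/2) ^ (size \<alpha> - 1)) *\<^sub>R unit_l1 (\<alpha> - {#j#})"
proof -
  have "mon half \<beta> = (1/2) ^ size \<beta> *\<^sub>R unit_l1 \<beta>" for \<beta> :: "'a multiset"
    unfolding half_def mon_scale mon_var ..
  moreover have "size (\<alpha> - {#j#}) = size \<alpha> - 1" if "j \<in># \<alpha>" using that by (rule size_Diff_singleton)
  ultimately show ?thesis
    by (cases "j \<in># \<alpha>") (auto simp: fderiv_def dev_def dmon_def not_in_iff
        of_nat_scaleR[where 'b = "'a multiset l1"])
qed

lemma bounded_linear_fderiv: "bounded_linear (fderiv j)"
  unfolding fderiv_def by (rule bounded_linear_dev) simp

text \<open>Symmetry of second partials, checked on monomials: the two dilations contribute the same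
  power of 1/2 in either order, as it depends only on the size of the exponent.\<close>

lemma fderiv_commute: "fderiv i (fderiv j c) = fderiv j (fderiv i c)"
proof (rule l1_linear_ext[where c = c, OF bounded_linear_compose bounded_linear_compose,
      OF bounded_linear_fderiv bounded_linear_fderiv bounded_linear_fderiv bounded_linear_fderiv])
  fix \<alpha> :: "'a multiset"
  have "fderiv i (fderiv j (unit_l1 \<alpha>)) = (real (count \<alpha> j) * real (count (\<alpha> - {#j#}) i)
      * ((1/2) ^ (size \<alpha> - 1) * (1/2) ^ (size \<alpha> - 2))) *\<^sub>R unit_l1 (\<alpha> - {#i#} - {#j#})" for i j
  proof (cases "j \<in># \<alpha>")
    case True
    then have "size (\<alpha> - {#j#}) = size \<alpha> - 1" by (rule size_Diff_singleton)
    then show ?thesis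
      by (simp add: fderiv_unit linear_simps[OF bounded_linear_fderiv] numeral_2_eq_2
          mult_ac add_mset_commute)
  qed (simp add: fderiv_unit not_in_iff linear_simps[OF bounded_linear_fderiv])
  moreover have "real (count \<alpha> j) * real (count (\<alpha> - {#j#}) i) = real (count \<alpha> i) * real (count (\<alpha> - {#i#}) j)"
    by (cases "i = j") auto
  ultimately show "fderiv i (fderiv j (unit_l1 \<alpha>)) = fderiv j (fderiv i (unit_l1 \<alpha>))"
    by (simp add: add_mset_commute)
qed

lemma ev_fderiv:
  assumes "\<And>i. norm (v i) \<le> 1"
  shows "ev v (fderiv j c) = dev j (\<lambda>i. v i /\<^sub>R 2) c"
proof -
  have "ev v (half i) = v i /\<^sub>R 2" for i
    by (simp add: half_def ev_linear[OF assms])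
  then show ?thesis unfolding fderiv_def by (simp add: ev_dev assms)
qed

text \<open>The Taylor remainder is quadratic in the increment, and the increment divided by
  \<open>s - s0\<close> stays bounded. The field is left open because complex curves are needed for
  analytic continuation.\<close>

lemma has_field_derivative_ev:
  fixes \<gamma> :: "'b \<Rightarrow> 'a \<Rightarrow> 'b::{real_normed_field, banach}"
  assumes I: "finite I" and d: "\<And>i. i \<in> I \<Longrightarrow> ((\<lambda>s. \<gamma> s i) has_field_derivative d i) (at s0)"
    and out: "\<And>i s. i \<notin> I \<Longrightarrow> \<gamma> s i = 0"
    and lt: "\<And>i. i \<in> I \<Longrightarrow> norm (\<gamma> s0 i) < 1 / 2"
  shows "((\<lambda>s. ev (\<gamma> s) c) has_field_derivative (\<Sum>i\<in>I. dev i (\<gamma> s0) c * d i)) (at s0)"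
proof -
  let ?\<delta> = "\<lambda>s. \<Sum>i\<in>I. norm (\<gamma> s i - \<gamma> s0 i)"
  let ?R = "\<lambda>s. ev (\<gamma> s) c - ev (\<gamma> s0) c - (\<Sum>i\<in>I. dev i (\<gamma> s0) c * (\<gamma> s i - \<gamma> s0 i))"
  have lim: "((\<lambda>s. \<gamma> s i) \<longlongrightarrow> \<gamma> s0 i) (at s0)" if "i \<in> I" for i
    using DERIV_isCont[OF d[OF that]] by (simp add: isCont_def)
  have dq: "((\<lambda>s. (\<gamma> s i - \<gamma> s0 i) / (s - s0)) \<longlongrightarrow> d i) (at s0)" if "i \<in> I" for i
    using d[OF that] by (simp add: has_field_derivative_iff)
  have small: "\<forall>\<^sub>F s in at s0. \<forall>i\<in>I. norm (\<gamma> s i) < 1 / 2"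
    using I lt by (intro eventually_ball_finite ballI order_tendstoD(2)[OF tendsto_norm[OF lim]]) auto
  have bound: "\<forall>\<^sub>F s in at s0. norm (?R s / (s - s0)) \<le> 4 * ?\<delta> s * norm c * (\<Sum>i\<in>I. norm ((\<gamma> s i - \<gamma> s0 i) / (s - s0)))"
    using small eventually_neq_at_within[of s0 s0 UNIV]
  proof eventually_elim
    case (elim s)
    have h: "norm (\<gamma> s i) \<le> 1 / 2" "norm (\<gamma> s0 i) \<le> 1 / 2" for i
      using elim(1) lt[of i] out[of i] by (cases "i \<in> I"; force)+
    have dd: "norm (\<gamma> s i - \<gamma> s0 i) \<le> ?\<delta> s" for i
      using out[of i] I by (cases "i \<in> I") (auto intro: member_le_sum sum_nonneg)
    have "norm (?R s) \<le> 4 * (?\<delta> s)\<^sup>2 * norm c"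
      by (rule norm_ev_taylor_le[OF I _ h(2) h(1) dd]) (simp add: out)
    then have "norm (?R s / (s - s0)) \<le> 4 * (?\<delta> s)\<^sup>2 * norm c / norm (s - s0)"
      by (simp add: norm_divide divide_right_mono)
    also have "\<dots> = 4 * ?\<delta> s * norm c * (?\<delta> s / norm (s - s0))"
      by (simp add: power2_eq_square)
    also have "?\<delta> s / norm (s - s0) = (\<Sum>i\<in>I. norm ((\<gamma> s i - \<gamma> s0 i) / (s - s0)))"
      by (simp add: norm_divide sum_divide_distrib)
    finally show ?case .
  qed
  have "((\<lambda>s. 4 * ?\<delta> s * norm c * (\<Sum>i\<in>I. norm ((\<gamma> s i - \<gamma> s0 i) / (s - s0)))) \<longlongrightarrow>
      4 * (\<Sum>i\<in>I. norm (\<gamma> s0 i - \<gamma> s0 i)) * norm c * (\<Sum>i\<in>I. norm (d i))) (at s0)"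
    by (intro tendsto_intros lim dq)
  then have "((\<lambda>s. ?R s / (s - s0)) \<longlongrightarrow> 0) (at s0)"
    by (intro Lim_null_comparison[OF bound]) simp
  moreover have "((\<lambda>s. \<Sum>i\<in>I. dev i (\<gamma> s0) c * ((\<gamma> s i - \<gamma> s0 i) / (s - s0))) \<longlongrightarrow> (\<Sum>i\<in>I. dev i (\<gamma> s0) c * d i)) (at s0)"
    by (intro tendsto_intros dq)
  ultimately have "((\<lambda>s. ?R s / (s - s0) + (\<Sum>i\<in>I. dev i (\<gamma> s0) c * ((\<gamma> s i - \<gamma> s0 i) / (s - s0))))
      \<longlongrightarrow> 0 + (\<Sum>i\<in>I. dev i (\<gamma> s0) c * d i)) (at s0)"
    by (rule tendsto_add)
  moreover have "?R s / (s - s0) + (\<Sum>i\<in>I. dev i (\<gamma> s0) c * ((\<gamma> s i - \<gamma> s0 i) / (s - s0)))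
      = (ev (\<gamma> s) c - ev (\<gamma> s0) c) / (s - s0)" for s
  proof -
    have "(\<Sum>i\<in>I. dev i (\<gamma> s0) c * ((\<gamma> s i - \<gamma> s0 i) / (s - s0)))
        = (\<Sum>i\<in>I. dev i (\<gamma> s0) c * (\<gamma> s i - \<gamma> s0 i)) / (s - s0)"
      by (simp add: sum_divide_distrib)
    then show ?thesis by (simp flip: add_divide_distrib)
  qed
  ultimately show ?thesis by (simp add: has_field_derivative_iff)
qed

section \<open>Locally analytic functions\<close>

abbreviation (input) near :: "jet \<Rightarrow> (jet \<Rightarrow> bool) \<Rightarrow> bool" where
  "near p Q \<equiv> eventually Q (nhds p)"

lemma tendsto_coord: "((\<lambda>q. q i) \<longlongrightarrow> p i) (nhds (p :: 'a \<Rightarrow> 'b::topological_space))"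
proof (rule topological_tendstoI)
  fix S :: "'b set" assume S: "open S" "p i \<in> S"
  have "open ((\<lambda>q :: 'a \<Rightarrow> 'b. q i) -` S)"
    by (rule open_vimage[OF S(1)]) (rule continuous_on_product_coordinates)
  then show "\<forall>\<^sub>F q in nhds p. q i \<in> S"
    using S(2) by (auto simp: eventually_nhds)
qed

lemma near_box:
  assumes "finite J" "r > 0"
  shows "near p (\<lambda>q. \<forall>i\<in>J. \<bar>q i - p i\<bar> < r)"
proof (intro eventually_ball_finite assms(1) ballI)
  fix i
  have "((\<lambda>q. \<bar>q i - p i\<bar>) \<longlongrightarrow> \<bar>p i - p i\<bar>) (nhds p)"
    by (intro tendsto_intros tendsto_coord)
  then show "near p (\<lambda>q. \<bar>q i - p i\<bar> < r)"
    using assms(2) by (intro order_tendstoD) auto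
qed

text \<open>A basic open set of the product topology restricts finitely many coordinates. Closed
  boxes are chosen to match the closed polydiscs of \<open>represents\<close>.\<close>

lemma near_iff_box:
  "near p Q \<longleftrightarrow> (\<exists>J r. finite J \<and> r > 0 \<and> (\<forall>q. (\<forall>i\<in>J. \<bar>q i - p i\<bar> \<le> r) \<longrightarrow> Q q))"
proof
  assume "near p Q"
  then obtain S where S: "open S" "p \<in> S" "\<And>q. q \<in> S \<Longrightarrow> Q q"
    by (auto simp: eventually_nhds)
  then obtain X where X: "p \<in> Pi\<^sub>E UNIV X" "\<And>i. open (X i)" "finite {i. X i \<noteq> UNIV}" "Pi\<^sub>E UNIV X \<subseteq> S"
    using product_topology_open_contains_basis[of "\<lambda>_. euclidean" UNIV S p]
    unfolding open_fun_def by auto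
  have "\<exists>r>0. \<forall>y. \<bar>y - p i\<bar> \<le> r \<longrightarrow> y \<in> X i" for i
  proof -
    have "p i \<in> X i" using X(1) by auto
    then obtain e where "e > 0" "cball (p i) e \<subseteq> X i" using X(2) open_contains_cball by metis
    then show ?thesis by (intro exI[of _ e]) (auto simp: dist_real_def subset_iff abs_minus_commute)
  qed
  then obtain r where r: "\<And>i. r i > 0" "\<And>i y. \<bar>y - p i\<bar> \<le> r i \<Longrightarrow> y \<in> X i" by metis
  define J where "J = {i. X i \<noteq> UNIV}"
  define R where "R = Min (insert 1 (r ` J))"
  have J: "finite J" using X(3) by (simp add: J_def)
  have R: "R > 0" "\<And>i. i \<in> J \<Longrightarrow> R \<le> r i" using J r(1) by (auto simp: R_def)
  have "Q q" if "\<forall>i\<in>J. \<bar>q i - p i\<bar> \<le> R" for q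
  proof -
    have "q i \<in> X i" for i
      using that r(2)[of "q i" i] R(2)[of i] by (cases "i \<in> J") (auto simp: J_def)
    then have "q \<in> S" using X(4) by auto
    then show ?thesis by (rule S(3))
  qed
  then show "\<exists>J r. finite J \<and> r > 0 \<and> (\<forall>q. (\<forall>i\<in>J. \<bar>q i - p i\<bar> \<le> r) \<longrightarrow> Q q)"
    using J R by blast
next
  assume "\<exists>J r. finite J \<and> r > 0 \<and> (\<forall>q. (\<forall>i\<in>J. \<bar>q i - p i\<bar> \<le> r) \<longrightarrow> Q q)"
  then obtain J r where "finite J" "r > 0" "\<And>q. (\<forall>i\<in>J. \<bar>q i - p i\<bar> \<le> r) \<Longrightarrow> Q q" by blast
  then show "near p Q"
    by (intro eventually_mono[OF near_box[of J r p]]) (auto intro: less_imp_le)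
qed

lemma near_at: "near p Q \<Longrightarrow> Q p"
  by (auto simp: eventually_nhds)

lemma near_near: "near p Q \<Longrightarrow> near p (\<lambda>q. near q Q)"
  by (simp add: eventually_eventually)

lemma tendsto_jetI:
  fixes \<gamma> :: "'s \<Rightarrow> jet"
  assumes "\<And>i. ((\<lambda>s. \<gamma> s i) \<longlongrightarrow> q i) F"
  shows "filterlim \<gamma> (nhds q) F"
  unfolding filterlim_iff
proof (intro allI impI)
  fix Q assume "near q Q"
  then obtain J r where J: "finite J" "r > 0" "\<And>q'. (\<forall>i\<in>J. \<bar>q' i - q i\<bar> \<le> r) \<Longrightarrow> Q q'"
    unfolding near_iff_box by blast
  have "\<forall>\<^sub>F s in F. \<forall>i\<in>J. \<bar>\<gamma> s i - q i\<bar> < r"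
    using tendstoD[OF assms J(2)] by (intro eventually_ball_finite J(1) ballI) (simp add: dist_real_def)
  then show "\<forall>\<^sub>F s in F. Q (\<gamma> s)"
    by eventually_elim (auto intro!: J(3) less_imp_le)
qed

lemma tendsto_fun_upd: "filterlim (\<lambda>s. q(j := s)) (nhds q) (nhds (q j))" for q :: jet
proof (rule tendsto_jetI)
  show "((\<lambda>s. (q(j := s)) i) \<longlongrightarrow> q i) (nhds (q j))" for i
    by (cases "i = j") (auto intro: filterlim_ident)
qed

lemma pd_cong:
  assumes "near p (\<lambda>q. h q = h' q)"
  shows "pd j h p = pd j h' p"
  unfolding pd_def
  by (rule deriv_cong_ev[OF eventually_compose_filterlim[OF assms tendsto_fun_upd] refl])

lemma near_pd_cong:
  assumes "near p (\<lambda>q. h q = h' q)"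
  shows "near p (\<lambda>q. pd j h q = pd j h' q)"
  using near_near[OF assms] by eventually_elim (rule pd_cong)

text \<open>Coordinates outside \<open>J\<close> become 0, so monomials in foreign variables
  evaluate to 0 and do no harm in a representing series.\<close>

definition scaled :: "dvar set \<Rightarrow> jet \<Rightarrow> real \<Rightarrow> jet \<Rightarrow> dvar \<Rightarrow> real" where
  "scaled J p r q i = (if i \<in> J then (q i - p i) / r else 0)"

text \<open>The box is closed because it corresponds to the closed unit polydisc, on all of which
  the elements of the algebra converge.\<close>

definition represents :: "dvar set \<Rightarrow> jet \<Rightarrow> real \<Rightarrow> dvar multiset l1 \<Rightarrow> (jet \<Rightarrow> real) \<Rightarrow> bool" where
  "represents J p r c h \<longleftrightarrow> finite J \<and> r > 0 \<and>
     (\<forall>q. (\<forall>i\<in>J. \<bar>q i - p i\<bar> \<le> r) \<longrightarrow> h q = ev (scaled J p r q) c)"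

lemma norm_scaled_le: "r > 0 \<Longrightarrow> \<forall>i\<in>J. \<bar>q i - p i\<bar> \<le> r \<Longrightarrow> norm (scaled J p r q i) \<le> 1"
  by (auto simp: scaled_def)

lemma mon_eq_prod:
  fixes u :: "'a \<Rightarrow> 'b::comm_semiring_1"
  assumes "finite I" "set_mset A \<subseteq> I"
  shows "mon u A = (\<Prod>i\<in>I. u i ^ count A i)"
proof -
  have "mon u A = (\<Prod>i\<in>set_mset A. u i ^ count A i)"
    unfolding mon_def by (simp add: image_prod_mset_multiplicity)
  also have "\<dots> = (\<Prod>i\<in>I. u i ^ count A i)"
    by (rule prod.mono_neutral_left) (use assms in \<open>auto simp: not_in_iff\<close>)
  finally show ?thesis .
qed

text \<open>The dictionary between the exponent functions of \<open>analytic_in\<close> and the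
  multisets of the algebra.\<close>

lemma bij_betw_count:
  assumes "finite I"
  shows "bij_betw count {A. set_mset A \<subseteq> I} {\<alpha>. \<forall>i. i \<notin> I \<longrightarrow> \<alpha> i = 0}"
proof (rule bij_betwI[where g = Abs_multiset])
  have fin: "finite {i. 0 < \<alpha> i}" if "\<forall>i. i \<notin> I \<longrightarrow> \<alpha> i = 0" for \<alpha> :: "'a \<Rightarrow> nat"
    by (rule finite_subset[OF _ assms]) (use that in fastforce)
  show "count \<in> {A. set_mset A \<subseteq> I} \<rightarrow> {\<alpha>. \<forall>i. i \<notin> I \<longrightarrow> \<alpha> i = 0}"
    by (auto simp: count_eq_zero_iff)
  show "Abs_multiset \<in> {\<alpha>. \<forall>i. i \<notin> I \<longrightarrow> \<alpha> i = 0} \<rightarrow> {A. set_mset A \<subseteq> I}"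
    by (fastforce simp: set_mset_def fin count_Abs_multiset)
  show "Abs_multiset (count A) = A" for A :: "'a multiset" by (simp add: count_inverse)
  show "count (Abs_multiset \<alpha>) = \<alpha>" if "\<alpha> \<in> {\<alpha>. \<forall>i. i \<notin> I \<longrightarrow> \<alpha> i = 0}" for \<alpha>
    using that by (simp add: count_Abs_multiset fin)
qed

lemma analytic_in_imp_represents:
  assumes I: "finite I" and h: "analytic_in I h p"
  shows "\<exists>r c. represents I p r c h"
proof -
  obtain c r0 where r0: "r0 > 0" and c: "\<And>q. (\<forall>i\<in>I. \<bar>q i - p i\<bar> < r0) \<Longrightarrow>
      ((\<lambda>\<alpha>. c \<alpha> * (\<Prod>i\<in>I. (q i - p i) ^ \<alpha> i)) has_sum h q) {\<alpha>. \<forall>i. i \<notin> I \<longrightarrow> \<alpha> i = 0}"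
    using h unfolding analytic_in_def by blast
  \<comment> \<open>Halving keeps the closed polydisc, including its corner, inside the open
    polydisc of convergence.\<close>
  define r where "r = r0 / 2"
  have r: "r > 0" "r < r0" using r0 by (auto simp: r_def)
  let ?N = "{A. set_mset A \<subseteq> I}"
  have sumN: "((\<lambda>A. c (count A) * (\<Prod>i\<in>I. (q i - p i) ^ count A i)) has_sum h q) ?N"
    if "\<forall>i\<in>I. \<bar>q i - p i\<bar> < r0" for q
    using c[OF that] has_sum_reindex_bij_betw[OF bij_betw_count[OF I],
        of "\<lambda>\<alpha>. c \<alpha> * (\<Prod>i\<in>I. (q i - p i) ^ \<alpha> i)"] by simp
  define k where "k A = (if set_mset A \<subseteq> I then c (count A) * r ^ size A else 0)" for A
  have rpow: "r ^ size A = (\<Prod>i\<in>I. r ^ count A i)" if "set_mset A \<subseteq> I" for A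
  proof -
    have "r ^ size A = mon (\<lambda>_. r) A" by (induction A) auto
    then show ?thesis using mon_eq_prod[OF I that] by simp
  qed
  have "(\<lambda>A. \<bar>k A\<bar>) summable_on UNIV"
  proof -
    \<comment> \<open>At the corner \<open>p + r\<close> the terms of the series are exactly the
      rescaled coefficients \<open>k\<close>. Unordered convergence of reals is absolute, so they
      are absolutely summable.\<close>
    have "((\<lambda>A. c (count A) * (\<Prod>i\<in>I. ((p i + r) - p i) ^ count A i)) has_sum h (\<lambda>i. p i + r)) ?N"
      by (rule sumN) (use r in auto)
    then have "(\<lambda>A. c (count A) * (\<Prod>i\<in>I. ((p i + r) - p i) ^ count A i)) summable_on ?N"
      by (rule has_sum_imp_summable)
    then have "k summable_on ?N"
      by (rule summable_on_cong[THEN iffD1, rotated]) (simp add: k_def rpow)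
    then have "(\<lambda>A. \<bar>k A\<bar>) summable_on ?N"
      using summable_on_iff_abs_summable_on_real by force
    then show ?thesis
      by (rule summable_on_cong_neutral[THEN iffD1, rotated -1]) (auto simp: k_def)
  qed
  then have cfk: "cf (Abs_l1 k) = k" by (rule cf_Abs_l1)
  have "h q = ev (scaled I p r q) (Abs_l1 k)" if q: "\<forall>i\<in>I. \<bar>q i - p i\<bar> \<le> r" for q
  proof -
    have "((\<lambda>A. c (count A) * (\<Prod>i\<in>I. (q i - p i) ^ count A i)) has_sum h q) ?N"
      by (rule sumN) (use q r in force)
    moreover have "c (count A) * (\<Prod>i\<in>I. (q i - p i) ^ count A i) = k A * mon (scaled I p r q) A"
      if "set_mset A \<subseteq> I" for A
    proof -
      have "mon (scaled I p r q) A = (\<Prod>i\<in>I. ((q i - p i) / r) ^ count A i)"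
        unfolding mon_eq_prod[OF I that] by (rule prod.cong) (auto simp: scaled_def)
      then show ?thesis using that r
        by (simp add: k_def rpow[OF that, symmetric] power_divide prod_dividef)
    qed
    ultimately have "((\<lambda>A. k A * mon (scaled I p r q) A) has_sum h q) ?N"
      by (subst (asm) has_sum_cong) auto
    then have "((\<lambda>A. k A * mon (scaled I p r q) A) has_sum h q) UNIV"
      by (rule has_sum_cong_neutral[THEN iffD1, rotated -1]) (auto simp: k_def)
    moreover have "((\<lambda>A. k A * mon (scaled I p r q) A) has_sum ev (scaled I p r q) (Abs_l1 k)) UNIV"
      using ev_has_sum[of "scaled I p r q" "Abs_l1 k", OF norm_scaled_le[OF r(1) q]] by (simp add: cfk)
    ultimately show ?thesis by (rule has_sum_unique)
  qed
  then show ?thesis using I r by (auto simp: represents_def)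
qed

lemma represents_imp_analytic_in:
  assumes "represents I p r c h"
  shows "analytic_in I h p"
proof -
  have I: "finite I" and r: "r > 0"
    and h: "\<And>q. (\<forall>i\<in>I. \<bar>q i - p i\<bar> \<le> r) \<Longrightarrow> h q = ev (scaled I p r q) c"
    using assms unfolding represents_def by auto
  let ?N = "{A. set_mset A \<subseteq> I}" and ?M = "{\<alpha>. \<forall>i. i \<notin> I \<longrightarrow> \<alpha> i = 0}"
  define k where "k \<alpha> = cf c (Abs_multiset \<alpha>) / r ^ size (Abs_multiset \<alpha>)" for \<alpha>
  have rpow: "r ^ size A = (\<Prod>i\<in>I. r ^ count A i)" if "set_mset A \<subseteq> I" for A
  proof -
    have "r ^ size A = mon (\<lambda>_. r) A" by (induction A) auto
    then show ?thesis using mon_eq_prod[OF I that] by simp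
  qed
  have "((\<lambda>\<alpha>. k \<alpha> * (\<Prod>i\<in>I. (q i - p i) ^ \<alpha> i)) has_sum h q) ?M"
    if "\<forall>i\<in>I. \<bar>q i - p i\<bar> < r" for q
  proof -
    have q: "\<forall>i\<in>I. \<bar>q i - p i\<bar> \<le> r" using that by force
    have "((\<lambda>A. cf c A * mon (scaled I p r q) A) has_sum h q) UNIV"
      using ev_has_sum[of "scaled I p r q" c, OF norm_scaled_le[OF r q]] h[OF q] by simp
    then have "((\<lambda>A. cf c A * mon (scaled I p r q) A) has_sum h q) ?N"
    proof (rule has_sum_cong_neutral[THEN iffD1, rotated -1])
      fix A assume "A \<in> UNIV - ?N"
      then obtain i B where "i \<notin> I" "A = add_mset i B"
        by (metis DiffD2 mem_Collect_eq multi_member_split subsetI)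
      then show "cf c A * mon (scaled I p r q) A = 0" by (simp add: scaled_def)
    qed auto
    moreover have "cf c A * mon (scaled I p r q) A = k (count A) * (\<Prod>i\<in>I. (q i - p i) ^ count A i)"
      if "A \<in> ?N" for A
    proof -
      have A: "set_mset A \<subseteq> I" using that by simp
      have "mon (scaled I p r q) A = (\<Prod>i\<in>I. ((q i - p i) / r) ^ count A i)"
        unfolding mon_eq_prod[OF I A] by (rule prod.cong) (auto simp: scaled_def)
      then show ?thesis using r
        by (simp add: k_def rpow[OF A, symmetric] power_divide prod_dividef count_inverse)
    qed
    ultimately have "((\<lambda>A. k (count A) * (\<Prod>i\<in>I. (q i - p i) ^ count A i)) has_sum h q) ?N"
      by (subst (asm) has_sum_cong) auto
    then show ?thesis
      using has_sum_reindex_bij_betw[OF bij_betw_count[OF I], of "\<lambda>\<alpha>. k \<alpha> * (\<Prod>i\<in>I. (q i - p i) ^ \<alpha> i)"] by simp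
  qed
  then show ?thesis unfolding analytic_in_def using r by blast
qed

lemma locally_analytic_iff: "locally_analytic p h \<longleftrightarrow> (\<exists>J r c. represents J p r c h)"
  unfolding locally_analytic_def
  using analytic_in_imp_represents represents_imp_analytic_in represents_def by metis

text \<open>Shrinking the radius is the dilation by \<open>r' / r\<close>. Variables outside
  \<open>J\<close> are sent to 0, so that enlarging \<open>J\<close> does not revive monomials in
  foreign variables.\<close>

lemma represents_mono:
  assumes h: "represents J p r c h" and J': "finite J'" "J \<subseteq> J'" and r': "0 < r'" "r' \<le> r"
  shows "\<exists>c'. represents J' p r' c' h"
proof (intro exI)
  define u where "u i = (if i \<in> J then (r' / r) *\<^sub>R var i else 0)" for i
  have u: "norm (u i) \<le> 1" for i using r' by (auto simp: u_def)
  show "represents J' p r' (ev u c) h"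
    unfolding represents_def
  proof (intro conjI allI impI J' r')
    fix q assume q: "\<forall>i\<in>J'. \<bar>q i - p i\<bar> \<le> r'"
    note v = norm_scaled_le[OF r'(1) q]
    have "ev (scaled J' p r' q) (ev u c) = ev (\<lambda>i. ev (scaled J' p r' q) (u i)) c"
      by (rule ev_ev[OF u v])
    also have "(\<lambda>i. ev (scaled J' p r' q) (u i)) = scaled J p r q"
      using J' r' by (intro ext) (auto simp: u_def ev_linear[OF v] scaled_def)
    finally show "h q = ev (scaled J' p r' q) (ev u c)"
      using h q J'(2) r'(2) by (force simp: represents_def)
  qed
qed

text \<open>The claim covers all larger index sets and all smaller radii; this stability lets the
  induction merge two polydiscs.\<close>

lemma locally_analytic_common:
  assumes "finite I" "\<And>i. i \<in> I \<Longrightarrow> locally_analytic p (\<phi> i)"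
  shows "\<exists>J r. finite J \<and> r > 0 \<and> (\<forall>J' r'. finite J' \<and> J \<subseteq> J' \<and> 0 < r' \<and> r' \<le> r \<longrightarrow>
      (\<forall>i\<in>I. \<exists>c. represents J' p r' c (\<phi> i)))"
  using assms
proof (induction I)
  case empty
  show ?case by (intro exI[of _ "{}"] exI[of _ 1]) auto
next
  case (insert k I)
  then obtain J r where J: "finite J" "r > 0" "\<And>J' r' i. finite J' \<and> J \<subseteq> J' \<and> 0 < r' \<and> r' \<le> r \<Longrightarrow>
      i \<in> I \<Longrightarrow> \<exists>c. represents J' p r' c (\<phi> i)" by (metis insertI2)
  obtain K s d where K: "represents K p s d (\<phi> k)"
    using insert.prems[of k] by (auto simp: locally_analytic_iff)
  show ?case
  proof (intro exI[of _ "J \<union> K"] exI[of _ "min r s"] conjI allI impI ballI)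
    show "finite (J \<union> K)" "0 < min r s" using J K by (auto simp: represents_def)
    fix J' r' i assume "finite J' \<and> J \<union> K \<subseteq> J' \<and> 0 < r' \<and> r' \<le> min r s" "i \<in> insert k I"
    then show "\<exists>c. represents J' p r' c (\<phi> i)"
      using J(3)[of J' r' i] represents_mono[OF K, of J' r'] by auto
  qed
qed

lemma locally_analytic_common2:
  assumes "locally_analytic p a" "locally_analytic p b"
  obtains J r c d where "represents J p r c a" "represents J p r d b"
proof -
  obtain J r where "finite J" "r > 0" and *: "\<forall>J' r'. finite J' \<and> J \<subseteq> J' \<and> 0 < r' \<and> r' \<le> r \<longrightarrow>
      (\<forall>i\<in>UNIV. \<exists>c. represents J' p r' c (if i then a else b))"
    using locally_analytic_common[of "UNIV :: bool set" p "\<lambda>i. if i then a else b"] assms by force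
  then have "\<forall>i\<in>UNIV. \<exists>c. represents J p r c (if i then a else b)" by blast
  then show ?thesis using that by (metis UNIV_I)
qed

section \<open>Closure properties of locally analytic functions\<close>

lemma la_const [simp]: "locally_analytic p (\<lambda>q. a)"
proof -
  have "represents {} p 1 (a *\<^sub>R 1) (\<lambda>q. a)"
    by (auto simp: represents_def ev_linear scaled_def)
  then show ?thesis unfolding locally_analytic_iff by blast
qed

lemma la_coord [simp]: "locally_analytic p (\<lambda>q. q i)"
proof -
  have "represents {i} p 1 (p i *\<^sub>R 1 + var i) (\<lambda>q. q i)"
    unfolding represents_def
  proof (intro conjI allI impI)
    fix q assume q: "\<forall>j\<in>{i}. \<bar>q j - p j\<bar> \<le> 1"
    have v: "norm (scaled {i} p 1 q j) \<le> 1" for j using norm_scaled_le[OF _ q] by simp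
    show "q i = ev (scaled {i} p 1 q) (p i *\<^sub>R 1 + var i)"
      by (simp add: ev_linear[OF v]) (simp add: scaled_def)
  qed auto
  then show ?thesis unfolding locally_analytic_iff by blast
qed

lemma la_add [intro]:
  assumes "locally_analytic p a" "locally_analytic p b"
  shows "locally_analytic p (\<lambda>q. a q + b q)"
proof -
  obtain J r c d where "represents J p r c a" "represents J p r d b"
    using locally_analytic_common2[OF assms] .
  then have "represents J p r (c + d) (\<lambda>q. a q + b q)"
    by (auto simp: represents_def ev_linear[OF norm_scaled_le])
  then show ?thesis unfolding locally_analytic_iff by blast
qed

lemma la_mult [intro]:
  assumes "locally_analytic p a" "locally_analytic p b"
  shows "locally_analytic p (\<lambda>q. a q * b q)"
proof -
  obtain J r c d where "represents J p r c a" "represents J p r d b"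
    using locally_analytic_common2[OF assms] .
  then have "represents J p r (c * d) (\<lambda>q. a q * b q)"
    by (auto simp: represents_def ev_mult[OF norm_scaled_le])
  then show ?thesis unfolding locally_analytic_iff by blast
qed

lemma la_uminus [intro]: "locally_analytic p a \<Longrightarrow> locally_analytic p (\<lambda>q. - a q)"
  using la_mult[OF la_const[of p "-1"], of a] by simp

lemma la_diff [intro]:
  "locally_analytic p a \<Longrightarrow> locally_analytic p b \<Longrightarrow> locally_analytic p (\<lambda>q. a q - b q)"
  using la_add[OF _ la_uminus[of p b], of a] by simp

lemma la_sum [intro]:
  "(\<And>i. i \<in> I \<Longrightarrow> locally_analytic p (a i)) \<Longrightarrow> locally_analytic p (\<lambda>q. \<Sum>i\<in>I. a i q)"
  by (induction I rule: infinite_finite_induct) auto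

lemma la_cong:
  assumes "locally_analytic p h" "near p (\<lambda>q. h q = h' q)"
  shows "locally_analytic p h'"
proof -
  obtain J r c where h: "represents J p r c h" using assms(1) by (auto simp: locally_analytic_iff)
  obtain K s where K: "finite K" "s > 0" "\<And>q. (\<forall>i\<in>K. \<bar>q i - p i\<bar> \<le> s) \<Longrightarrow> h q = h' q"
    using assms(2) unfolding near_iff_box by blast
  have "finite (J \<union> K)" "0 < min r s" using h K by (auto simp: represents_def)
  then obtain c' where c': "represents (J \<union> K) p (min r s) c' h"
    using represents_mono[OF h, of "J \<union> K" "min r s"] by auto
  have "represents (J \<union> K) p (min r s) c' h'"
    using c' K(3) by (auto simp: represents_def) 
  then show ?thesis unfolding locally_analytic_iff by blast
qed

text \<open>Expansion at \<open>q0\<close> is the substitution of the constant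
  \<open>(q0 i - p i) / r\<close> plus \<open>half i\<close>. Each of the two has norm at most 1/2,
  hence the halved radius.\<close>

lemma represents_recentre:
  assumes h: "represents J p r c h" and q0: "\<forall>i\<in>J. \<bar>q0 i - p i\<bar> \<le> r / 2"
  shows "\<exists>c'. represents J q0 (r / 2) c' h"
proof (intro exI)
  have r: "r > 0" using h by (simp add: represents_def)
  define u where "u i = (if i \<in> J then ((q0 i - p i) / r) *\<^sub>R 1 + half i else 0)" for i
  have u: "norm (u i) \<le> 1" for i
  proof (cases "i \<in> J")
    case True
    then have "\<bar>q0 i - p i\<bar> / r \<le> 1 / 2" using q0 r by (simp add: field_simps)
    then have "norm (((q0 i - p i) / r) *\<^sub>R (1 :: dvar multiset l1)) + norm (half i) \<le> 1"
      using r by (simp add: field_simps)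
    from norm_triangle_le[OF this] show ?thesis using True by (simp add: u_def)
  qed (simp add: u_def)
  show "represents J q0 (r / 2) (ev u c) h"
    unfolding represents_def
  proof (intro conjI allI impI)
    show "finite J" "r / 2 > 0" using h r by (auto simp: represents_def)
    fix q assume q: "\<forall>i\<in>J. \<bar>q i - q0 i\<bar> \<le> r / 2"
    have "norm (scaled J q0 (r / 2) q i) \<le> 1" for i using norm_scaled_le[OF _ q] r by simp
    note v = this
    have "ev (scaled J q0 (r / 2) q) (ev u c) = ev (\<lambda>i. ev (scaled J q0 (r / 2) q) (u i)) c"
      by (rule ev_ev[OF u v])
    also have "(\<lambda>i. ev (scaled J q0 (r / 2) q) (u i)) = scaled J p r q"
    proof
      fix i
      show "ev (scaled J q0 (r / 2) q) (u i) = scaled J p r q i"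
      proof (cases "i \<in> J")
        case True
        then have "ev (scaled J q0 (r / 2) q) (u i) = (q0 i - p i) / r + scaled J q0 (r / 2) q i / 2"
          by (simp add: u_def half_def ev_linear[OF v])
        also have "\<dots> = scaled J p r q i"
          using True r by (simp add: scaled_def field_simps)
        finally show ?thesis .
      qed (simp add: u_def scaled_def ev_linear[OF v])
    qed
    finally have "ev (scaled J q0 (r / 2) q) (ev u c) = ev (scaled J p r q) c" .
    moreover have "\<forall>i\<in>J. \<bar>q i - p i\<bar> \<le> r"
    proof
      fix i assume "i \<in> J"
      then have "\<bar>q i - q0 i\<bar> \<le> r / 2" "\<bar>q0 i - p i\<bar> \<le> r / 2" using q q0 by auto
      then show "\<bar>q i - p i\<bar> \<le> r" by linarith
    qed
    ultimately show "h q = ev (scaled J q0 (r / 2) q) (ev u c)"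
      using h by (simp add: represents_def)
  qed
qed

lemma near_la:
  assumes "locally_analytic p h"
  shows "near p (\<lambda>q. locally_analytic q h)"
proof -
  obtain J r c where h: "represents J p r c h" using assms by (auto simp: locally_analytic_iff)
  then have "finite J" "r / 2 > 0" by (auto simp: represents_def)
  then show ?thesis unfolding near_iff_box locally_analytic_iff
    using represents_recentre[OF h] by meson
qed

lemma la_tendsto:
  assumes "locally_analytic p h"
  shows "(h \<longlongrightarrow> h p) (nhds p)"
proof (rule tendstoI)
  fix e :: real assume e: "e > 0"
  obtain J r c where h: "represents J p r c h" using assms by (auto simp: locally_analytic_iff)
  \<comment> \<open>The added 1 covers \<open>c = 0\<close> and makes the final inequality
    strict.\<close>
  define m where "m = min 1 (e / (norm c + 1))"
  have nc: "norm c + 1 > 0" using norm_ge_zero[of c] by linarith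
  have m: "m > 0" "m \<le> 1" "m * norm c < e"
  proof -
    show "m > 0" "m \<le> 1" using e nc by (auto simp: m_def)
    have "m * norm c \<le> e / (norm c + 1) * norm c" by (intro mult_right_mono) (auto simp: m_def)
    also have "\<dots> < e" using e nc by (simp add: field_simps)
    finally show "m * norm c < e" .
  qed
  have r: "finite J" "r > 0" using h by (auto simp: represents_def)
  have "h p = cf c {#}"
    using h r by (simp add: represents_def ev_zero[of "scaled J p r p"] scaled_def)
  have "dist (h q) (h p) < e" if q: "\<forall>i\<in>J. \<bar>q i - p i\<bar> \<le> m * r" for q
  proof -
    have mr: "m * r \<le> r" using m r by (simp add: mult_left_le_one_le)
    have b: "norm (scaled J p r q i) \<le> m" for i
      using q r m by (auto simp: scaled_def field_simps)
    have "h q = ev (scaled J p r q) c"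
      using h order_trans[OF _ mr] q unfolding represents_def by blast
    then show ?thesis
      using norm_ev_minus_const_le[where u = "scaled J p r q" and c = c, OF m(2) b] m(3) \<open>h p = _\<close> by (simp add: dist_real_def)
  qed
  then show "near p (\<lambda>q. dist (h q) (h p) < e)"
    unfolding near_iff_box using r m by (meson mult_pos_pos)
qed

lemma near_la_nonzero: "locally_analytic p h \<Longrightarrow> h p \<noteq> 0 \<Longrightarrow> near p (\<lambda>q. h q \<noteq> 0)"
  using tendsto_imp_eventually_ne[OF la_tendsto] by blast

text \<open>The inner series, freed of their constant terms and divided by \<open>r\<close>, are
  substituted into the outer one. A dilation by a small \<theta> makes them fit into its unit
  polydisc.\<close>

lemma la_compose:
  assumes h: "locally_analytic (\<phi> p) h" and \<phi>: "\<And>i. locally_analytic p (\<lambda>q. \<phi> q i)"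
  shows "locally_analytic p (\<lambda>q. h (\<phi> q))"
proof -
  obtain I r c where c: "represents I (\<phi> p) r c h" using h by (auto simp: locally_analytic_iff)
  then have I: "finite I" and r: "r > 0" by (auto simp: represents_def)
  obtain J r1 where J: "finite J" "r1 > 0" and "\<forall>J' r'. finite J' \<and> J \<subseteq> J' \<and> 0 < r' \<and> r' \<le> r1 \<longrightarrow>
      (\<forall>i\<in>I. \<exists>c. represents J' p r' c (\<lambda>q. \<phi> q i))"
    using locally_analytic_common[OF I, of p "\<lambda>i q. \<phi> q i"] \<phi> by blast
  then have "\<forall>i\<in>I. \<exists>c. represents J p r1 c (\<lambda>q. \<phi> q i)" by blast
  then obtain d where d: "\<And>i. i \<in> I \<Longrightarrow> represents J p r1 (d i) (\<lambda>q. \<phi> q i)" by metis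
  define M where "M = (\<Sum>i\<in>I. norm (d i)) + 1"
  have M: "M > 0" "\<And>i. i \<in> I \<Longrightarrow> norm (d i) \<le> M"
    using I sum_nonneg[of I "\<lambda>i. norm (d i)"] member_le_sum[of _ I "\<lambda>i. norm (d i)"]
    by (fastforce simp: M_def)+
  define \<theta> where "\<theta> = min 1 (r / M)"
  have \<theta>: "\<theta> > 0" "\<theta> \<le> 1" "\<theta> * M \<le> r"
    using r M by (auto simp: \<theta>_def min_def field_simps)
  define w where "w i = \<theta> *\<^sub>R var i" for i :: dvar
  have w: "norm (w i) \<le> \<theta>" and w1: "norm (w i) \<le> 1" for i using \<theta> by (auto simp: w_def)
  have dp: "cf (d i) {#} = \<phi> p i" if "i \<in> I" for i
    using d[OF that] J by (simp add: represents_def ev_zero[of "scaled J p r1 p"] scaled_def)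
  define u where "u i = (if i \<in> I then (1 / r) *\<^sub>R (ev w (d i) - \<phi> p i *\<^sub>R 1) else 0)" for i
  have u: "norm (u i) \<le> 1" for i
  proof (cases "i \<in> I")
    case True
    have "norm (ev w (d i) - \<phi> p i *\<^sub>R 1) \<le> \<theta> * norm (d i)"
      using norm_ev_minus_const_le[where u = w and c = "d i", OF \<theta>(2) w] by (simp add: dp True)
    also have "\<dots> \<le> \<theta> * M" using \<theta> M True by (intro mult_left_mono) auto
    finally have "norm (ev w (d i) - \<phi> p i *\<^sub>R 1) \<le> r" using \<theta>(3) by linarith
    then have "norm (ev w (d i) - \<phi> p i *\<^sub>R 1) / r \<le> 1" using r by simp
    then show ?thesis using r True by (simp add: u_def del: scaleR_right_diff_distrib)
  qed (simp add: u_def)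
  have "represents J p (\<theta> * r1) (ev u c) (\<lambda>q. h (\<phi> q))"
    unfolding represents_def
  proof (intro conjI allI impI)
    show "finite J" "\<theta> * r1 > 0" using J \<theta> by auto
    fix q assume q: "\<forall>i\<in>J. \<bar>q i - p i\<bar> \<le> \<theta> * r1"
    let ?v = "scaled J p (\<theta> * r1) q"
    have v: "norm (?v i) \<le> 1" for i using norm_scaled_le[OF _ q] \<theta> J by simp
    have tr: "\<theta> * r1 \<le> r1" using \<theta> J by (simp add: mult_left_le_one_le)
    have evd: "ev ?v (ev w (d i)) = \<phi> q i" if "i \<in> I" for i
    proof -
      have "ev ?v (ev w (d i)) = ev (\<lambda>i. ev ?v (w i)) (d i)" by (rule ev_ev[OF w1 v])
      also have "(\<lambda>i. ev ?v (w i)) = scaled J p r1 q"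
        using \<theta> by (intro ext) (auto simp: w_def ev_linear[OF v] scaled_def)
      finally show ?thesis
        using d[OF that] order_trans[OF _ tr] q unfolding represents_def by metis
    qed
    note evl = linear_simps[OF bounded_linear_ev[where u = ?v, OF v]]
    have evu: "ev ?v (u i) = scaled I (\<phi> p) r (\<phi> q) i" for i
      by (cases "i \<in> I") (simp_all add: u_def evl evd, simp_all add: scaled_def)
    have "\<forall>i\<in>I. \<bar>\<phi> q i - \<phi> p i\<bar> \<le> r"
    proof
      fix i assume "i \<in> I"
      have "norm (ev ?v (u i)) \<le> 1" by (rule order_trans[OF norm_ev_le[OF v] u])
      then show "\<bar>\<phi> q i - \<phi> p i\<bar> \<le> r" using \<open>i \<in> I\<close> r by (simp add: evu scaled_def[of I])
    qed
    then have "h (\<phi> q) = ev (scaled I (\<phi> p) r (\<phi> q)) c" using c by (simp add: represents_def)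
    also have "scaled I (\<phi> p) r (\<phi> q) = (\<lambda>i. ev ?v (u i))" by (simp add: evu)
    also have "ev \<dots> c = ev ?v (ev u c)" by (rule ev_ev[OF u v, symmetric])
    finally show "h (\<phi> q) = ev ?v (ev u c)" .
  qed
  then show ?thesis unfolding locally_analytic_iff by blast
qed

lemma l1_geometric:
  assumes "norm x < 1"
  shows "\<exists>s. s * (1 - x) = (1 :: 'a::{real_normed_algebra_1, banach})"
proof -
  have s: "summable (\<lambda>n. x ^ n)" by (rule complete_algebra_summable_geometric[OF assms])
  have "(\<Sum>n. x ^ n) * x = (\<Sum>n. x ^ Suc n)"
    using suminf_mult2[OF s, of x] by (simp add: power_commutes)
  also have "\<dots> = (\<Sum>n. x ^ n) - 1" using suminf_split_head[OF s] by simp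
  finally show ?thesis by (intro exI[of _ "\<Sum>n. x ^ n"]) (simp add: right_diff_distrib)
qed

text \<open>By \<open>la_compose\<close> it suffices to invert one coordinate near \<open>a\<close>.
  With the sign of the variable adjusted, \<open>q Vx / a\<close> is the value of
  \<open>1 - x\<close> for a series \<open>x\<close> of norm 1/2, which the geometric series
  inverts.\<close>

lemma la_inverse [intro]:
  assumes "locally_analytic p h" "h p \<noteq> 0"
  shows "locally_analytic p (\<lambda>q. inverse (h q))"
proof -
  define a where "a = h p"
  have a: "a \<noteq> 0" using assms by (simp add: a_def)
  define x where "x = - (1/2) *\<^sub>R var Vx"
  have "norm x < 1" by (simp add: x_def)
  then obtain s where s: "s * (1 - x) = 1" using l1_geometric by blast
  have "represents {Vx} (\<lambda>_. a) (\<bar>a\<bar> / 2) (ev (\<lambda>i. sgn a *\<^sub>R var i) ((1 / a) *\<^sub>R s)) (\<lambda>q. inverse (q Vx))"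
    unfolding represents_def
  proof (intro conjI allI impI)
    show "0 < \<bar>a\<bar> / 2" using a by simp
    fix q :: jet assume q: "\<forall>i\<in>{Vx}. \<bar>q i - a\<bar> \<le> \<bar>a\<bar> / 2"
    let ?v = "scaled {Vx} (\<lambda>_. a) (\<bar>a\<bar> / 2) q"
    have v: "norm (?v i) \<le> 1" for i using norm_scaled_le[OF _ q] a by simp
    have u: "norm (sgn a *\<^sub>R var i :: dvar multiset l1) \<le> 1" for i by (simp add: sgn_if)
    let ?w = "\<lambda>i. ev ?v (sgn a *\<^sub>R var i)"
    have w: "norm (?w i) \<le> 1" for i by (rule order_trans[OF norm_ev_le[OF v] u])
    have "ev ?w s * (1 - ev ?w x) = 1"
      using arg_cong[OF s, of "ev ?w"] by (simp add: ev_mult[OF w] ev_linear[OF w])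
    moreover have "1 - ev ?w x = q Vx / a"
    proof -
      have "1 - ev ?w x = 1 + ?w Vx / 2" unfolding x_def by (simp only: ev_linear[OF w] ev_var) simp
      also have "?w Vx = sgn a * ?v Vx" by (simp only: ev_linear[OF v] ev_var) simp
      also have "?v Vx = (q Vx - a) / (\<bar>a\<bar> / 2)" by (simp add: scaled_def)
      finally show ?thesis using a by (auto simp: sgn_if field_simps split: if_splits)
    qed
    moreover have "q Vx \<noteq> 0" using q a by auto
    ultimately have "ev ?w s = a / q Vx" using a by (simp add: field_simps)
    then show "inverse (q Vx) = ev ?v (ev (\<lambda>i. sgn a *\<^sub>R var i) ((1 / a) *\<^sub>R s))"
      using a by (simp only: ev_ev[OF u v] ev_linear[OF w]) (simp add: field_simps)
  qed auto
  then have "locally_analytic ((\<lambda>q _. h q) p) (\<lambda>q. inverse (q Vx))"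
    unfolding locally_analytic_iff a_def by blast
  from la_compose[where \<phi> = "\<lambda>q _. h q", OF this] show ?thesis using assms(1) by simp
qed

lemma la_divide [intro]:
  "locally_analytic p a \<Longrightarrow> locally_analytic p b \<Longrightarrow> b p \<noteq> 0 \<Longrightarrow> locally_analytic p (\<lambda>q. a q / b q)"
  unfolding divide_inverse by (intro la_mult la_inverse)

section \<open>Partial derivatives, identity theorem and implicit functions\<close>

text \<open>The strict bound \<open>r / 2\<close> is the bound 1/2 for termwise differentiation,
  seen before scaling.\<close>

lemma has_field_derivative_along:
  fixes \<gamma> :: "real \<Rightarrow> jet"
  assumes h: "represents J p r c h"
    and \<gamma>: "\<And>i. i \<in> J \<Longrightarrow> ((\<lambda>s. \<gamma> s i) has_field_derivative d i) (at s0)"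
    and lt: "\<And>i. i \<in> J \<Longrightarrow> \<bar>\<gamma> s0 i - p i\<bar> < r / 2"
  shows "((\<lambda>s. h (\<gamma> s)) has_field_derivative (\<Sum>i\<in>J. dev i (scaled J p r (\<gamma> s0)) c / r * d i)) (at s0)"
proof -
  have J: "finite J" and r: "r > 0" using h by (auto simp: represents_def)
  have "((\<lambda>s. ev (scaled J p r (\<gamma> s)) c) has_field_derivative
      (\<Sum>i\<in>J. dev i (scaled J p r (\<gamma> s0)) c * (d i / r))) (at s0)"
  proof (rule has_field_derivative_ev[OF J])
    show "((\<lambda>s. scaled J p r (\<gamma> s) i) has_field_derivative d i / r) (at s0)" if "i \<in> J" for i
      using DERIV_cdivide[OF DERIV_diff[OF \<gamma>[OF that] DERIV_const[of "p i"]], of r] that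
      by (simp add: scaled_def)
    show "norm (scaled J p r (\<gamma> s0) i) < 1 / 2" if "i \<in> J" for i
      using lt[OF that] r that by (simp add: scaled_def field_simps)
  qed (simp add: scaled_def)
  moreover have "\<forall>\<^sub>F s in nhds s0. ev (scaled J p r (\<gamma> s)) c = h (\<gamma> s)"
  proof -
    have "\<forall>\<^sub>F s in nhds s0. \<forall>i\<in>J. \<bar>\<gamma> s i - p i\<bar> < r"
    proof (intro eventually_ball_finite J ballI)
      fix i assume i: "i \<in> J"
      have "((\<lambda>s. \<gamma> s i) \<longlongrightarrow> \<gamma> s0 i) (nhds s0)"
        using DERIV_isCont[OF \<gamma>[OF i]] tendsto_at_iff_tendsto_nhds[of "\<lambda>s. \<gamma> s i" s0]
        by (simp add: isCont_def)
      then have "((\<lambda>s. \<bar>\<gamma> s i - p i\<bar>) \<longlongrightarrow> \<bar>\<gamma> s0 i - p i\<bar>) (nhds s0)"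
        by (intro tendsto_intros)
      then show "\<forall>\<^sub>F s in nhds s0. \<bar>\<gamma> s i - p i\<bar> < r"
        by (rule order_tendstoD(2)) (use lt[OF i] r in simp)
    qed
    then show ?thesis
      by eventually_elim (use h in \<open>force simp: represents_def intro: less_imp_le\<close>)
  qed
  ultimately show ?thesis
    by (subst (asm) DERIV_cong_ev[OF refl _ refl]) auto
qed

lemma has_field_derivative_upd: "((\<lambda>s. (q(j := s)) i) has_field_derivative (if i = j then 1 else 0)) (at s0)"
  for q :: jet
  by (cases "i = j") auto

lemma represents_partial:
  assumes h: "represents J p r c h" and q: "\<forall>i\<in>J. \<bar>q i - p i\<bar> < r / 2"
  shows "((\<lambda>s. h (q(j := s))) has_field_derivative (if j \<in> J then dev j (scaled J p r q) c / r else 0)) (at (q j))"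
proof -
  have J: "finite J" using h by (simp add: represents_def)
  have "((\<lambda>s. h (q(j := s))) has_field_derivative
      (\<Sum>i\<in>J. dev i (scaled J p r (q(j := q j))) c / r * (if i = j then 1 else 0))) (at (q j))"
    by (rule has_field_derivative_along[OF h has_field_derivative_upd]) (use q in simp)
  also have "(\<Sum>i\<in>J. dev i (scaled J p r (q(j := q j))) c / r * (if i = j then 1 else 0))
      = (if j \<in> J then dev j (scaled J p r q) c / r else 0)"
    using J by (simp add: sum.delta if_distrib[of "\<lambda>x. _ * x"] cong: if_cong)
  finally show ?thesis .
qed

lemma pd_represents:
  assumes "represents J p r c h" "\<forall>i\<in>J. \<bar>q i - p i\<bar> < r / 2"
  shows "pd j h q = (if j \<in> J then dev j (scaled J p r q) c / r else 0)"
  unfolding pd_def by (rule DERIV_imp_deriv[OF represents_partial[OF assms]])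

lemma la_DERIV:
  assumes "locally_analytic p h"
  shows "((\<lambda>s. h (p(j := s))) has_field_derivative pd j h p) (at (p j))"
proof -
  obtain J r c where h: "represents J p r c h" using assms by (auto simp: locally_analytic_iff)
  then have "\<forall>i\<in>J. \<bar>p i - p i\<bar> < r / 2" by (auto simp: represents_def)
  from represents_partial[OF h this] pd_represents[OF h this] show ?thesis by simp
qed

text \<open>\<open>fderiv\<close> contains a dilation by 1/2: scaling with \<open>r / 2\<close> and
  then halving is scaling with \<open>r\<close>. Hence the halved radius; the factor
  \<open>1 / r\<close> is the derivative of the scaling.\<close>

lemma represents_pd:
  assumes h: "represents J p r c h" and j: "j \<in> J"
  shows "represents J p (r / 2) ((1 / r) *\<^sub>R fderiv j c) (\<lambda>q. ev (scaled J p (r / 2) q) ((1 / r) *\<^sub>R fderiv j c))"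
    and "near p (\<lambda>q. pd j h q = ev (scaled J p (r / 2) q) ((1 / r) *\<^sub>R fderiv j c))"
proof -
  have J: "finite J" and r: "r > 0" using h by (auto simp: represents_def)
  then show "represents J p (r / 2) ((1 / r) *\<^sub>R fderiv j c) (\<lambda>q. ev (scaled J p (r / 2) q) ((1 / r) *\<^sub>R fderiv j c))"
    by (simp add: represents_def)
  show "near p (\<lambda>q. pd j h q = ev (scaled J p (r / 2) q) ((1 / r) *\<^sub>R fderiv j c))"
  proof (rule eventually_mono[OF near_box[OF J, of "r / 2" p]])
    fix q assume q: "\<forall>i\<in>J. \<bar>q i - p i\<bar> < r / 2"
    have v: "norm (scaled J p (r / 2) q i) \<le> 1" for i
      by (rule norm_scaled_le) (use r q in \<open>auto intro: less_imp_le\<close>)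
    have "scaled J p (r / 2) q i /\<^sub>R 2 = scaled J p r q i" for i by (simp add: scaled_def)
    then have "ev (scaled J p (r / 2) q) (fderiv j c) = dev j (scaled J p r q) c"
      by (simp add: ev_fderiv[OF v])
    then show "pd j h q = ev (scaled J p (r / 2) q) ((1 / r) *\<^sub>R fderiv j c)"
      using j by (simp add: pd_represents[OF h q] ev_linear[OF v])
  qed (use r in simp)
qed

lemma locally_analytic_represents_with:
  assumes "locally_analytic p h" "finite I"
  obtains J r c where "represents J p r c h" "I \<subseteq> J"
proof -
  obtain J r c where h: "represents J p r c h" using assms by (auto simp: locally_analytic_iff)
  have "\<exists>c'. represents (J \<union> I) p r c' h"
    by (rule represents_mono[OF h]) (use h assms in \<open>auto simp: represents_def\<close>)
  then show ?thesis using that by blast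
qed

lemma la_pd [intro]:
  assumes "locally_analytic p h"
  shows "locally_analytic p (pd j h)"
proof -
  obtain J r c where h: "represents J p r c h" "{j} \<subseteq> J"
    using locally_analytic_represents_with[OF assms, of "{j}"] by blast
  then have j: "j \<in> J" by simp
  have "locally_analytic p (\<lambda>q. ev (scaled J p (r / 2) q) ((1 / r) *\<^sub>R fderiv j c))"
    using represents_pd(1)[OF h(1) j] unfolding locally_analytic_iff by blast
  then show ?thesis
    by (rule la_cong) (use represents_pd(2)[OF h(1) j] in \<open>simp add: eq_commute\<close>)
qed

lemma pd_commute:
  assumes "locally_analytic p h"
  shows "near p (\<lambda>q. pd i (pd j h) q = pd j (pd i h) q)"
proof -
  obtain J r c where h: "represents J p r c h" "{i, j} \<subseteq> J"
    using locally_analytic_represents_with[OF assms, of "{i, j}"] by blast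
  have eq: "near p (\<lambda>q. pd i (pd j h) q = ev (scaled J p (r / 2 / 2) q) ((1 / (r / 2)) *\<^sub>R fderiv i ((1 / r) *\<^sub>R fderiv j c)))"
    if "i \<in> J" "j \<in> J" for i j
    using near_pd_cong[OF represents_pd(2)[OF h(1) that(2)], of i]
      represents_pd(2)[OF represents_pd(1)[OF h(1) that(2)] that(1)]
    by eventually_elim simp
  have "near p (\<lambda>q. pd i (pd j h) q = ev (scaled J p (r / 2 / 2) q) ((1 / (r / 2)) *\<^sub>R fderiv i ((1 / r) *\<^sub>R fderiv j c)))"
    and "near p (\<lambda>q. pd j (pd i h) q = ev (scaled J p (r / 2 / 2) q) ((1 / (r / 2)) *\<^sub>R fderiv j ((1 / r) *\<^sub>R fderiv i c)))"
    using eq h(2) by auto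
  then show ?thesis
    by eventually_elim (simp add: linear_simps[OF bounded_linear_fderiv] fderiv_commute[of i j])
qed

lemma pd_zero_outside:
  assumes "locally_analytic p h"
  obtains I where "finite I" "near p (\<lambda>q. \<forall>j. j \<notin> I \<longrightarrow> pd j h q = 0)"
proof -
  obtain J r c where h: "represents J p r c h" using assms by (auto simp: locally_analytic_iff)
  then have J: "finite J" "r / 2 > 0" by (auto simp: represents_def)
  have "near p (\<lambda>q. \<forall>j. j \<notin> J \<longrightarrow> pd j h q = 0)"
    using near_box[OF J, of p] by eventually_elim (simp add: pd_represents[OF h])
  then show ?thesis using that J by blast
qed

lemma pd_const [simp]: "pd j (\<lambda>q. a) = (\<lambda>q. 0)"
  by (simp add: pd_def fun_eq_iff)

lemma pd_coord [simp]: "pd j (\<lambda>q. q i) q = (if i = j then 1 else 0)"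
  unfolding pd_def by (rule DERIV_imp_deriv[OF has_field_derivative_upd])

lemma pd_add_at:
  assumes "locally_analytic p a" "locally_analytic p b"
  shows "pd j (\<lambda>q. a q + b q) p = pd j a p + pd j b p"
  using DERIV_imp_deriv[OF DERIV_add[OF la_DERIV[OF assms(1)] la_DERIV[OF assms(2)]]]
  unfolding pd_def[of j "\<lambda>q. a q + b q"] .

lemma pd_mult_at:
  assumes "locally_analytic p a" "locally_analytic p b"
  shows "pd j (\<lambda>q. a q * b q) p = pd j a p * b p + a p * pd j b p"
  using DERIV_imp_deriv[OF DERIV_mult[OF la_DERIV[OF assms(1), of j] la_DERIV[OF assms(2), of j]]]
  unfolding pd_def[of j "\<lambda>q. a q * b q"] by (simp add: mult.commute)

lemma near_pd_add:
  assumes "locally_analytic p a" "locally_analytic p b"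
  shows "near p (\<lambda>q. pd j (\<lambda>q. a q + b q) q = pd j a q + pd j b q)"
  using near_la[OF assms(1)] near_la[OF assms(2)] by eventually_elim (rule pd_add_at)

lemma near_pd_mult:
  assumes "locally_analytic p a" "locally_analytic p b"
  shows "near p (\<lambda>q. pd j (\<lambda>q. a q * b q) q = pd j a q * b q + a q * pd j b q)"
  using near_la[OF assms(1)] near_la[OF assms(2)] by eventually_elim (rule pd_mult_at)

text \<open>The index set is fixed before \<open>j\<close> and may be enlarged, since the partials
  of \<open>h\<close> vanish off it. Sums belonging to several functions can then run over one
  set.\<close>

lemma pd_compose:
  assumes h: "locally_analytic (\<phi> p) h" and \<phi>: "\<And>i. locally_analytic p (\<lambda>q. \<phi> q i)"
  obtains I where "finite I"
    "\<And>I' j. finite I' \<Longrightarrow> I \<subseteq> I' \<Longrightarrow>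
      near p (\<lambda>q. pd j (\<lambda>q. h (\<phi> q)) q = (\<Sum>i\<in>I'. pd i h (\<phi> q) * pd j (\<lambda>q. \<phi> q i) q))"
proof -
  obtain I r c where c: "represents I (\<phi> p) r c h" using h by (auto simp: locally_analytic_iff)
  have I: "finite I" and r: "r / 2 > 0" using c by (auto simp: represents_def)
  have near\<phi>: "filterlim \<phi> (nhds (\<phi> p)) (nhds p)"
    by (rule tendsto_jetI) (rule la_tendsto[OF \<phi>])
  have "near p (\<lambda>q. pd j (\<lambda>q. h (\<phi> q)) q = (\<Sum>i\<in>I'. pd i h (\<phi> q) * pd j (\<lambda>q. \<phi> q i) q))"
    if I': "finite I'" "I \<subseteq> I'" for I' j
  proof -
    have "near p (\<lambda>q. \<forall>i\<in>I. \<bar>\<phi> q i - \<phi> p i\<bar> < r / 2)"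
      by (rule eventually_compose_filterlim[OF near_box[OF I r] near\<phi>])
    moreover have "near p (\<lambda>q. \<forall>i\<in>I. locally_analytic q (\<lambda>q. \<phi> q i))"
      by (intro eventually_ball_finite I ballI near_la \<phi>)
    ultimately show ?thesis
    proof eventually_elim
      case (elim q)
      have "((\<lambda>s. h (\<phi> (q(j := s)))) has_field_derivative
        (\<Sum>i\<in>I. dev i (scaled I (\<phi> p) r (\<phi> (q(j := q j)))) c / r * pd j (\<lambda>q. \<phi> q i) q)) (at (q j))"
        by (rule has_field_derivative_along[OF c])
          (use elim la_DERIV[of q "\<lambda>q. \<phi> q i" j for i] in auto)
      then have "pd j (\<lambda>q. h (\<phi> q)) q = (\<Sum>i\<in>I. dev i (scaled I (\<phi> p) r (\<phi> q)) c / r * pd j (\<lambda>q. \<phi> q i) q)"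
        unfolding pd_def[of j "\<lambda>q. h (\<phi> q)"] by (intro DERIV_imp_deriv) simp
      also have "\<dots> = (\<Sum>i\<in>I'. pd i h (\<phi> q) * pd j (\<lambda>q. \<phi> q i) q)"
        using I' by (intro sum.mono_neutral_cong_left) (auto simp: pd_represents[OF c elim(1)])
      finally show ?case .
    qed
  qed
  then show ?thesis using that I by blast
qed

section \<open>Analytic continuation\<close>

lemma ev_of_real:
  assumes v: "\<And>i. norm (v i) \<le> 1"
  shows "ev (\<lambda>i. complex_of_real (v i)) c = of_real (ev v c)"
proof (rule l1_linear_ext[where c = c])
  show "bounded_linear (ev (\<lambda>i. complex_of_real (v i)))"
    by (rule bounded_linear_ev) (use v in simp)
  show "bounded_linear (\<lambda>c. complex_of_real (ev v c))"
    by (rule bounded_linear_compose[OF bounded_linear_of_real bounded_linear_ev[OF v]])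
  show "ev (\<lambda>i. complex_of_real (v i)) (unit_l1 \<alpha>) = complex_of_real (ev v (unit_l1 \<alpha>))" for \<alpha>
    by simp (induction \<alpha>, auto)
qed

text \<open>Identity theorem: restrict to the complexified line through the two points.\<close>

lemma represents_zero_everywhere:
  assumes h: "represents J p r c h"
    and q0: "\<forall>i\<in>J. \<bar>q0 i - p i\<bar> < r / 2" and zero: "near q0 (\<lambda>q. h q = 0)"
    and q1: "\<forall>i\<in>J. \<bar>q1 i - p i\<bar> < r / 2"
  shows "h q1 = 0"
proof -
  have J: "finite J" and r: "r > 0" using h by (auto simp: represents_def)
  define v0 v1 where "v0 = scaled J p r q0" and "v1 = scaled J p r q1"
  define \<gamma> where "\<gamma> s i = complex_of_real (v0 i) + s * (complex_of_real (v1 i) - complex_of_real (v0 i))" for s i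
  \<comment> \<open>Within radius 1/2 \<open>has_field_derivative_ev\<close> applies. As an
    intersection of convex sets \<open>S\<close> is connected, and it contains the real segment from
    0 to 1.\<close>
  define S where "S = (\<Inter>i\<in>J. {s. cmod (\<gamma> s i) < 1 / 2})"
  have small: "\<bar>v0 i\<bar> < 1 / 2" "\<bar>v1 i\<bar> < 1 / 2" for i
    using q0 q1 r by (auto simp: v0_def v1_def scaled_def field_simps)
  have "open S" unfolding S_def \<gamma>_def by (intro open_INT J ballI open_Collect_less continuous_intros)
  have "convex {s. cmod (\<gamma> s i) < 1 / 2}" for i
  proof -
    have eq: "\<gamma> ((1 - u) *\<^sub>R x + u *\<^sub>R y) i = (1 - u) *\<^sub>R \<gamma> x i + u *\<^sub>R \<gamma> y i" for u x y
      by (simp add: \<gamma>_def scaleR_conv_of_real algebra_simps)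
    show ?thesis unfolding convex_alt
    proof (intro ballI allI impI, unfold mem_Collect_eq eq)
      fix x y and u :: real assume xy: "cmod (\<gamma> x i) < 1 / 2" "cmod (\<gamma> y i) < 1 / 2" and u: "0 \<le> u \<and> u \<le> 1"
      have "(1 - u) *\<^sub>R \<gamma> x i + u *\<^sub>R \<gamma> y i \<in> ball 0 (1 / 2)"
        using xy u convexD_alt[OF convex_ball[of 0 "1/2"], of "\<gamma> x i" "\<gamma> y i" u] by simp
      then show "cmod ((1 - u) *\<^sub>R \<gamma> x i + u *\<^sub>R \<gamma> y i) < 1 / 2" by simp
    qed
  qed
  then have "connected S" unfolding S_def by (intro convex_connected convex_INT)
  have out: "\<gamma> s i = 0" if "i \<notin> J" for s i using that by (simp add: \<gamma>_def v0_def v1_def scaled_def)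
  have hol: "(\<lambda>s. ev (\<gamma> s) c) holomorphic_on S"
  proof (rule holomorphic_onI)
    fix s assume "s \<in> S"
    have "((\<lambda>s. ev (\<gamma> s) c) has_field_derivative (\<Sum>i\<in>J. dev i (\<gamma> s) c * (complex_of_real (v1 i) - complex_of_real (v0 i)))) (at s)"
      by (rule has_field_derivative_ev[OF J])
        (use \<open>s \<in> S\<close> out in \<open>auto simp: S_def \<gamma>_def intro!: derivative_eq_intros\<close>)
    then show "(\<lambda>s. ev (\<gamma> s) c) field_differentiable (at s within S)"
      using field_differentiable_at_within field_differentiable_def by blast
  qed
  define Q where "Q x i = q0 i + x * (q1 i - q0 i)" for x i
  have real: "ev (\<gamma> (of_real x)) c = of_real (h (Q x))" and inS: "of_real x \<in> S" if x: "0 \<le> x" "x \<le> 1" for x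
  proof -
    have Qv: "scaled J p r (Q x) i = v0 i + x * (v1 i - v0 i)" for i
      using r by (simp add: scaled_def v0_def v1_def Q_def field_simps)
    have bd: "\<bar>v0 i + x * (v1 i - v0 i)\<bar> < 1 / 2" for i
    proof -
      have "v0 i + x * (v1 i - v0 i) \<in> ball 0 (1 / 2)"
        using convexD_alt[OF convex_ball[of 0 "1/2"], of "v0 i" "v1 i" x] small[of i] x
        by (simp add: algebra_simps)
      then show ?thesis by simp
    qed
    have g: "\<gamma> (of_real x) = (\<lambda>i. complex_of_real (scaled J p r (Q x) i))"
      by (auto simp: Qv \<gamma>_def)
    have v: "norm (scaled J p r (Q x) i) \<le> 1" for i unfolding Qv using bd[of i] by simp
    have "\<forall>i\<in>J. \<bar>Q x i - p i\<bar> \<le> r"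
    proof
      fix i assume "i \<in> J"
      then show "\<bar>Q x i - p i\<bar> \<le> r" using v[of i] r by (simp add: scaled_def field_simps)
    qed
    then have "h (Q x) = ev (scaled J p r (Q x)) c" using h by (simp add: represents_def)
    then show "ev (\<gamma> (of_real x)) c = of_real (h (Q x))"
      unfolding g by (simp add: ev_of_real[OF v])
    have "cmod (\<gamma> (of_real x) i) < 1 / 2" for i
      unfolding g norm_of_real Qv by (rule bd)
    then show "of_real x \<in> S" by (simp add: S_def)
  qed
  have "filterlim Q (nhds q0) (nhds 0)"
  proof (rule tendsto_jetI)
    fix i
    have "((\<lambda>x. Q x i) \<longlongrightarrow> q0 i + 0 * (q1 i - q0 i)) (nhds 0)"
      unfolding Q_def by (intro tendsto_intros filterlim_ident)
    then show "((\<lambda>x. Q x i) \<longlongrightarrow> q0 i) (nhds 0)" by simp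
  qed
  from eventually_compose_filterlim[OF zero this] obtain e where e: "e > 0" "\<And>x. \<bar>x\<bar> < e \<Longrightarrow> h (Q x) = 0"
    unfolding eventually_nhds_metric by (auto simp: dist_real_def)
  \<comment> \<open>A real half-open interval has 0 as a limit point, and \<open>h\<close> vanishes
    along it because \<open>Q x\<close> is close to \<open>q0\<close> for small
    \<open>x\<close>.\<close>
  define U where "U = complex_of_real ` {0..<min e 1}"
  have "ev (\<gamma> 1) c = 0"
  proof (rule analytic_continuation[OF hol \<open>open S\<close> \<open>connected S\<close>])
    show "U \<subseteq> S" using inS by (auto simp: U_def)
    show "0 \<in> S" "1 \<in> S" using inS[of 0] inS[of 1] by auto
    show "0 islimpt U"
      unfolding islimpt_approachable
    proof (intro allI impI)
      fix d :: real assume "0 < d"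
      define x where "x = min d (min e 1) / 2"
      have "0 < x" "x < d" "x \<in> {0..<min e 1}" using \<open>0 < d\<close> e(1) by (auto simp: x_def)
      then show "\<exists>x'\<in>U. x' \<noteq> 0 \<and> dist x' 0 < d"
        unfolding U_def by (intro bexI[of _ "of_real x"] imageI) auto
    qed
    show "ev (\<gamma> z) c = 0" if "z \<in> U" for z
      using that real e(2) by (auto simp: U_def)
  qed
  then have "h (Q 1) = 0" using real[of 1] by simp
  moreover have "Q 1 = q1" by (auto simp: Q_def)
  ultimately show ?thesis by simp
qed

text \<open>Where \<open>b\<close> is nonzero, \<open>a\<close> vanishes on a neighbourhood, hence
  near \<open>p\<close> by continuation. A factor can thus be cancelled even if it vanishes at
  \<open>p\<close> itself.\<close>

lemma la_domain:
  assumes a: "locally_analytic p a" and b: "locally_analytic p b"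
    and ab: "near p (\<lambda>q. a q * b q = 0)" and nz: "\<not> near p (\<lambda>q. a q = 0)"
  shows "near p (\<lambda>q. b q = 0)"
proof -
  obtain J0 r0 where J0: "finite J0" "r0 > 0" "\<And>q. (\<forall>i\<in>J0. \<bar>q i - p i\<bar> \<le> r0) \<Longrightarrow> near q (\<lambda>q. a q * b q = 0) \<and> locally_analytic q b"
    using eventually_conj[OF near_near[OF ab] near_la[OF b]] unfolding near_iff_box by blast
  obtain J1 r1 c1 where c1: "represents J1 p r1 c1 a" using a by (auto simp: locally_analytic_iff)
  have J1: "finite J1" "r1 > 0" using c1 by (auto simp: represents_def)
  define J r where "J = J0 \<union> J1" and "r = min r0 r1"
  have J: "finite J" "r > 0" "J0 \<subseteq> J" "J1 \<subseteq> J" "r \<le> r0" "r \<le> r1" using J0 J1 by (auto simp: J_def r_def)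
  obtain c where c: "represents J p r c a" using represents_mono[OF c1 J(1,4,2,6)] by blast
  have "b q = 0" if q: "\<forall>i\<in>J. \<bar>q i - p i\<bar> < r / 2" for q
  proof (rule ccontr)
    assume nb: "b q \<noteq> 0"
    have "\<bar>q i - p i\<bar> \<le> r0" if "i \<in> J0" for i
    proof -
      have "\<bar>q i - p i\<bar> < r / 2" using q that J(3) by blast
      then show ?thesis using J by linarith
    qed
    then have "near q (\<lambda>q. a q * b q = 0)" "locally_analytic q b" using J0(3) by blast+
    with near_la_nonzero[OF this(2) nb] have "near q (\<lambda>q. a q = 0)"
      by (auto elim: eventually_elim2)
    then have "a q1 = 0" if "\<forall>i\<in>J. \<bar>q1 i - p i\<bar> < r / 2" for q1
      using represents_zero_everywhere[OF c q _ that] by blast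
    then have "near p (\<lambda>q. a q = 0)"
      using near_box[of J "r / 2" p] J by (auto elim: eventually_mono)
    with nz show False by simp
  qed
  then show ?thesis using near_box[of J "r / 2" p] J by (auto elim: eventually_mono)
qed

text \<open>Newton iteration in the Banach algebra of power series, where the variable \<open>j\<close> stands for the
  prescribed value of \<open>F\<close>.\<close>

lemma implicit_function:
  assumes F: "locally_analytic p F" and nz: "pd j F p \<noteq> 0" and e: "e > 0"
  obtains S where "locally_analytic (p(j := F p)) S"
    "near (p(j := F p)) (\<lambda>q. F (q(j := S q)) = q j \<and> \<bar>S q - p j\<bar> \<le> e)"
proof -
  obtain I r c where c: "represents I p r c F" "{j} \<subseteq> I"
    using locally_analytic_represents_with[OF F, of "{j}"] by blast
  then have I: "finite I" "j \<in> I" and r: "r > 0" by (auto simp: represents_def)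
  \<comment> \<open>Up to the factor \<open>r\<close> this is the partial derivative of
    \<open>F\<close> along \<open>j\<close> at \<open>p\<close>.\<close>
  define a where "a = cf c {#j#}"
  have a: "a \<noteq> 0"
  proof -
    have "dev j (scaled I p r p) c = cf c {#j#}"
    proof -
      have z: "scaled I p r p = (\<lambda>i. 0)" by (auto simp: scaled_def)
      have "bounded_linear (\<lambda>c::dvar multiset l1. cf c {#j#})"
        by (rule bounded_linear_intro[of _ 1]) (auto simp: norm_cf_le)
      moreover have "dmon j (\<lambda>i. 0::real) \<alpha> = (if \<alpha> = {#j#} then 1 else 0)" for \<alpha>
      proof (cases "j \<in># \<alpha>")
        case True
        then obtain \<beta> where "\<alpha> = add_mset j \<beta>" by (meson multi_member_split)
        then show ?thesis by (cases \<beta>) (auto simp: dmon_def)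
      qed (auto simp: dmon_def not_in_iff)
      ultimately show ?thesis unfolding z
        by (intro l1_linear_ext[where c = c, OF bounded_linear_dev]) (auto simp: dev_def)
    qed
    then have "pd j F p = a / r" using pd_represents[OF c(1), of p j] I r by (simp add: a_def)
    then show ?thesis using nz by auto
  qed
  have Fp: "F p = cf c {#}"
    using c(1) r by (simp add: represents_def ev_zero[of "scaled I p r p"] scaled_def)
  \<comment> \<open>The radius for the unknown series: 1/2 is required by the estimates,
    \<open>e / r\<close> localises the solution, and the last entry makes the nonlinear part at most
    half as steep as the linear part \<open>a\<close>.\<close>
  define \<eta> where "\<eta> = min (min (1 / 2) (e / r)) (\<bar>a\<bar> / (6 * (norm c + 1)))"
  have nc: "norm c + 1 > 0" using norm_ge_zero[of c] by linarith
  have \<eta>: "\<eta> > 0" "\<eta> \<le> 1 / 2" "\<eta> * r \<le> e" "3 * \<eta> * norm c \<le> \<bar>a\<bar> / 2"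
  proof -
    show "\<eta> > 0" using e r a nc by (auto simp: \<eta>_def)
    show "\<eta> \<le> 1 / 2" unfolding \<eta>_def by linarith
    have "\<eta> \<le> e / r" by (simp add: \<eta>_def)
    then show "\<eta> * r \<le> e" using r by (simp add: field_simps)
    have "\<eta> * norm c \<le> \<bar>a\<bar> / (6 * (norm c + 1)) * norm c"
      by (intro mult_right_mono) (auto simp: \<eta>_def)
    also have "\<dots> \<le> \<bar>a\<bar> / (6 * (norm c + 1)) * (norm c + 1)"
      using nc by (intro mult_left_mono) auto
    also have "\<dots> = \<bar>a\<bar> / 6" using nc by (simp add: field_simps)
    finally show "3 * \<eta> * norm c \<le> \<bar>a\<bar> / 2" by linarith
  qed
  \<comment> \<open>The radius for the parameters, so small that the first iterate
    \<open>T 0\<close> stays within half the radius of \<open>B\<close>.\<close>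
  define \<epsilon> where "\<epsilon> = min \<eta> (\<eta> * \<bar>a\<bar> / (2 * (norm c + r)))"
  have ncr: "norm c + r > 0" using r norm_ge_zero[of c] by linarith
  have \<epsilon>: "\<epsilon> > 0" "\<epsilon> \<le> \<eta>" "\<epsilon> * (norm c + r) \<le> \<eta> * \<bar>a\<bar> / 2"
  proof -
    show "\<epsilon> > 0" "\<epsilon> \<le> \<eta>" using \<eta> a ncr by (auto simp: \<epsilon>_def)
    have "\<epsilon> * (norm c + r) \<le> \<eta> * \<bar>a\<bar> / (2 * (norm c + r)) * (norm c + r)"
      using ncr by (intro mult_right_mono) (auto simp: \<epsilon>_def)
    also have "\<dots> = \<eta> * \<bar>a\<bar> / 2" using ncr by (simp add: field_simps)
    finally show "\<epsilon> * (norm c + r) \<le> \<eta> * \<bar>a\<bar> / 2" .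
  qed
  \<comment> \<open>The unknown series occupies slot \<open>j\<close> and dilated variables occupy
    the others; \<open>G \<sigma> = 0\<close> is the equation to solve, and \<open>T\<close> is the
    Newton step with the derivative frozen at \<open>a\<close>.\<close>
  define u where "u \<sigma> i = (if i = j then \<sigma> else if i \<in> I then \<epsilon> *\<^sub>R var i else 0)" for \<sigma> i
  define G where "G \<sigma> = ev (u \<sigma>) c - cf c {#} *\<^sub>R 1 - (\<epsilon> * r) *\<^sub>R var j" for \<sigma>
  define T where "T \<sigma> = \<sigma> - (1 / a) *\<^sub>R G \<sigma>" for \<sigma>
  define B where "B = cball (0 :: dvar multiset l1) \<eta>"
  have u: "norm (u \<sigma> i) \<le> \<eta>" if "\<sigma> \<in> B" for \<sigma> i
    using that \<epsilon> by (auto simp: u_def B_def)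
  have lip: "dist (T \<sigma>) (T \<tau>) \<le> 1 / 2 * dist \<sigma> \<tau>" if "\<sigma> \<in> B" "\<tau> \<in> B" for \<sigma> \<tau>
  proof -
    have "norm (ev (u \<sigma>) c - ev (u \<tau>) c - cf c {#j#} *\<^sub>R (u \<sigma> j - u \<tau> j)) \<le> 3 * \<eta> * norm (u \<sigma> j - u \<tau> j) * norm c"
      by (rule norm_ev_diff_le[OF _ \<eta>(2) u[OF that(2)] u[OF that(1)]]) (simp add: u_def)
    then have "norm (ev (u \<sigma>) c - ev (u \<tau>) c - a *\<^sub>R (\<sigma> - \<tau>)) \<le> (3 * \<eta> * norm c) * norm (\<sigma> - \<tau>)"
      by (simp add: u_def a_def mult_ac)
    also have "\<dots> \<le> \<bar>a\<bar> / 2 * norm (\<sigma> - \<tau>)" by (intro mult_right_mono \<eta>) auto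
    finally have 1: "norm (ev (u \<sigma>) c - ev (u \<tau>) c - a *\<^sub>R (\<sigma> - \<tau>)) \<le> \<bar>a\<bar> / 2 * norm (\<sigma> - \<tau>)" .
    have "T \<sigma> - T \<tau> = - ((1 / a) *\<^sub>R (ev (u \<sigma>) c - ev (u \<tau>) c - a *\<^sub>R (\<sigma> - \<tau>)))"
      using a by (simp add: T_def G_def algebra_simps)
    then have "norm (T \<sigma> - T \<tau>) = norm (ev (u \<sigma>) c - ev (u \<tau>) c - a *\<^sub>R (\<sigma> - \<tau>)) / \<bar>a\<bar>"
      by (simp only: norm_minus_cancel norm_scaleR) simp
    also have "\<dots> \<le> (\<bar>a\<bar> / 2 * norm (\<sigma> - \<tau>)) / \<bar>a\<bar>" by (intro divide_right_mono 1) auto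
    finally show ?thesis using a by (simp add: dist_norm)
  qed
  have T0: "norm (T 0) \<le> \<eta> / 2"
  proof -
    have "\<epsilon> \<le> 1" using \<epsilon>(2) \<eta>(2) by linarith
    moreover have "norm (u 0 i) \<le> \<epsilon>" for i using \<epsilon> by (auto simp: u_def)
    ultimately have "norm (ev (u 0) c - cf c {#} *\<^sub>R 1) \<le> \<epsilon> * norm c"
      by (rule norm_ev_minus_const_le)
    then have "norm (G 0) \<le> \<epsilon> * norm c + \<epsilon> * r"
      unfolding G_def using \<epsilon>(1) r by (intro norm_triangle_le_diff) simp
    also have "\<dots> \<le> \<eta> * \<bar>a\<bar> / 2" using \<epsilon>(3) by (simp add: algebra_simps)
    finally have "norm (G 0) / \<bar>a\<bar> \<le> \<eta> / 2" using a by (simp add: field_simps)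
    then show ?thesis by (simp add: T_def)
  qed
  have "\<exists>!\<sigma>\<in>B. T \<sigma> = \<sigma>"
  proof (rule Banach_fix[where c = "1 / 2"])
    show "complete B" unfolding B_def by (simp add: complete_eq_closed)
    show "B \<noteq> {}" using \<eta>(1) by (simp add: B_def)
    show "T ` B \<subseteq> B"
    proof
      fix y assume "y \<in> T ` B"
      then obtain \<sigma> where \<sigma>: "\<sigma> \<in> B" "y = T \<sigma>" by blast
      have "0 \<in> B" using \<eta>(1) by (simp add: B_def)
      then have "norm (T \<sigma> - T 0) \<le> 1 / 2 * norm \<sigma>" using lip[OF \<sigma>(1), of 0] by (simp add: dist_norm)
      moreover have "norm \<sigma> \<le> \<eta>" using \<sigma>(1) by (simp add: B_def)
      moreover have "norm (T \<sigma>) \<le> norm (T \<sigma> - T 0) + norm (T 0)" using norm_triangle_sub[of "T \<sigma>" "T 0"] by linarith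
      ultimately have "norm (T \<sigma>) \<le> \<eta>" using T0 by linarith
      then show "y \<in> B" using \<sigma>(2) by (simp add: B_def)
    qed
  qed (use lip in auto)
  then obtain \<sigma> where \<sigma>: "\<sigma> \<in> B" "T \<sigma> = \<sigma>" by blast
  have "G \<sigma> = 0" using \<sigma>(2) a by (simp add: T_def)
  then have G0: "ev (u \<sigma>) c = cf c {#} *\<^sub>R 1 + (\<epsilon> * r) *\<^sub>R var j"
    by (simp add: G_def algebra_simps)
  define p' where "p' = p(j := F p)"
  define S where "S q = p j + r * ev (scaled I p' (\<epsilon> * r) q) \<sigma>" for q
  have box: "F (q(j := S q)) = q j \<and> \<bar>S q - p j\<bar> \<le> e" if q: "\<forall>i\<in>I. \<bar>q i - p' i\<bar> \<le> \<epsilon> * r" for q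
  proof -
    let ?v = "scaled I p' (\<epsilon> * r) q"
    have v: "norm (?v i) \<le> 1" for i by (rule norm_scaled_le) (use \<epsilon> r q in auto)
    have u1: "norm (u \<sigma> i) \<le> 1" for i using u[OF \<sigma>(1), of i] \<eta>(2) by linarith
    note evl = linear_simps[OF bounded_linear_ev[where u = ?v, OF v]]
    have s: "\<bar>ev ?v \<sigma>\<bar> \<le> \<eta>" using norm_ev_le[of ?v \<sigma>, OF v] \<sigma>(1) by (simp add: B_def)
    have sr: "\<bar>S q - p j\<bar> \<le> \<eta> * r"
      using mult_right_mono[OF s, of r] r by (simp add: S_def abs_mult mult.commute)
    have eq: "(\<lambda>i. ev ?v (u \<sigma> i)) = scaled I p r (q(j := S q))"
    proof
      fix i
      show "ev ?v (u \<sigma> i) = scaled I p r (q(j := S q)) i"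
      proof (cases "i = j")
        case True
        then show ?thesis using r I by (simp add: u_def scaled_def[of I p] S_def)
      next
        case False
        then have "ev ?v (u \<sigma> i) = \<epsilon> * ?v i" by (simp add: u_def evl scaled_def[of I p' _ _ i])
        also have "\<dots> = scaled I p r (q(j := S q)) i" using False \<epsilon> r by (simp add: scaled_def p'_def)
        finally show ?thesis .
      qed
    qed
    have "ev ?v (ev (u \<sigma>) c) = ev (scaled I p r (q(j := S q))) c"
      unfolding eq[symmetric] by (rule ev_ev[OF u1 v])
    moreover have "\<forall>i\<in>I. \<bar>(q(j := S q)) i - p i\<bar> \<le> r"
    proof
      fix i assume "i \<in> I"
      have "norm (ev ?v (u \<sigma> i)) \<le> 1" by (rule order_trans[OF norm_ev_le[OF v] u1])
      then show "\<bar>(q(j := S q)) i - p i\<bar> \<le> r"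
        using \<open>i \<in> I\<close> r fun_cong[OF eq, of i] by (simp add: scaled_def[of I p] field_simps)
    qed
    ultimately have "F (q(j := S q)) = ev ?v (ev (u \<sigma>) c)" using c(1) by (simp add: represents_def)
    also have "\<dots> = F p + \<epsilon> * r * ?v j" unfolding G0 by (simp add: evl Fp)
    also have "\<epsilon> * r * ?v j = q j - F p" using \<epsilon> I r by (simp add: scaled_def p'_def)
    finally have Fq: "F (q(j := S q)) = F p + (q j - F p)" .
    show ?thesis unfolding Fq using order_trans[OF sr \<eta>(3)] by simp
  qed
  have "represents I p' (\<epsilon> * r) (p j *\<^sub>R 1 + r *\<^sub>R \<sigma>) S"
    unfolding represents_def
  proof (intro conjI allI impI)
    show "finite I" "\<epsilon> * r > 0" using I \<epsilon> r by auto
    fix q assume "\<forall>i\<in>I. \<bar>q i - p' i\<bar> \<le> \<epsilon> * r"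
    then have v: "norm (scaled I p' (\<epsilon> * r) q i) \<le> 1" for i by (intro norm_scaled_le) (use \<epsilon> r in auto)
    show "S q = ev (scaled I p' (\<epsilon> * r) q) (p j *\<^sub>R 1 + r *\<^sub>R \<sigma>)"
      by (simp add: S_def ev_linear[OF v])
  qed
  then have "locally_analytic p' S" unfolding locally_analytic_iff by blast
  moreover have "near p' (\<lambda>q. F (q(j := S q)) = q j \<and> \<bar>S q - p j\<bar> \<le> e)"
    unfolding near_iff_box using box I(1) \<epsilon>(1) r mult_pos_pos by blast
  ultimately show ?thesis using that unfolding p'_def by blast
qed

section \<open>Vector fields over germs\<close>

abbreviation (input) germ_eq :: "jet \<Rightarrow> (jet \<Rightarrow> real) \<Rightarrow> (jet \<Rightarrow> real) \<Rightarrow> bool" where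
  "germ_eq p h h' \<equiv> near p (\<lambda>q. h q = h' q)"

definition la_field :: "jet \<Rightarrow> vfield \<Rightarrow> bool" where
  "la_field p V \<longleftrightarrow> (\<forall>j. locally_analytic p (V j))"

lemma la_fieldD: "la_field p V \<Longrightarrow> locally_analytic p (V j)"
  by (simp add: la_field_def)

text \<open>One index set for first and second partials lets the double sums in
  \<open>vf_app_bracket\<close> run over a fixed square.\<close>

lemma pd_zero_outside2:
  assumes "locally_analytic p h"
  obtains I where "finite I" "near p (\<lambda>q. \<forall>j. j \<notin> I \<longrightarrow> pd j h q = 0)"
    "\<And>i. near p (\<lambda>q. \<forall>j. j \<notin> I \<longrightarrow> pd j (pd i h) q = 0)"
proof -
  obtain J r c where h: "represents J p r c h" using assms by (auto simp: locally_analytic_iff)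
  then have J: "finite J" "r / 2 > 0" "r / 2 / 2 > 0" by (auto simp: represents_def)
  have 1: "near p (\<lambda>q. \<forall>j. j \<notin> J \<longrightarrow> pd j h q = 0)"
    using near_box[OF J(1,2), of p] by eventually_elim (simp add: pd_represents[OF h])
  have "near p (\<lambda>q. \<forall>j. j \<notin> J \<longrightarrow> pd j (pd i h) q = 0)" for i
  proof (cases "i \<in> J")
    case True
    show ?thesis
      using near_near[OF represents_pd(2)[OF h True]] near_box[OF J(1,3), of p]
    proof eventually_elim
      case (elim q)
      then show ?case
        using pd_cong[OF elim(1)] by (simp add: pd_represents[OF represents_pd(1)[OF h True]])
    qed
  next
    case False
    then have "near p (\<lambda>q. pd i h q = 0)" using 1 by (auto elim: eventually_mono)
    from near_near[OF this] show ?thesis by eventually_elim (use pd_cong in fastforce)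
  qed
  then show ?thesis using that 1 J by blast
qed

section \<open>Vector fields as derivations of germs\<close>

lemma vf_app_eq_sum:
  assumes "finite I" "\<forall>j. j \<notin> I \<longrightarrow> pd j h q = 0"
  shows "vf_app V h q = (\<Sum>j\<in>I. V j q * pd j h q)"
  unfolding vf_app_def using assms by (intro sum.mono_neutral_left) auto

text \<open>The index set in \<open>vf_app\<close> varies with the point. Near \<open>p\<close> it
  is replaced by a fixed finite set, which can be enlarged to suit several functions at
  once.\<close>

lemma vf_app_sum:
  assumes "locally_analytic p h"
  shows "\<exists>I. finite I \<and> (\<forall>J V. finite J \<longrightarrow> I \<subseteq> J \<longrightarrow>
    germ_eq p (vf_app V h) (\<lambda>q. \<Sum>j\<in>J. V j q * pd j h q))"
proof -
  obtain I where I: "finite I" "near p (\<lambda>q. \<forall>j. j \<notin> I \<longrightarrow> pd j h q = 0)"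
    using pd_zero_outside[OF assms] .
  have "germ_eq p (vf_app V h) (\<lambda>q. \<Sum>j\<in>J. V j q * pd j h q)" if "finite J" "I \<subseteq> J" for J V
    using I(2) by eventually_elim (rule vf_app_eq_sum, use that in auto)
  then show ?thesis using I by blast
qed

lemma la_vf_app [intro]:
  assumes "la_field p V" "locally_analytic p h"
  shows "locally_analytic p (vf_app V h)"
proof -
  obtain I where I: "finite I" "\<And>J V. finite J \<Longrightarrow> I \<subseteq> J \<Longrightarrow> germ_eq p (vf_app V h) (\<lambda>q. \<Sum>j\<in>J. V j q * pd j h q)"
    using vf_app_sum[OF assms(2)] by blast
  have "locally_analytic p (\<lambda>q. \<Sum>j\<in>I. V j q * pd j h q)"
    by (intro la_sum la_mult la_pd assms la_fieldD[OF assms(1)])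
  then show ?thesis by (rule la_cong) (use I(2)[OF I(1) subset_refl, of V] in \<open>simp add: eq_commute\<close>)
qed

lemma vf_app_germ_cong:
  assumes "germ_eq p h h'"
  shows "germ_eq p (vf_app V h) (vf_app V h')"
  using near_near[OF assms]
proof eventually_elim
  case (elim q)
  then show ?case using pd_cong[OF elim] by (simp add: vf_app_def)
qed

lemma vf_app_cong:
  assumes "vf_eq p V V'" "germ_eq p h h'" "locally_analytic p h"
  shows "germ_eq p (vf_app V h) (vf_app V' h')"
proof -
  obtain I where I: "finite I" "\<And>J V. finite J \<Longrightarrow> I \<subseteq> J \<Longrightarrow> germ_eq p (vf_app V h) (\<lambda>q. \<Sum>j\<in>J. V j q * pd j h q)"
    using vf_app_sum[OF assms(3)] by blast
  have "near p (\<lambda>q. \<forall>j\<in>I. V j q = V' j q)"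
    using assms(1) by (intro eventually_ball_finite I) (auto simp: vf_eq_def)
  with I(2)[OF I(1) subset_refl, of V] I(2)[OF I(1) subset_refl, of V'] vf_app_germ_cong[OF assms(2), of V']
  show ?thesis by eventually_elim simp
qed

lemma vf_app_const [simp]: "vf_app V (\<lambda>q. a) = (\<lambda>q. 0)"
  by (simp add: vf_app_def fun_eq_iff)

lemma vf_app_coord [simp]: "vf_app V (\<lambda>q. q i) q = V i q"
proof -
  have "{j. (if i = j then 1 else (0::real)) \<noteq> 0} = {i}" by auto
  then show ?thesis by (simp add: vf_app_def)
qed

lemma vf_app_add:
  assumes a: "locally_analytic p a" and b: "locally_analytic p b"
  shows "germ_eq p (vf_app V (\<lambda>q. a q + b q)) (\<lambda>q. vf_app V a q + vf_app V b q)"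
proof -
  obtain I where I: "finite I" "\<And>J V. finite J \<Longrightarrow> I \<subseteq> J \<Longrightarrow> germ_eq p (vf_app V a) (\<lambda>q. \<Sum>j\<in>J. V j q * pd j a q)"
    using vf_app_sum[OF a] by blast
  obtain K where K: "finite K" "\<And>J V. finite J \<Longrightarrow> K \<subseteq> J \<Longrightarrow> germ_eq p (vf_app V b) (\<lambda>q. \<Sum>j\<in>J. V j q * pd j b q)"
    using vf_app_sum[OF b] by blast
  obtain L where L: "finite L" "\<And>J V. finite J \<Longrightarrow> L \<subseteq> J \<Longrightarrow> germ_eq p (vf_app V (\<lambda>q. a q + b q)) (\<lambda>q. \<Sum>j\<in>J. V j q * pd j (\<lambda>q. a q + b q) q)"
    using vf_app_sum[OF la_add[OF a b]] by blast
  let ?J = "I \<union> K \<union> L"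
  have J: "finite ?J" "I \<subseteq> ?J" "K \<subseteq> ?J" "L \<subseteq> ?J" using I K L by auto
  have "near p (\<lambda>q. \<forall>j\<in>?J. pd j (\<lambda>q. a q + b q) q = pd j a q + pd j b q)"
    by (intro eventually_ball_finite ballI near_pd_add a b J)
  with I(2)[OF J(1,2), of V] K(2)[OF J(1,3), of V] L(2)[OF J(1,4), of V] show ?thesis
    by eventually_elim (simp add: sum.distrib distrib_left)
qed

lemma vf_app_mult:
  assumes a: "locally_analytic p a" and b: "locally_analytic p b"
  shows "germ_eq p (vf_app V (\<lambda>q. a q * b q)) (\<lambda>q. vf_app V a q * b q + a q * vf_app V b q)"
proof -
  obtain I where I: "finite I" "\<And>J V. finite J \<Longrightarrow> I \<subseteq> J \<Longrightarrow> germ_eq p (vf_app V a) (\<lambda>q. \<Sum>j\<in>J. V j q * pd j a q)"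
    using vf_app_sum[OF a] by blast
  obtain K where K: "finite K" "\<And>J V. finite J \<Longrightarrow> K \<subseteq> J \<Longrightarrow> germ_eq p (vf_app V b) (\<lambda>q. \<Sum>j\<in>J. V j q * pd j b q)"
    using vf_app_sum[OF b] by blast
  obtain L where L: "finite L" "\<And>J V. finite J \<Longrightarrow> L \<subseteq> J \<Longrightarrow> germ_eq p (vf_app V (\<lambda>q. a q * b q)) (\<lambda>q. \<Sum>j\<in>J. V j q * pd j (\<lambda>q. a q * b q) q)"
    using vf_app_sum[OF la_mult[OF a b]] by blast
  let ?J = "I \<union> K \<union> L"
  have J: "finite ?J" "I \<subseteq> ?J" "K \<subseteq> ?J" "L \<subseteq> ?J" using I K L by auto
  have "near p (\<lambda>q. \<forall>j\<in>?J. pd j (\<lambda>q. a q * b q) q = pd j a q * b q + a q * pd j b q)"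
    by (intro eventually_ball_finite ballI near_pd_mult a b J)
  with I(2)[OF J(1,2), of V] K(2)[OF J(1,3), of V] L(2)[OF J(1,4), of V] show ?thesis
  proof eventually_elim
    case (elim q)
    show ?case unfolding elim(1-3)
      by (simp add: elim(4) sum.distrib sum_distrib_left sum_distrib_right algebra_simps)
  qed
qed

lemma vf_app_diff:
  assumes a: "locally_analytic p a" and b: "locally_analytic p b"
  shows "germ_eq p (vf_app V (\<lambda>q. a q - b q)) (\<lambda>q. vf_app V a q - vf_app V b q)"
proof -
  have "germ_eq p (vf_app V (\<lambda>q. a q + (-1) * b q)) (\<lambda>q. vf_app V a q + vf_app V (\<lambda>q. (-1) * b q) q)"
    by (intro vf_app_add la_mult la_const a b)
  with vf_app_mult[OF la_const[of p "-1"] b, of V] show ?thesis by eventually_elim simp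
qed

lemma vf_app_sum_fun:
  assumes "finite I" "\<And>i. i \<in> I \<Longrightarrow> locally_analytic p (a i)"
  shows "germ_eq p (vf_app V (\<lambda>q. \<Sum>i\<in>I. a i q)) (\<lambda>q. \<Sum>i\<in>I. vf_app V (a i) q)"
  using assms
proof (induction I)
  case (insert k I)
  have "germ_eq p (vf_app V (\<lambda>q. a k q + (\<Sum>i\<in>I. a i q))) (\<lambda>q. vf_app V (a k) q + vf_app V (\<lambda>q. \<Sum>i\<in>I. a i q) q)"
    by (intro vf_app_add la_sum insert.prems) auto
  moreover have "germ_eq p (vf_app V (\<lambda>q. \<Sum>i\<in>I. a i q)) (\<lambda>q. \<Sum>i\<in>I. vf_app V (a i) q)"
    using insert by simp
  ultimately have "germ_eq p (vf_app V (\<lambda>q. a k q + (\<Sum>i\<in>I. a i q))) (\<lambda>q. vf_app V (a k) q + (\<Sum>i\<in>I. vf_app V (a i) q))"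
    by eventually_elim simp
  then show ?case using insert.hyps by simp
qed simp

lemma vf_app_field_add:
  assumes "locally_analytic p h"
  shows "germ_eq p (vf_app (\<lambda>j q. V j q + W j q) h) (\<lambda>q. vf_app V h q + vf_app W h q)"
proof -
  obtain I where I: "finite I" "\<And>J V. finite J \<Longrightarrow> I \<subseteq> J \<Longrightarrow> germ_eq p (vf_app V h) (\<lambda>q. \<Sum>j\<in>J. V j q * pd j h q)"
    using vf_app_sum[OF assms] by blast
  note I = I(2)[OF I(1) subset_refl]
  from I[of V] I[of W] I[of "\<lambda>j q. V j q + W j q"] show ?thesis
    by eventually_elim (simp add: sum.distrib distrib_right)
qed

lemma vf_app_field_scale: "vf_app (\<lambda>j q. a q * V j q) h q = a q * vf_app V h q"
  by (simp add: vf_app_def sum_distrib_left mult.assoc)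

lemma la_field_bracket [intro]: "la_field p V \<Longrightarrow> la_field p W \<Longrightarrow> la_field p (bracket V W)"
  unfolding la_field_def bracket_def
  by (intro allI la_diff la_vf_app) (auto simp: la_field_def)

lemma la_field_add [intro]: "la_field p V \<Longrightarrow> la_field p W \<Longrightarrow> la_field p (\<lambda>j q. V j q + W j q)"
  by (auto simp: la_field_def)

lemma la_field_scale [intro]: "locally_analytic p a \<Longrightarrow> la_field p V \<Longrightarrow> la_field p (\<lambda>j q. a q * V j q)"
  by (auto simp: la_field_def)

text \<open>In the commutator the second partials of \<open>h\<close> cancel by symmetry, and the
  remaining first-order terms are those of the bracket. This makes brackets computable as
  commutators of derivations.\<close>

lemma vf_app_bracket:
  assumes V: "la_field p V" and W: "la_field p W" and h: "locally_analytic p h"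
  shows "germ_eq p (vf_app (bracket V W) h) (\<lambda>q. vf_app V (vf_app W h) q - vf_app W (vf_app V h) q)"
proof -
  obtain I where I: "finite I" "near p (\<lambda>q. \<forall>j. j \<notin> I \<longrightarrow> pd j h q = 0)"
    "\<And>i. near p (\<lambda>q. \<forall>j. j \<notin> I \<longrightarrow> pd j (pd i h) q = 0)"
    using pd_zero_outside2[OF h] by blast
  have app: "near p (\<lambda>q. \<forall>V. vf_app V h q = (\<Sum>j\<in>I. V j q * pd j h q))"
    using I(2) by eventually_elim (use vf_app_eq_sum[OF I(1)] in blast)
  have "near p (\<lambda>q. \<forall>i\<in>I. \<forall>j. j \<notin> I \<longrightarrow> pd j (pd i h) q = 0)"
    by (intro eventually_ball_finite I(1) ballI I(3))
  then have app2: "near p (\<lambda>q. \<forall>i\<in>I. \<forall>V. vf_app V (pd i h) q = (\<Sum>j\<in>I. V j q * pd j (pd i h) q))"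
    by eventually_elim (use vf_app_eq_sum[OF I(1)] in blast)
  have twice: "germ_eq p (vf_app V (vf_app W h))
      (\<lambda>q. (\<Sum>j\<in>I. vf_app V (W j) q * pd j h q) + (\<Sum>j\<in>I. \<Sum>i\<in>I. W j q * V i q * pd i (pd j h) q))"
    if V: "la_field p V" and W: "la_field p W" for V W
  proof -
    have "germ_eq p (vf_app W h) (\<lambda>q. \<Sum>j\<in>I. W j q * pd j h q)" using app by eventually_elim simp
    from vf_app_germ_cong[OF this, of V]
    have "germ_eq p (vf_app V (vf_app W h)) (vf_app V (\<lambda>q. \<Sum>j\<in>I. W j q * pd j h q))" .
    moreover have "germ_eq p (vf_app V (\<lambda>q. \<Sum>j\<in>I. W j q * pd j h q)) (\<lambda>q. \<Sum>j\<in>I. vf_app V (\<lambda>q. W j q * pd j h q) q)"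
      by (intro vf_app_sum_fun I la_mult la_fieldD[OF W] la_pd h)
    moreover have "near p (\<lambda>q. \<forall>j\<in>I. vf_app V (\<lambda>q. W j q * pd j h q) q = vf_app V (W j) q * pd j h q + W j q * vf_app V (pd j h) q)"
      by (intro eventually_ball_finite I ballI vf_app_mult la_fieldD[OF W] la_pd h)
    ultimately show ?thesis using app2
      by eventually_elim (simp add: sum.distrib sum_distrib_left mult.assoc)
  qed
  have schwarz: "near p (\<lambda>q. \<forall>i\<in>I. \<forall>j\<in>I. pd i (pd j h) q = pd j (pd i h) q)"
    by (intro eventually_ball_finite I ballI pd_commute h)
  show ?thesis
    using twice[OF V W] twice[OF W V] schwarz app
  proof eventually_elim
    case (elim q)
    have "(\<Sum>j\<in>I. \<Sum>i\<in>I. W j q * V i q * pd i (pd j h) q) = (\<Sum>i\<in>I. \<Sum>j\<in>I. W j q * V i q * pd i (pd j h) q)"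
      by (rule sum.swap)
    also have "\<dots> = (\<Sum>j\<in>I. \<Sum>i\<in>I. V j q * W i q * pd i (pd j h) q)"
      using elim(3) by (intro sum.cong refl) (simp add: mult_ac)
    finally show ?case
      using elim(4) by (simp add: elim(1,2) bracket_def sum_subtractf left_diff_distrib)
  qed
qed

lemma vf_eqD: "vf_eq p V W \<Longrightarrow> germ_eq p (V j) (W j)"
  by (simp add: vf_eq_def)

lemma vf_eq_refl [simp]: "vf_eq p V V"
  by (simp add: vf_eq_def)

lemma vf_eq_sym: "vf_eq p V W \<Longrightarrow> vf_eq p W V"
  by (simp add: vf_eq_def eq_commute)

lemma vf_eq_trans: "vf_eq p U V \<Longrightarrow> vf_eq p V W \<Longrightarrow> vf_eq p U W"
  unfolding vf_eq_def
proof
  fix j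
  assume "\<forall>j. germ_eq p (U j) (V j)" "\<forall>j. germ_eq p (V j) (W j)"
  then have "germ_eq p (U j) (V j)" "germ_eq p (V j) (W j)" by auto
  then show "germ_eq p (U j) (W j)" by eventually_elim simp
qed

lemma la_field_cong: "la_field p V \<Longrightarrow> vf_eq p V W \<Longrightarrow> la_field p W"
  unfolding la_field_def vf_eq_def using la_cong by blast

lemma bracket_cong:
  assumes "vf_eq p V V'" "vf_eq p W W'" "la_field p V" "la_field p W"
  shows "vf_eq p (bracket V W) (bracket V' W')"
  unfolding vf_eq_def
proof
  fix j
  show "germ_eq p (bracket V W j) (bracket V' W' j)"
    using vf_app_cong[OF assms(1) vf_eqD[OF assms(2)] la_fieldD[OF assms(4)], of j]
      vf_app_cong[OF assms(2) vf_eqD[OF assms(1)] la_fieldD[OF assms(3)], of j]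
    by eventually_elim (simp add: bracket_def)
qed

lemma bracket_antisym: "bracket V W = (\<lambda>j q. - 1 * bracket W V j q)"
  by (simp add: bracket_def)

lemma bracket_add_left:
  assumes "la_field p V" "la_field p V'" "la_field p W"
  shows "vf_eq p (bracket (\<lambda>j q. V j q + V' j q) W) (\<lambda>j q. bracket V W j q + bracket V' W j q)"
  unfolding vf_eq_def
proof
  fix j
  show "germ_eq p (bracket (\<lambda>j q. V j q + V' j q) W j) (\<lambda>q. bracket V W j q + bracket V' W j q)"
    using vf_app_field_add[OF la_fieldD[OF assms(3)], of V V' j]
      vf_app_add[OF la_fieldD[OF assms(1)] la_fieldD[OF assms(2)], of W j j]
    by eventually_elim (simp add: bracket_def)
qed

lemma bracket_scale_left:
  assumes "locally_analytic p a" "la_field p V"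
  shows "vf_eq p (bracket (\<lambda>j q. a q * V j q) W) (\<lambda>j q. a q * bracket V W j q + (- vf_app W a q) * V j q)"
  unfolding vf_eq_def
proof
  fix j
  show "germ_eq p (bracket (\<lambda>j q. a q * V j q) W j) (\<lambda>q. a q * bracket V W j q + (- vf_app W a q) * V j q)"
    using vf_app_mult[OF assms(1) la_fieldD[OF assms(2)], of W j]
    by eventually_elim (simp add: bracket_def vf_app_field_scale algebra_simps)
qed

text \<open>Along each coordinate a double bracket is a sum of four twice-derived coefficients, by
  \<open>vf_app_bracket\<close>; in the identity these cancel in pairs.\<close>

lemma bracket_jacobi:
  assumes U: "la_field p U" and V: "la_field p V" and W: "la_field p W"
  shows "vf_eq p (bracket U (bracket V W)) (\<lambda>j q. bracket (bracket U V) W j q + bracket V (bracket U W) j q)"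
  unfolding vf_eq_def
proof
  fix j
  have expand: "germ_eq p (bracket U (bracket V W) j) (\<lambda>q. vf_app U (vf_app V (W j)) q - vf_app U (vf_app W (V j)) q
      - vf_app V (vf_app W (U j)) q + vf_app W (vf_app V (U j)) q)"
    if U: "la_field p U" and V: "la_field p V" and W: "la_field p W" for U V W
  proof -
    have "germ_eq p (vf_app U (\<lambda>q. vf_app V (W j) q - vf_app W (V j) q)) (\<lambda>q. vf_app U (vf_app V (W j)) q - vf_app U (vf_app W (V j)) q)"
      by (intro vf_app_diff la_vf_app V W la_fieldD[OF V] la_fieldD[OF W])
    with vf_app_bracket[OF V W la_fieldD[OF U], of j] show ?thesis
      by eventually_elim (simp add: bracket_def[of U "bracket V W"], simp add: bracket_def)
  qed
  have "germ_eq p (bracket (bracket U V) W j) (\<lambda>q. - bracket W (bracket U V) j q)"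
    by (simp add: bracket_def)
  with expand[OF U V W] expand[OF W U V] expand[OF V U W]
  show "germ_eq p (bracket U (bracket V W) j) (\<lambda>q. bracket (bracket U V) W j q + bracket V (bracket U W) j q)"
    by eventually_elim simp
qed

section \<open>Spans over germs and dimension\<close>

definition span_germs :: "jet \<Rightarrow> vfield list \<Rightarrow> vfield set" where
  "span_germs p Vs = {Z. \<exists>a. (\<forall>i<length Vs. locally_analytic p (a i)) \<and> vf_eq p Z (lincomb a Vs)}"

lemma span_vf_eq: "Z \<in> span_germs p Vs \<Longrightarrow> vf_eq p W Z \<Longrightarrow> W \<in> span_germs p Vs"
  unfolding span_germs_def using vf_eq_trans by blast

lemma span_zero: "(\<lambda>j q. 0) \<in> span_germs p Vs"
  unfolding span_germs_def by (auto intro!: exI[of _ "\<lambda>i q. 0"] simp: lincomb_def)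

lemma span_add:
  assumes "V \<in> span_germs p Vs" "W \<in> span_germs p Vs"
  shows "(\<lambda>j q. V j q + W j q) \<in> span_germs p Vs"
proof -
  obtain a where a: "\<forall>i<length Vs. locally_analytic p (a i)" "vf_eq p V (lincomb a Vs)"
    using assms(1) unfolding span_germs_def by blast
  obtain b where b: "\<forall>i<length Vs. locally_analytic p (b i)" "vf_eq p W (lincomb b Vs)"
    using assms(2) unfolding span_germs_def by blast
  have "vf_eq p (\<lambda>j q. V j q + W j q) (lincomb (\<lambda>i q. a i q + b i q) Vs)"
    unfolding vf_eq_def
  proof
    fix j
    show "germ_eq p (\<lambda>q. V j q + W j q) (lincomb (\<lambda>i q. a i q + b i q) Vs j)"
      using vf_eqD[OF a(2), of j] vf_eqD[OF b(2), of j]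
      by eventually_elim (simp add: lincomb_def sum.distrib distrib_right)
  qed
  then show ?thesis using a(1) b(1) unfolding span_germs_def
    by (intro CollectI exI[of _ "\<lambda>i q. a i q + b i q"]) auto
qed

lemma span_scale:
  assumes "locally_analytic p c" "V \<in> span_germs p Vs"
  shows "(\<lambda>j q. c q * V j q) \<in> span_germs p Vs"
proof -
  obtain a where a: "\<forall>i<length Vs. locally_analytic p (a i)" "vf_eq p V (lincomb a Vs)"
    using assms(2) unfolding span_germs_def by blast
  have "vf_eq p (\<lambda>j q. c q * V j q) (lincomb (\<lambda>i q. c q * a i q) Vs)"
    unfolding vf_eq_def
  proof
    fix j
    show "germ_eq p (\<lambda>q. c q * V j q) (lincomb (\<lambda>i q. c q * a i q) Vs j)"
      using vf_eqD[OF a(2), of j] by eventually_elim (simp add: lincomb_def sum_distrib_left mult.assoc)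
  qed
  then show ?thesis using a(1) assms(1) unfolding span_germs_def
    by (intro CollectI exI[of _ "\<lambda>i q. c q * a i q"]) auto
qed

lemma span_base: "V \<in> set Vs \<Longrightarrow> V \<in> span_germs p Vs"
proof -
  assume "V \<in> set Vs"
  then obtain k where k: "k < length Vs" "V = Vs ! k" by (auto simp: in_set_conv_nth)
  have "lincomb (\<lambda>i q. if i = k then 1 else 0) Vs = V"
    using k by (simp add: lincomb_def if_distrib[of "\<lambda>x. x * _"] cong: if_cong)
  then show ?thesis unfolding span_germs_def
    by (intro CollectI exI[of _ "\<lambda>i q. if i = k then 1 else 0"]) simp
qed

text \<open>The combination is built up one generator at a time, every partial sum staying in the
  span; \<open>cong\<close> passes to a field that agrees with it only as a germ.\<close>

lemma span_induct:
  assumes Z: "Z \<in> span_germs p Vs"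
    and base: "\<And>V. V \<in> set Vs \<Longrightarrow> P V" and zero: "P (\<lambda>j q. 0)"
    and add: "\<And>V W. V \<in> span_germs p Vs \<Longrightarrow> W \<in> span_germs p Vs \<Longrightarrow> P V \<Longrightarrow> P W \<Longrightarrow> P (\<lambda>j q. V j q + W j q)"
    and scale: "\<And>c V. locally_analytic p c \<Longrightarrow> V \<in> span_germs p Vs \<Longrightarrow> P V \<Longrightarrow> P (\<lambda>j q. c q * V j q)"
    and cong: "\<And>V W. V \<in> span_germs p Vs \<Longrightarrow> P V \<Longrightarrow> vf_eq p W V \<Longrightarrow> P W"
  shows "P Z"
proof -
  obtain a where a: "\<And>i. i < length Vs \<Longrightarrow> locally_analytic p (a i)" "vf_eq p Z (lincomb a Vs)"
    using Z unfolding span_germs_def by blast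
  have "P (\<lambda>j q. \<Sum>i<n. a i q * (Vs ! i) j q) \<and> (\<lambda>j q. \<Sum>i<n. a i q * (Vs ! i) j q) \<in> span_germs p Vs"
    if "n \<le> length Vs" for n
    using that
  proof (induction n)
    case 0
    show ?case using zero span_zero by simp
  next
    case (Suc n)
    then have n: "n < length Vs" by simp
    have "P (\<lambda>j q. a n q * (Vs ! n) j q)" "(\<lambda>j q. a n q * (Vs ! n) j q) \<in> span_germs p Vs"
      using scale[OF a(1)[OF n] _ base] span_scale[OF a(1)[OF n]] span_base nth_mem[OF n] by blast+
    then show ?case using Suc n add span_add by simp
  qed
  from this[of "length Vs"] show ?thesis
    using cong[OF _ _ a(2)] by (simp add: lincomb_def)
qed

lemma la_field_span:
  assumes "\<And>V. V \<in> set Vs \<Longrightarrow> la_field p V" "Z \<in> span_germs p Vs"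
  shows "la_field p Z"
  using assms(2)
proof (rule span_induct)
  show "la_field p (\<lambda>j q. 0)" by (simp add: la_field_def)
  show "la_field p W" if "la_field p V" "vf_eq p W V" for V W
    using la_field_cong[OF that(1) vf_eq_sym[OF that(2)]] .
qed (use assms(1) in auto)

text \<open>Scaling a field by \<open>c\<close> changes its bracket by a derivative of
  \<open>c\<close> times the same field, which stays in the span.\<close>

lemma span_bracket_left:
  assumes la: "\<And>V. V \<in> set Vs \<Longrightarrow> la_field p V" and W: "la_field p W"
    and gen: "\<And>V. V \<in> set Vs \<Longrightarrow> bracket V W \<in> span_germs p Vs"
    and V: "V \<in> span_germs p Vs"
  shows "bracket V W \<in> span_germs p Vs"
  using V
proof (rule span_induct)
  show "bracket (\<lambda>j q. 0) W \<in> span_germs p Vs"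
    using span_zero by (simp add: bracket_def vf_app_def)
  show "bracket (\<lambda>j q. V j q + V' j q) W \<in> span_germs p Vs"
    if "V \<in> span_germs p Vs" "V' \<in> span_germs p Vs" "bracket V W \<in> span_germs p Vs" "bracket V' W \<in> span_germs p Vs" for V V'
    by (rule span_vf_eq[OF span_add[OF that(3,4)]])
      (intro bracket_add_left W la_field_span[OF la that(1)] la_field_span[OF la that(2)])
  show "bracket (\<lambda>j q. c q * V j q) W \<in> span_germs p Vs"
    if "locally_analytic p c" "V \<in> span_germs p Vs" "bracket V W \<in> span_germs p Vs" for c V
    by (rule span_vf_eq[OF span_add[OF span_scale[OF that(1,3)] span_scale[OF _ that(2)]]
        bracket_scale_left[OF that(1) la_field_span[OF la that(2)]]])
      (intro la_uminus la_vf_app W that)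
  show "bracket V' W \<in> span_germs p Vs"
    if "V \<in> span_germs p Vs" "bracket V W \<in> span_germs p Vs" "vf_eq p V' V" for V V'
    by (rule span_vf_eq[OF that(2)], rule bracket_cong[OF that(3) vf_eq_refl _ W])
      (rule la_field_cong[OF la_field_span[OF la that(1)] vf_eq_sym[OF that(3)]])
qed (rule gen)

text \<open>\<open>span_bracket_left\<close> is used once for each slot, with antisymmetry
  exchanging the slots.\<close>

lemma span_bracket:
  assumes la: "\<And>V. V \<in> set Vs \<Longrightarrow> la_field p V"
    and gen: "\<And>V W. V \<in> set Vs \<Longrightarrow> W \<in> set Vs \<Longrightarrow> bracket V W \<in> span_germs p Vs"
    and VW: "V \<in> span_germs p Vs" "W \<in> span_germs p Vs"
  shows "bracket V W \<in> span_germs p Vs"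
proof (rule span_bracket_left[OF la la_field_span[OF la VW(2)] _ VW(1)])
  fix V assume V: "V \<in> set Vs"
  have "bracket W V \<in> span_germs p Vs"
    by (rule span_bracket_left[OF la la[OF V] gen[OF _ V] VW(2)])
  from span_scale[OF la_const[of p "-1"] this] show "bracket V W \<in> span_germs p Vs"
    by (subst bracket_antisym)
qed

text \<open>Fraction-free Gaussian elimination; germs have no zero divisors by the identity theorem.\<close>

lemma germs_dependent:
  fixes v :: "'i \<Rightarrow> nat \<Rightarrow> jet \<Rightarrow> real"
  assumes "finite S" "card S > n" "\<And>i k. i \<in> S \<Longrightarrow> k < n \<Longrightarrow> locally_analytic p (v i k)"
  shows "\<exists>a. (\<forall>i\<in>S. locally_analytic p (a i)) \<and> (\<exists>i\<in>S. \<not> near p (\<lambda>q. a i q = 0)) \<and>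
    (\<forall>k<n. near p (\<lambda>q. (\<Sum>i\<in>S. a i q * v i k q) = 0))"
  using assms
proof (induction n arbitrary: S v)
  case 0
  then have "S \<noteq> {}" by auto
  then show ?case by (intro exI[of _ "\<lambda>_ _. 1"]) (auto dest: near_at)
next
  case (Suc n)
  show ?case
  proof (cases "\<forall>i\<in>S. near p (\<lambda>q. v i n q = 0)")
    case True
    obtain a where a: "\<forall>i\<in>S. locally_analytic p (a i)" "\<exists>i\<in>S. \<not> near p (\<lambda>q. a i q = 0)"
      "\<forall>k<n. near p (\<lambda>q. (\<Sum>i\<in>S. a i q * v i k q) = 0)"
      using Suc.IH[of S v] Suc.prems by auto
    have "near p (\<lambda>q. \<forall>i\<in>S. v i n q = 0)"
      using True by (intro eventually_ball_finite Suc.prems)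
    then have "near p (\<lambda>q. (\<Sum>i\<in>S. a i q * v i n q) = 0)" by eventually_elim simp
    then show ?thesis using a by (intro exI[of _ a]) (auto simp: less_Suc_eq)
  next
    case False
    then obtain m where m: "m \<in> S" "\<not> near p (\<lambda>q. v m n q = 0)" by blast
    let ?S = "S - {m}"
    \<comment> \<open>Cross-multiplication with the pivot row \<open>m\<close> clears column
      \<open>n\<close> without dividing.\<close>
    define w where "w i k q = v m n q * v i k q - v i n q * v m k q" for i k q
    have "finite ?S" "card ?S > n" using Suc.prems m by auto
    moreover have "locally_analytic p (w i k)" if "i \<in> ?S" "k < n" for i k
      unfolding w_def[abs_def] using that m Suc.prems(3) by (intro la_diff la_mult) auto
    ultimately obtain a where a: "\<forall>i\<in>?S. locally_analytic p (a i)" "\<exists>i\<in>?S. \<not> near p (\<lambda>q. a i q = 0)"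
      "\<forall>k<n. near p (\<lambda>q. (\<Sum>i\<in>?S. a i q * w i k q) = 0)"
      using Suc.IH[of ?S w] by blast
    \<comment> \<open>The elimination is undone: row \<open>i\<close> gets the weight
      \<open>a i * v m n\<close>, and the pivot row absorbs the subtracted multiples, so that the
      combination equals that of the rows \<open>w\<close>.\<close>
    define b where "b i q = (if i = m then - (\<Sum>i\<in>?S. a i q * v i n q) else a i q * v m n q)" for i q
    have lb: "locally_analytic p (b i)" if "i \<in> S" for i
    proof (cases "i = m")
      case True
      have "locally_analytic p (\<lambda>q. - (\<Sum>i\<in>?S. a i q * v i n q))"
        using a(1) Suc.prems(3) by (intro la_uminus la_sum la_mult) auto
      then show ?thesis using True by (simp add: b_def[abs_def])
    next
      case False
      then have "locally_analytic p (\<lambda>q. a i q * v m n q)"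
        using a(1) that m Suc.prems(3) by (intro la_mult) auto
      then show ?thesis using False by (simp add: b_def[abs_def])
    qed
    have sum_b: "(\<Sum>i\<in>S. b i q * v i k q) = (\<Sum>i\<in>?S. a i q * w i k q)" for k q
    proof -
      have "(\<Sum>i\<in>S. b i q * v i k q) = b m q * v m k q + (\<Sum>i\<in>?S. b i q * v i k q)"
        by (rule sum.remove[OF Suc.prems(1) m(1)])
      also have "(\<Sum>i\<in>?S. b i q * v i k q) = (\<Sum>i\<in>?S. a i q * v m n q * v i k q)"
        by (rule sum.cong) (auto simp: b_def)
      also have "b m q * v m k q = - (\<Sum>i\<in>?S. a i q * v i n q * v m k q)"
        by (simp add: b_def sum_distrib_right)
      finally show ?thesis
        by (simp add: w_def right_diff_distrib sum_subtractf mult_ac)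
    qed
    have "near p (\<lambda>q. (\<Sum>i\<in>S. b i q * v i k q) = 0)" if "k < Suc n" for k
    proof (cases "k = n")
      case True
      then show ?thesis by (simp add: sum_b w_def mult_ac)
    qed (use that a(3) in \<open>simp add: sum_b\<close>)
    moreover obtain i where i: "i \<in> ?S" "\<not> near p (\<lambda>q. a i q = 0)" using a(2) by blast
    have "\<not> near p (\<lambda>q. b i q = 0)"
    proof
      assume "near p (\<lambda>q. b i q = 0)"
      then have "near p (\<lambda>q. a i q * v m n q = 0)" using i(1) by (simp add: b_def)
      then have "near p (\<lambda>q. v m n q = 0)"
        using la_domain[OF _ _ _ i(2)] a(1) i(1) m(1) Suc.prems(3) by blast
      then show False using m by simp
    qed
    ultimately show ?thesis using lb i(1) by (intro exI[of _ b]) blast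
  qed
qed

text \<open>Expanded in the basis, more than \<open>length Vs\<close> elements give a matrix with
  more rows than columns; a nontrivial relation among its rows is one among the elements.\<close>

lemma basis_dimension:
  assumes basis: "is_basis p L Vs"
  shows "has_dimension p L (length Vs)"
  unfolding has_dimension_def
proof (intro conjI allI impI)
  show "\<exists>Ws. set Ws \<subseteq> L \<and> lin_indep p Ws \<and> length Ws = length Vs"
    using basis unfolding is_basis_def by blast
  fix Ws assume Ws: "set Ws \<subseteq> L \<and> lin_indep p Ws"
  show "length Ws \<le> length Vs"
  proof (rule ccontr)
    assume "\<not> length Ws \<le> length Vs"
    have "\<forall>i<length Ws. \<exists>a. (\<forall>k<length Vs. locally_analytic p (a k)) \<and> vf_eq p (Ws ! i) (lincomb a Vs)"
      using Ws basis unfolding is_basis_def by (meson nth_mem subsetD)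
    then obtain v where v: "\<And>i k. i < length Ws \<Longrightarrow> k < length Vs \<Longrightarrow> locally_analytic p (v i k)"
      "\<And>i. i < length Ws \<Longrightarrow> vf_eq p (Ws ! i) (lincomb (v i) Vs)" by metis
    obtain a where a: "\<forall>i\<in>{..<length Ws}. locally_analytic p (a i)" "\<exists>i\<in>{..<length Ws}. \<not> near p (\<lambda>q. a i q = 0)"
      "\<forall>k<length Vs. near p (\<lambda>q. (\<Sum>i<length Ws. a i q * v i k q) = 0)"
      using germs_dependent[of "{..<length Ws}" "length Vs" p v] v(1) \<open>\<not> length Ws \<le> length Vs\<close> by auto
    have "vf_eq p (lincomb a Ws) (\<lambda>j q. 0)"
      unfolding vf_eq_def
    proof
      fix j
      have "near p (\<lambda>q. \<forall>i\<in>{..<length Ws}. (Ws ! i) j q = lincomb (v i) Vs j q)"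
        using v(2) by (intro eventually_ball_finite) (auto dest: vf_eqD)
      moreover have "near p (\<lambda>q. \<forall>k\<in>{..<length Vs}. (\<Sum>i<length Ws. a i q * v i k q) = 0)"
        using a(3) by (intro eventually_ball_finite) auto
      ultimately show "germ_eq p (lincomb a Ws j) (\<lambda>q. 0)"
      proof eventually_elim
        case (elim q)
        have "lincomb a Ws j q = (\<Sum>i<length Ws. \<Sum>k<length Vs. a i q * v i k q * (Vs ! k) j q)"
          using elim(1) by (simp add: lincomb_def sum_distrib_left mult.assoc)
        also have "\<dots> = (\<Sum>k<length Vs. (\<Sum>i<length Ws. a i q * v i k q) * (Vs ! k) j q)"
          by (subst sum.swap) (simp add: sum_distrib_right)
        also have "\<dots> = 0" using elim(2) by simp
        finally show ?case .
      qed
    qed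
    then show False using Ws a(1,2) unfolding lin_indep_def by blast
  qed
qed

section \<open>The shift along an orbit\<close>

text \<open>The chain rule for a derivation, obtained by swapping the sums over the coordinates
  before and after the substitution.\<close>

lemma vf_app_compose:
  assumes V: "la_field p V" and h: "locally_analytic (\<phi> p) h" and \<phi>: "\<And>i. locally_analytic p (\<lambda>q. \<phi> q i)"
  shows "\<exists>I. finite I \<and> (\<forall>I'. finite I' \<longrightarrow> I \<subseteq> I' \<longrightarrow>
    germ_eq p (vf_app V (\<lambda>q. h (\<phi> q))) (\<lambda>q. \<Sum>i\<in>I'. pd i h (\<phi> q) * vf_app V (\<lambda>q. \<phi> q i) q))"
proof -
  obtain I where I: "finite I" "\<And>I' j. finite I' \<Longrightarrow> I \<subseteq> I' \<Longrightarrow>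
      near p (\<lambda>q. pd j (\<lambda>q. h (\<phi> q)) q = (\<Sum>i\<in>I'. pd i h (\<phi> q) * pd j (\<lambda>q. \<phi> q i) q))"
    by (rule pd_compose[OF h \<phi>]) blast
  have "germ_eq p (vf_app V (\<lambda>q. h (\<phi> q))) (\<lambda>q. \<Sum>i\<in>I'. pd i h (\<phi> q) * vf_app V (\<lambda>q. \<phi> q i) q)"
    if I': "finite I'" "I \<subseteq> I'" for I'
  proof -
    let ?Q = "\<lambda>i J. finite J \<and> (\<forall>J' V. finite J' \<longrightarrow> J \<subseteq> J' \<longrightarrow>
        germ_eq p (vf_app V (\<lambda>q. \<phi> q i)) (\<lambda>q. \<Sum>j\<in>J'. V j q * pd j (\<lambda>q. \<phi> q i) q))"
    have "\<forall>i. \<exists>J. ?Q i J" by (intro allI vf_app_sum \<phi>)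
    then obtain J where "\<forall>i. ?Q i (J i)" using choice[of ?Q] by blast
    then have J: "\<And>i. finite (J i)" "\<And>i J' V. finite J' \<Longrightarrow> J i \<subseteq> J' \<Longrightarrow>
        germ_eq p (vf_app V (\<lambda>q. \<phi> q i)) (\<lambda>q. \<Sum>j\<in>J'. V j q * pd j (\<lambda>q. \<phi> q i) q)" by blast+
    obtain L where L: "finite L" "\<And>J' V. finite J' \<Longrightarrow> L \<subseteq> J' \<Longrightarrow>
        germ_eq p (vf_app V (\<lambda>q. h (\<phi> q))) (\<lambda>q. \<Sum>j\<in>J'. V j q * pd j (\<lambda>q. h (\<phi> q)) q)"
      using vf_app_sum[OF la_compose[OF h \<phi>]] by blast
    define M where "M = L \<union> (\<Union>i\<in>I'. J i)"
    have M: "finite M" "L \<subseteq> M" "\<And>i. i \<in> I' \<Longrightarrow> J i \<subseteq> M" using L I' J by (auto simp: M_def)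
    have "near p (\<lambda>q. \<forall>i\<in>I'. vf_app V (\<lambda>q. \<phi> q i) q = (\<Sum>j\<in>M. V j q * pd j (\<lambda>q. \<phi> q i) q))"
      by (intro eventually_ball_finite ballI J(2) M I')
    moreover have "near p (\<lambda>q. \<forall>j\<in>M. pd j (\<lambda>q. h (\<phi> q)) q = (\<Sum>i\<in>I'. pd i h (\<phi> q) * pd j (\<lambda>q. \<phi> q i) q))"
      by (intro eventually_ball_finite ballI I(2) M I')
    ultimately show ?thesis using L(2)[OF M(1,2), of V]
    proof eventually_elim
      case (elim q)
      have "vf_app V (\<lambda>q. h (\<phi> q)) q = (\<Sum>j\<in>M. \<Sum>i\<in>I'. pd i h (\<phi> q) * (V j q * pd j (\<lambda>q. \<phi> q i) q))"
        using elim(2) by (simp add: elim(3) sum_distrib_left mult_ac)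
      also have "\<dots> = (\<Sum>i\<in>I'. pd i h (\<phi> q) * vf_app V (\<lambda>q. \<phi> q i) q)"
        using elim(1) by (subst sum.swap) (simp add: sum_distrib_left)
      finally show ?case .
    qed
  qed
  then show ?thesis using I(1) by blast
qed

lemma la_field_Xfield [simp]: "la_field p Xfield"
  by (simp add: la_field_def Xfield_def)

lemma vf_app_Xfield:
  assumes "locally_analytic p h"
  shows "germ_eq p (vf_app Xfield h) (pd Vtx h)"
proof -
  obtain I where I: "finite I" "\<And>J V. finite J \<Longrightarrow> I \<subseteq> J \<Longrightarrow> germ_eq p (vf_app V h) (\<lambda>q. \<Sum>j\<in>J. V j q * pd j h q)"
    using vf_app_sum[OF assms] by blast
  have "(\<Sum>j\<in>insert Vtx I. Xfield j q * pd j h q) = pd Vtx h q" for q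
    using I(1) by (simp add: Xfield_def if_distrib[of "\<lambda>x. x * _"] cong: if_cong)
  with I(2)[of "insert Vtx I" Xfield] I(1) show ?thesis by auto
qed

lemma on_jets_upd: "j \<notin> {Vx, Vt m, Vt (m + 1), Vtx} \<Longrightarrow> on_jets f m (q(j := s)) = on_jets f m q"
  by (auto simp: on_jets_def)

lemma pd_indep:
  assumes "\<And>q s. h (q(j := s)) = h q"
  shows "pd j h q = 0"
  by (simp add: pd_def assms)

declare Kfield.simps(3) [simp del]

text \<open>The hypotheses of the theorem, fixed once. Statements inside refer to an arbitrary orbit
  point \<open>P m\<close>, since \<open>D\<close> relates germs at consecutive points.\<close>

locale chain =
  fixes f g :: "real \<Rightarrow> real \<Rightarrow> real \<Rightarrow> real \<Rightarrow> real"
    and U :: "(real \<times> real \<times> real \<times> real) set"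
    and P :: "int \<Rightarrow> jet"
  assumes U: "open U"
    and f_analytic: "\<forall>q\<in>jets_over U. analytic_in {Vx, Vt 0, Vt 1, Vtx} (on_jets f 0) q"
    and f_tx: "\<forall>q\<in>jets_over U. pd Vtx (on_jets f 0) q \<noteq> 0"
    and f_txtx: "\<forall>q\<in>jets_over U. pd Vtx (pd Vtx (on_jets f 0)) q \<noteq> 0"
    and g_inverse: "\<forall>(x, t, t1, s)\<in>U. g x t t1 (f x t t1 s) = s"
    and orbit: "\<forall>m. P (m + 1) = shift f (P m)"
    and orbit_in_domain: "\<forall>m. P m \<in> jets_over U"
begin

abbreviation "F \<equiv> on_jets f 0"
abbreviation "Fs \<equiv> pd Vtx F"
abbreviation "Fss \<equiv> pd Vtx Fs"
abbreviation "K \<equiv> Kfield f g"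
abbreviation T :: "int \<Rightarrow> jet \<Rightarrow> real" where "T k \<equiv> K (Vt k)"

lemma near_domain: "near (P m) (\<lambda>q. q \<in> jets_over U)"
proof -
  have "((\<lambda>q. (q Vx, q (Vt 0), q (Vt 1), q Vtx)) \<longlongrightarrow> (P m Vx, P m (Vt 0), P m (Vt 1), P m Vtx)) (nhds (P m))"
    by (intro tendsto_Pair tendsto_coord)
  from topological_tendstoD[OF this U] show ?thesis
    using orbit_in_domain by (simp add: jets_over_def)
qed

lemma la_F: "locally_analytic (P m) F"
  unfolding locally_analytic_def
  by (intro exI[of _ "{Vx, Vt 0, Vt 1, Vtx}"]) (use f_analytic orbit_in_domain in auto)

lemma near_Fs: "near (P m) (\<lambda>q. Fs q \<noteq> 0)"
  using near_domain by eventually_elim (use f_tx in blast)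

lemma near_Fss: "near (P m) (\<lambda>q. Fss q \<noteq> 0)"
  using near_domain by eventually_elim (use f_txtx in blast)

lemma la_shift: "locally_analytic (P m) (\<lambda>q. shift f q i)"
  by (cases i) (use la_F in simp_all)

lemma la_D: "locally_analytic (P (m + 1)) u \<Longrightarrow> locally_analytic (P m) (D f u)"
  unfolding D_def by (rule la_compose[OF _ la_shift]) (use orbit in simp)

lemma near_shift:
  assumes "near (P (m + 1)) Q"
  shows "near (P m) (\<lambda>q. Q (shift f q))"
proof (rule eventually_compose_filterlim[OF assms])
  show "filterlim (shift f) (nhds (P (m + 1))) (nhds (P m))"
    unfolding orbit[rule_format] by (rule tendsto_jetI) (rule la_tendsto[OF la_shift])
qed

lemma shift_back_shift:
  assumes "q \<in> jets_over U"
  shows "shift_back g (shift f q) = q"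
proof
  fix i
  have "g (q Vx) (q (Vt 0)) (q (Vt 1)) (f (q Vx) (q (Vt 0)) (q (Vt 1)) (q Vtx)) = q Vtx"
    using assms g_inverse by (auto simp: jets_over_def)
  then show "shift_back g (shift f q) i = q i"
    by (cases i) (auto simp: on_jets_def)
qed

text \<open>The part of \<open>shift_back\<close> that merely moves indices. With it split off,
  \<open>g\<close> enters as \<open>on_jets g 0\<close>, a function of the same four variables as
  \<open>F\<close>.\<close>

definition unshift :: "jet \<Rightarrow> jet" where
  "unshift q = (\<lambda>i. case i of Vx \<Rightarrow> q Vx | Vtx \<Rightarrow> q Vtx | Vt k \<Rightarrow> q (Vt (k - 1)))"

lemma unshift_simps [simp]: "unshift q Vx = q Vx" "unshift q Vtx = q Vtx" "unshift q (Vt k) = q (Vt (k - 1))"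
  by (simp_all add: unshift_def)

lemma shift_back_eq: "shift_back g q = (unshift q)(Vtx := on_jets g 0 (unshift q))"
proof
  show "shift_back g q i = ((unshift q)(Vtx := on_jets g 0 (unshift q))) i" for i
    by (cases i) (auto simp: on_jets_def)
qed

lemma unshift_orbit: "unshift (P (m + 1)) = (P m)(Vtx := F (P m))"
proof
  show "unshift (P (m + 1)) i = ((P m)(Vtx := F (P m))) i" for i
    using orbit by (cases i) auto
qed

text \<open>The analytic solution \<open>S\<close> of the implicit equation stays in the domain,
  where \<open>g\<close> is a left inverse; applying \<open>g\<close> identifies it with
  \<open>S\<close>. Hence \<open>g\<close> is analytic here and a right inverse as well.\<close>

lemma g_implicit:
  defines "p \<equiv> \<lambda>m. (P m)(Vtx := F (P m))"
  shows "locally_analytic (p m) (on_jets g 0)"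
    and "near (p m) (\<lambda>q. F (q(Vtx := on_jets g 0 q)) = q Vtx)"
proof -
  obtain J r where J: "finite J" "r > 0" "\<And>q. (\<forall>i\<in>J. \<bar>q i - P m i\<bar> \<le> r) \<Longrightarrow> q \<in> jets_over U"
    using near_domain[of m] unfolding near_iff_box by blast
  have "Fs (P m) \<noteq> 0" using f_tx orbit_in_domain by blast
  \<comment> \<open>The tolerance \<open>r\<close> keeps the solution in the box that lies inside
    the domain.\<close>
  then obtain S where S: "locally_analytic (p m) S"
    "near (p m) (\<lambda>q. F (q(Vtx := S q)) = q Vtx \<and> \<bar>S q - P m Vtx\<bar> \<le> r)"
    unfolding p_def using implicit_function[OF la_F _ J(2)] by blast
  have eq: "near (p m) (\<lambda>q. S q = on_jets g 0 q \<and> F (q(Vtx := S q)) = q Vtx)"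
    using S(2) near_box[OF J(1,2), of "p m"]
  proof eventually_elim
    case (elim q)
    have "q(Vtx := S q) \<in> jets_over U"
    proof (rule J(3), rule)
      fix i assume "i \<in> J"
      then have "\<bar>q i - p m i\<bar> < r" using elim(2) by blast
      then show "\<bar>(q(Vtx := S q)) i - P m i\<bar> \<le> r" using elim(1) by (auto simp: p_def)
    qed
    then have "g (q Vx) (q (Vt 0)) (q (Vt 1)) (f (q Vx) (q (Vt 0)) (q (Vt 1)) (S q)) = S q"
      using g_inverse by (auto simp: jets_over_def)
    moreover have "f (q Vx) (q (Vt 0)) (q (Vt 1)) (S q) = q Vtx" using elim(1) by (simp add: on_jets_def)
    ultimately show ?case using elim(1) by (simp add: on_jets_def)
  qed
  show "locally_analytic (p m) (on_jets g 0)"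
    by (rule la_cong[OF S(1)]) (use eq in \<open>auto elim: eventually_mono\<close>)
  show "near (p m) (\<lambda>q. F (q(Vtx := on_jets g 0 q)) = q Vtx)"
    using eq by eventually_elim auto
qed

lemma la_unshift: "locally_analytic p (\<lambda>q. unshift q i)"
  by (cases i) simp_all

lemma la_shift_back: "locally_analytic (P (m + 1)) (\<lambda>q. shift_back g q i)"
proof (cases "i = Vtx")
  case True
  have "locally_analytic (unshift (P (m + 1))) (on_jets g 0)"
    unfolding unshift_orbit by (rule g_implicit)
  from la_compose[OF this la_unshift] show ?thesis unfolding shift_back_eq by (simp add: True)
qed (use la_unshift in \<open>simp add: shift_back_eq\<close>)

lemma shift_back_orbit: "shift_back g (P (m + 1)) = P m"
  using shift_back_shift orbit_in_domain orbit by simp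

lemma near_shift_back:
  assumes "near (P m) Q"
  shows "near (P (m + 1)) (\<lambda>q. Q (shift_back g q))"
proof (rule eventually_compose_filterlim[OF assms])
  have "filterlim (shift_back g) (nhds (shift_back g (P (m + 1)))) (nhds (P (m + 1)))"
    by (rule tendsto_jetI) (rule la_tendsto[OF la_shift_back])
  then show "filterlim (shift_back g) (nhds (P m)) (nhds (P (m + 1)))" by (simp only: shift_back_orbit)
qed

text \<open>The right inverse property comes from the implicit equation for \<open>g\<close>. It is
  what carries facts forward along the orbit, where a left inverse alone would not suffice.\<close>

lemma shift_shift_back: "near (P (m + 1)) (\<lambda>q. shift f (shift_back g q) = q)"
proof -
  have "filterlim unshift (nhds (unshift (P (m + 1)))) (nhds (P (m + 1)))"
    by (rule tendsto_jetI) (rule la_tendsto[OF la_unshift])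
  from eventually_compose_filterlim[OF g_implicit(2)[of m, folded unshift_orbit] this]
  show ?thesis
  proof eventually_elim
    case (elim q)
    show ?case
    proof
      fix i
      show "shift f (shift_back g q) i = q i"
        using elim by (cases i) (simp_all add: shift_back_eq)
    qed
  qed
qed

text \<open>Both inverse properties are at hand, so composition with \<open>shift\<close> matches
  germs at consecutive orbit points bijectively.\<close>

lemma near_shift_iff: "near (P m) (\<lambda>q. Q (shift f q)) \<longleftrightarrow> near (P (m + 1)) Q"
proof
  assume "near (P m) (\<lambda>q. Q (shift f q))"
  from near_shift_back[OF this] shift_shift_back[of m] show "near (P (m + 1)) Q"
    by eventually_elim simp
qed (rule near_shift)

section \<open>Coefficients of \<open>K\<close> under the shift\<close>

lemma T_0: "T 0 = (\<lambda>q. q Vtx)"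
  by (simp add: fun_eq_iff Kfield.simps(3))

lemma T_1: "T 1 = F"
  by (simp add: fun_eq_iff Kfield.simps(3))

lemma T_pos: "k \<ge> 0 \<Longrightarrow> T (k + 1) q = T k (shift f q)"
proof (cases "k = 0")
  case False
  assume "k \<ge> 0"
  with False have "nat k = Suc (nat (k - 1))" by simp
  then show ?thesis using False \<open>k \<ge> 0\<close> by (simp add: D_def Kfield.simps(3))
qed (simp add: Kfield.simps(3))

lemma T_neg: "k < 0 \<Longrightarrow> T k q = T (k + 1) (shift_back g q)"
proof (cases "k = -1")
  case False
  assume "k < 0"
  with False have "nat (- k - 1) = Suc (nat (- (k + 1) - 1))" by simp
  then show ?thesis using False \<open>k < 0\<close> by (simp add: Dinv_def Kfield.simps(3))
qed (simp add: Kfield.simps(3))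

text \<open>The two-sided definition of \<open>K\<close> becomes uniform: for nonnegative
  \<open>k\<close> by construction, for negative \<open>k\<close> because \<open>shift_back\<close>
  undoes \<open>shift\<close>.\<close>

lemma T_shift: "q \<in> jets_over U \<Longrightarrow> T k (shift f q) = T (k + 1) q"
  using T_pos[of k q] T_neg[of k "shift f q"] shift_back_shift[of q] by (cases "k \<ge> 0") auto

lemma D_T: "germ_eq (P m) (D f (T k)) (T (k + 1))"
  using near_domain by eventually_elim (simp only: D_def T_shift)

lemma la_T: "locally_analytic (P m) (T k)"
\<comment> \<open>Each step in \<open>k\<close> passes to a neighbouring point of the orbit, so
  \<open>m\<close> has to vary.\<close>
proof (induction k arbitrary: m rule: int_induct[where k = 0])
  case base
  show ?case unfolding T_0 by simp
next
  case (step1 k)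
  have "T (k + 1) = D f (T k)" using T_pos[OF step1(1)] by (auto simp: D_def)
  then show ?case using la_D[OF step1(2)[of "m + 1"]] by simp
next
  case (step2 k)
  have T: "T (k - 1) = (\<lambda>q. T k (shift_back g q))" using T_neg[of "k - 1"] step2(1) by auto
  have "locally_analytic (P (m - 1 + 1)) (T (k - 1))" unfolding T
    by (rule la_compose[OF _ la_shift_back]) (unfold shift_back_orbit, rule step2(2))
  then show ?case by simp
qed

lemma la_K: "la_field (P m) K"
  unfolding la_field_def
proof
  fix j show "locally_analytic (P m) (K j)"
  proof (cases j)
    case Vx
    have "K Vx = (\<lambda>q. 1)" by (simp add: fun_eq_iff)
    then show ?thesis by (simp add: Vx)
  next
    case Vtx
    have "K Vtx = (\<lambda>q. 0)" by (simp add: fun_eq_iff)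
    then show ?thesis by (simp add: Vtx)
  qed (simp only: la_T)
qed

section \<open>Commuting \<open>X\<close> and \<open>K\<close> with the shift\<close>

lemma pd_shift_Vtx: "pd Vtx (\<lambda>q. shift f q i) = (\<lambda>q. if i = Vtx then Fs q else 0)"
  by (cases i) (auto simp: fun_eq_iff)

text \<open>Among the coordinates of \<open>shift f q\<close> only the one at \<open>Vtx\<close>,
  which is \<open>F q\<close>, depends on \<open>t_x\<close>.\<close>

lemma X_D:
  assumes u: "locally_analytic (P (m + 1)) u"
  shows "germ_eq (P m) (pd Vtx (D f u)) (\<lambda>q. Fs q * D f (pd Vtx u) q)"
proof -
  have u': "locally_analytic (shift f (P m)) u" using u orbit by simp
  obtain I where I: "finite I" "\<And>I' j. finite I' \<Longrightarrow> I \<subseteq> I' \<Longrightarrow>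
      germ_eq (P m) (pd j (\<lambda>q. u (shift f q))) (\<lambda>q. \<Sum>i\<in>I'. pd i u (shift f q) * pd j (\<lambda>q. shift f q i) q)"
    by (rule pd_compose[OF u' la_shift]) blast
  have "(\<Sum>i\<in>insert Vtx I. pd i u (shift f q) * pd Vtx (\<lambda>q. shift f q i) q) = Fs q * D f (pd Vtx u) q" for q
    using I(1) by (simp add: pd_shift_Vtx D_def if_distrib[of "\<lambda>x. _ * x"] cong: if_cong)
  with I(2)[of "insert Vtx I" Vtx] I(1) show ?thesis by (simp add: D_def subset_insertI)
qed

text \<open>In expanded form this is \<open>f_x + t_x f_t + f f_t1\<close>, the expression
  subtracted in the second identity; see \<open>\<kappa>_eq\<close>.\<close>

definition \<kappa> :: "jet \<Rightarrow> real" where "\<kappa> = vf_app K F"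

text \<open>\<open>K\<close> and its shifted copy agree in every coordinate except
  \<open>t_x\<close>: there \<open>K\<close> has coefficient 0, whereas the shifted coordinate
  \<open>F\<close> has derivative \<kappa>.\<close>

lemma K_D:
  assumes u: "locally_analytic (P (m + 1)) u"
  shows "germ_eq (P m) (vf_app K (D f u)) (\<lambda>q. D f (vf_app K u) q + \<kappa> q * D f (pd Vtx u) q)"
proof -
  have u': "locally_analytic (shift f (P m)) u" using u orbit by simp
  obtain I where I: "finite I" "\<And>I'. finite I' \<Longrightarrow> I \<subseteq> I' \<Longrightarrow>
      germ_eq (P m) (vf_app K (\<lambda>q. u (shift f q))) (\<lambda>q. \<Sum>i\<in>I'. pd i u (shift f q) * vf_app K (\<lambda>q. shift f q i) q)"
    using vf_app_compose[OF la_K[of m] u' la_shift] by blast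
  obtain L where L: "finite L" "\<And>J V. finite J \<Longrightarrow> L \<subseteq> J \<Longrightarrow> germ_eq (P (m + 1)) (vf_app V u) (\<lambda>q. \<Sum>j\<in>J. V j q * pd j u q)"
    using vf_app_sum[OF u] by blast
  let ?J = "insert Vtx (I \<union> L)"
  have J: "finite ?J" "I \<subseteq> ?J" "L \<subseteq> ?J" using I(1) L(1) by auto
  from I(2)[OF J(1,2)] near_shift[OF L(2)[OF J(1,3), of K]] near_domain[of m] show ?thesis
  proof eventually_elim
    case (elim q)
    have comp: "vf_app K (\<lambda>q. shift f q i) q = K i (shift f q) + (if i = Vtx then \<kappa> q else 0)" for i
    proof (cases i)
      case (Vt k)
      have "vf_app K (\<lambda>q. shift f q i) q = T (k + 1) q" by (simp only: Vt shift.simps vf_app_coord)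
      then show ?thesis using T_shift[OF elim(3), of k] by (simp only: Vt) simp
    next
      case Vtx
      then show ?thesis by (simp add: \<kappa>_def)
    qed simp
    have "vf_app K (D f u) q = (\<Sum>i\<in>?J. K i (shift f q) * pd i u (shift f q) + (if i = Vtx then \<kappa> q * pd Vtx u (shift f q) else 0))"
      unfolding D_def elim(1) comp by (rule sum.cong) (auto simp: algebra_simps)
    also have "\<dots> = D f (vf_app K u) q + \<kappa> q * D f (pd Vtx u) q"
      unfolding sum.distrib using J(1) by (simp add: D_def elim(2))
    finally show ?case .
  qed
qed

lemma vf_app_K_jets:
  assumes "\<And>q j s. j \<notin> {Vx, Vt 0, Vt 1, Vtx} \<Longrightarrow> h (q(j := s)) = h q"
  shows "vf_app K h q = pd Vx h q + q Vtx * pd (Vt 0) h q + F q * pd (Vt 1) h q"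
proof -
  have "vf_app K h q = (\<Sum>j\<in>{Vx, Vt 0, Vt 1, Vtx}. K j q * pd j h q)"
    by (rule vf_app_eq_sum) (use pd_indep[of h, OF assms] in blast)+
  then show ?thesis by (simp add: T_0[unfolded fun_eq_iff] T_1[unfolded fun_eq_iff])
qed

lemma \<kappa>_eq: "\<kappa> q = pd Vx F q + q Vtx * pd (Vt 0) F q + F q * pd (Vt 1) F q"
  unfolding \<kappa>_def by (rule vf_app_K_jets) (simp add: on_jets_upd)

lemma K_Fs: "vf_app K Fs q = pd Vx Fs q + q Vtx * pd (Vt 0) Fs q + F q * pd (Vt 1) Fs q"
proof (rule vf_app_K_jets)
  fix q :: jet and j s assume j: "j \<notin> {Vx, Vt 0, Vt 1, Vtx}"
  then have "F (q(j := s, Vtx := s')) = F (q(Vtx := s'))" for s'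
    by (simp add: fun_upd_twist[of j Vtx] on_jets_upd)
  moreover have "Vtx \<noteq> j" using j by auto
  ultimately show "Fs (q(j := s)) = Fs q" by (simp add: pd_def)
qed

subsection \<open>The characteristic ring\<close>

abbreviation X :: "(jet \<Rightarrow> real) \<Rightarrow> jet \<Rightarrow> real" where "X \<equiv> pd Vtx"

definition lam :: "jet \<Rightarrow> real" where "lam q = X Fss q / Fss q"

definition \<tau> :: "jet \<Rightarrow> real" where
  "\<tau> q = D f lam q - (X Fss q * Fs q - 3 * (Fss q)\<^sup>2) / (Fss q * (Fs q)\<^sup>2)"

definition \<sigma> :: "jet \<Rightarrow> real" where
  "\<sigma> q = D f (mu F) q - (mu F q * Fs q - \<kappa> q)"

definition A :: "(jet \<Rightarrow> real) \<Rightarrow> jet \<Rightarrow> real" where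
  "A u q = X (X (X u)) q - lam q * X (X u) q"

text \<open>The part \<open>2 K X - X K\<close> comes from \<open>[K, [X, K]]\<close>: the
  coefficient of \<open>C1\<close> along \<open>t_k\<close> is \<open>X (T k)\<close>, and
  \<open>C1\<close> acts on \<open>T k\<close> as \<open>X K - K X\<close>.\<close>

definition B :: "(jet \<Rightarrow> real) \<Rightarrow> jet \<Rightarrow> real" where
  "B u q = 2 * vf_app K (X u) q - X (vf_app K u) q - mu F q * X (X u) q"

lemma la_\<kappa>: "locally_analytic (P m) \<kappa>"
  unfolding \<kappa>_def by (intro la_vf_app la_K la_F)

lemma la_lam: "locally_analytic (P m) lam"
  unfolding lam_def[abs_def] using f_txtx orbit_in_domain by (intro la_divide la_pd la_F) blast

lemma la_mu: "locally_analytic (P m) (mu F)"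
  unfolding mu_def[abs_def] using f_txtx orbit_in_domain
  by (intro la_divide la_add la_diff la_mult la_pd la_F la_coord) blast

lemma X_X_D:
  assumes u: "locally_analytic (P (m + 1)) u"
  shows "germ_eq (P m) (X (X (D f u))) (\<lambda>q. Fss q * D f (X u) q + Fs q * Fs q * D f (X (X u)) q)"
  using near_pd_cong[OF X_D[OF u], of Vtx] X_D[OF la_pd[OF u, of Vtx]]
    near_pd_mult[OF la_pd[OF la_F] la_D[OF la_pd[OF u]], of Vtx Vtx Vtx]
  by eventually_elim simp

lemma X_X_X_D:
  assumes u: "locally_analytic (P (m + 1)) u"
  shows "germ_eq (P m) (X (X (X (D f u))))
    (\<lambda>q. X Fss q * D f (X u) q + 3 * Fs q * Fss q * D f (X (X u)) q + Fs q ^ 3 * D f (X (X (X u))) q)"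
proof -
  note Xu = la_pd[OF u, of Vtx] and XXu = la_pd[OF la_pd[OF u, of Vtx], of Vtx]
  note Fs = la_pd[OF la_F, of _ Vtx] and Fss = la_pd[OF la_pd[OF la_F], of _ Vtx Vtx]
  show ?thesis
    using near_pd_cong[OF X_X_D[OF u], of Vtx] X_D[OF Xu] X_D[OF XXu]
      near_pd_add[OF la_mult[OF Fss la_D[OF Xu]] la_mult[OF la_mult[OF Fs Fs] la_D[OF XXu]], of Vtx]
      near_pd_mult[OF Fss la_D[OF Xu], of Vtx] near_pd_mult[OF la_mult[OF Fs Fs] la_D[OF XXu], of Vtx]
      near_pd_mult[OF Fs[of m] Fs, of Vtx]
    by eventually_elim (simp add: algebra_simps power3_eq_cube)
qed

text \<open>The coefficient of \<open>D f (X u)\<close> is \<open>X Fss - lam * Fss\<close> and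
  vanishes by the choice of \<open>lam\<close>; replacing \<open>lam\<close> by
  \<open>D f lam\<close> in the next coefficient leaves the defect \<tau>.\<close>

lemma A_D:
  assumes u: "locally_analytic (P (m + 1)) u"
  shows "germ_eq (P m) (A (D f u)) (\<lambda>q. Fs q ^ 3 * (D f (A u) q + \<tau> q * D f (X (X u)) q))"
  using X_X_D[OF u] X_X_X_D[OF u] near_Fs near_Fss
proof eventually_elim
  case (elim q)
  have "D f (A u) q = D f (X (X (X u))) q - D f lam q * D f (X (X u)) q"
    by (simp add: D_def A_def)
  moreover have "Fs q ^ 3 * ((X Fss q * Fs q - 3 * (Fss q)\<^sup>2) / (Fss q * (Fs q)\<^sup>2))
      = lam q * (Fs q)\<^sup>2 - 3 * Fs q * Fss q"
    using elim(3,4) by (simp add: lam_def field_simps power2_eq_square power3_eq_cube)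
  moreover have "lam q * Fss q = X Fss q" using elim(4) by (simp add: lam_def)
  ultimately show ?case
    unfolding A_def[of "D f u"] elim(1,2) \<tau>_def by algebra
qed

text \<open>Moving \<open>X\<close> past \<open>K\<close> in \<open>X (K F)\<close> creates
  \<open>f_t + f_s f_t1\<close>, as the coefficients \<open>t_x\<close> and \<open>F\<close> of
  \<open>K\<close> themselves depend on \<open>t_x\<close>. This explains the last two terms in the
  numerator of \<open>mu\<close>.\<close>

lemma mu_eq: "near (P m) (\<lambda>q. 2 * vf_app K Fs q - X \<kappa> q = mu F q * Fss q)"
proof -
  have k: "\<kappa> = (\<lambda>q. (pd Vx F q + q Vtx * pd (Vt 0) F q) + F q * pd (Vt 1) F q)" by (auto simp: \<kappa>_eq)
  note pd = la_pd[OF la_F[of m]]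
  show ?thesis
    using near_Fss[of m] pd_commute[OF la_F[of m], of Vtx Vx] pd_commute[OF la_F[of m], of Vtx "Vt 0"]
      pd_commute[OF la_F[of m], of Vtx "Vt 1"]
      near_pd_add[OF la_add[OF pd la_mult[OF la_coord pd]] la_mult[OF la_F pd], of Vtx Vx Vtx "Vt 0" "Vt 1"]
      near_pd_add[OF pd la_mult[OF la_coord pd], of Vtx Vx Vtx "Vt 0"]
      near_pd_mult[OF la_coord pd, of Vtx Vtx "Vt 0"]
      near_pd_mult[OF la_F pd, of Vtx "Vt 1"]
  proof eventually_elim
    case (elim q)
    have "mu F q * Fss q = pd Vx Fs q + q Vtx * pd (Vt 0) Fs q + F q * pd (Vt 1) Fs q
        - pd (Vt 0) F q - Fs q * pd (Vt 1) F q"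
      using elim(1-4) by (simp add: mu_def)
    then show ?case unfolding K_Fs unfolding k elim(5-8) using elim(2-4)
      by (simp add: algebra_simps)
  qed
qed

text \<open>Here the coefficient of \<open>D f (X u)\<close> is
  \<open>2 K(Fs) - X \<kappa> - mu F * Fss\<close>, which vanishes by \<open>mu_eq\<close>.\<close>

lemma B_D:
  assumes u: "locally_analytic (P (m + 1)) u"
  shows "germ_eq (P m) (B (D f u)) (\<lambda>q. Fs q * (D f (B u) q + \<sigma> q * D f (X (X u)) q))"
proof -
  note Fs = la_pd[OF la_F[of m], of Vtx]
  note Xu = la_pd[OF u, of Vtx] and Ku = la_vf_app[OF la_K u]
  show ?thesis
    using X_X_D[OF u] mu_eq[of m]
      vf_app_germ_cong[OF X_D[OF u], of K] vf_app_mult[OF Fs la_D[OF Xu], of K] K_D[OF Xu]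
      near_pd_cong[OF K_D[OF u], of Vtx] near_pd_add[OF la_D[OF Ku] la_mult[OF la_\<kappa> la_D[OF Xu]], of Vtx]
      X_D[OF Ku] near_pd_mult[OF la_\<kappa> la_D[OF Xu], of Vtx] X_D[OF Xu]
  proof eventually_elim
    case (elim q)
    have "D f (B u) q = 2 * D f (vf_app K (X u)) q - D f (X (vf_app K u)) q - D f (mu F) q * D f (X (X u)) q"
      by (simp add: D_def B_def)
    moreover have "vf_app K (X (D f u)) q = vf_app K Fs q * D f (X u) q
        + Fs q * (D f (vf_app K (X u)) q + \<kappa> q * D f (X (X u)) q)"
      by (simp add: elim(3,4,5))
    moreover have "X (vf_app K (D f u)) q = Fs q * D f (X (vf_app K u)) q
        + (X \<kappa> q * D f (X u) q + \<kappa> q * (Fs q * D f (X (X u)) q))"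
      by (simp add: elim(6,7,8,9,10))
    ultimately show ?case
      unfolding B_def[of "D f u"] elim(1) \<sigma>_def using elim(2) by algebra
  qed
qed

lemma X_T_0: "X (T 0) = (\<lambda>q. 1)" "X (X (T 0)) = (\<lambda>q. 0)"
proof -
  show "X (T 0) = (\<lambda>q. 1)" by (auto simp: T_0)
  then show "X (X (T 0)) = (\<lambda>q. 0)" by simp
qed

lemma A_T_0: "A (T 0) q = 0"
  by (simp add: A_def X_T_0)

lemma B_T_0: "B (T 0) q = 0"
proof -
  have "vf_app K (T 0) = (\<lambda>q. 0)" unfolding T_0 by (auto simp: fun_eq_iff)
  then show ?thesis by (simp add: B_def X_T_0)
qed

lemma A_T_1: "near (P m) (\<lambda>q. A (T 1) q = 0)"
  using near_Fss by eventually_elim (simp add: A_def T_1 lam_def)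

lemma B_T_1: "near (P m) (\<lambda>q. B (T 1) q = 0)"
  using mu_eq by eventually_elim (simp add: B_def T_1 \<kappa>_def)

lemma A_cong:
  assumes "germ_eq (P m) u v"
  shows "germ_eq (P m) (A u) (A v)"
  using near_pd_cong[OF near_pd_cong[OF assms, of Vtx], of Vtx]
    near_pd_cong[OF near_pd_cong[OF near_pd_cong[OF assms, of Vtx], of Vtx], of Vtx]
  by eventually_elim (simp add: A_def)

lemma B_cong:
  assumes "germ_eq (P m) u v"
  shows "germ_eq (P m) (B u) (B v)"
  using near_pd_cong[OF near_pd_cong[OF assms, of Vtx], of Vtx]
    vf_app_germ_cong[OF near_pd_cong[OF assms, of Vtx], of K]
    near_pd_cong[OF vf_app_germ_cong[OF assms, of K], of Vtx]
  by eventually_elim (simp add: B_def)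

text \<open>Differentiating \<open>D f (T (-1)) = t_x\<close> once and twice along
  \<open>t_x\<close> gives \<open>D f (X (X (T (-1)))) = - Fss / Fs ^ 3\<close>.\<close>

lemma D_X_X_T_minus: "near (P m) (\<lambda>q. D f (X (X (T (-1)))) q \<noteq> 0)"
proof -
  have "germ_eq (P m) (D f (T (-1))) (T 0)" using D_T[where m = m and k = "-1"] by simp
  note c = near_pd_cong[OF this, of Vtx]
  show ?thesis
    using X_D[OF la_T[where m = "m + 1" and k = "-1"]] X_X_D[OF la_T[where m = "m + 1" and k = "-1"]] c near_pd_cong[OF c, of Vtx] near_Fss
  proof eventually_elim
    case (elim q)
    have "Fs q * D f (X (T (-1))) q = 1" using elim(1,3) by (simp add: X_T_0)
    moreover have "Fss q * D f (X (T (-1))) q + Fs q * Fs q * D f (X (X (T (-1)))) q = 0"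
      using elim(2,4) by (simp add: X_T_0)
    ultimately show ?case using elim(5) by auto
  qed
qed

text \<open>The vanishing of all \<open>Z T\<^sub>k\<close> at one point of the orbit propagates along the orbit: the
  equation for \<open>T\<^sub>2\<close> forces \<open>\<theta> = 0\<close> there, and the one for \<open>T\<^sub>-\<^sub>1\<close> forces it at the preceding point.\<close>

lemma orbit_transfer:
  assumes ZD: "\<And>m u. locally_analytic (P (m + 1)) u \<Longrightarrow>
      germ_eq (P m) (Z (D f u)) (\<lambda>q. w q * (D f (Z u) q + \<theta> q * D f (X (X u)) q))"
    and w: "\<And>m. near (P m) (\<lambda>q. w q \<noteq> 0)"
    and cong: "\<And>m u v. germ_eq (P m) u v \<Longrightarrow> germ_eq (P m) (Z u) (Z v)"
    and Z0: "\<And>m. near (P m) (\<lambda>q. Z (T 0) q = 0)" and Z1: "\<And>m. near (P m) (\<lambda>q. Z (T 1) q = 0)"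
  shows "(\<forall>k. near (P 0) (\<lambda>q. Z (T k) q = 0)) \<longleftrightarrow> (\<forall>m. near (P m) (\<lambda>q. \<theta> q = 0))"
proof -
  have step: "germ_eq (P m) (Z (T (k + 1))) (\<lambda>q. w q * (D f (Z (T k)) q + \<theta> q * D f (X (X (T k))) q))" for m k
    using cong[OF D_T[where m = m and k = k]] ZD[OF la_T[where m = "m + 1" and k = k]] by eventually_elim simp
  have D0: "near (P m) (\<lambda>q. D f u q = 0) \<longleftrightarrow> near (P (m + 1)) (\<lambda>q. u q = 0)" for m u
    unfolding D_def by (rule near_shift_iff)
  define H where "H m \<longleftrightarrow> (\<forall>k. near (P m) (\<lambda>q. Z (T k) q = 0))" for m
  define E where "E m \<longleftrightarrow> near (P m) (\<lambda>q. \<theta> q = 0)" for m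
  \<comment> \<open>\<open>up\<close> and \<open>down\<close> are the halves of one equivalence:
    where \<theta> vanishes near \<open>P m\<close>, index \<open>k + 1\<close> at
    \<open>P m\<close> corresponds to index \<open>k\<close> at \<open>P (m + 1)\<close>.\<close>
  have up: "near (P m) (\<lambda>q. Z (T (k + 1)) q = 0)" if "E m" "near (P (m + 1)) (\<lambda>q. Z (T k) q = 0)" for m k
    using step[where m = m and k = k] that(1)[unfolded E_def] that(2)[folded D0] by eventually_elim simp
  have down: "near (P (m + 1)) (\<lambda>q. Z (T k) q = 0)" if "E m" "near (P m) (\<lambda>q. Z (T (k + 1)) q = 0)" for m k
    unfolding D0[symmetric] using step[where m = m and k = k] that(1)[unfolded E_def] that(2) w[of m] by eventually_elim simp
  have HE: "E m" if "H m" for m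
  proof -
    have "near (P m) (\<lambda>q. Z (T (1 + 1)) q = 0)" using that by (simp only: H_def)
    moreover have "near (P m) (\<lambda>q. D f (Z (T 1)) q = 0)" unfolding D0 by (rule Z1)
    moreover have "near (P m) (\<lambda>q. D f Fss q \<noteq> 0)" unfolding D_def by (rule near_shift[OF near_Fss])
    ultimately show ?thesis unfolding E_def using step[where m = m and k = 1] w[of m]
      by eventually_elim (simp add: T_1)
  qed
  have HE': "E m" if "H (m + 1)" for m
  proof -
    have "near (P m) (\<lambda>q. D f (Z (T (-1))) q = 0)" unfolding D0 using that by (simp only: H_def)
    then show ?thesis unfolding E_def using step[where m = m and k = "-1"] w[of m] Z0[of m] D_X_X_T_minus[of m]
      by eventually_elim simp
  qed
  have "E m \<and> H m" if "H 0" for m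
  proof (induction m rule: int_induct[where k = 0])
    case base
    show ?case using HE that by blast
  next
    case (step1 m)
    then have "H (m + 1)" unfolding H_def using down by blast
    then show ?case using HE by blast
  next
    case (step2 m)
    then have "E (m - 1)" using HE'[of "m - 1"] by simp
    \<comment> \<open>Only now can the relations be pulled back, since the relation for index -1 at
      \<open>P m\<close> has supplied the identity at \<open>P (m - 1)\<close>.\<close>
    moreover have "near (P (m - 1)) (\<lambda>q. Z (T k) q = 0)" for k
      using up[OF \<open>E (m - 1)\<close>, where k = "k - 1"] step2(2) by (simp add: H_def)
    ultimately show ?case unfolding H_def by blast
  qed
  moreover have "near (P m) (\<lambda>q. Z (T k) q = 0)" if E: "\<And>m. E m" for m k
  proof (induction k arbitrary: m rule: int_induct[where k = 0])
    case base
    show ?case by (rule Z0)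
  next
    case (step1 k)
    show ?case by (rule up[OF E step1(2)])
  next
    case (step2 k)
    show ?case using down[OF E[of "m - 1"], where k = "k - 1"] step2(2)[of "m - 1"] by simp
  qed
  ultimately show ?thesis unfolding H_def E_def by blast
qed

lemma A_iff: "(\<forall>k. near (P 0) (\<lambda>q. A (T k) q = 0)) \<longleftrightarrow> (\<forall>m. near (P m) (\<lambda>q. \<tau> q = 0))"
proof (rule orbit_transfer[OF A_D])
  show "near (P m) (\<lambda>q. Fs q ^ 3 \<noteq> 0)" for m using near_Fs by eventually_elim simp
qed (simp_all add: A_cong A_T_0 A_T_1)

lemma B_iff: "(\<forall>k. near (P 0) (\<lambda>q. B (T k) q = 0)) \<longleftrightarrow> (\<forall>m. near (P m) (\<lambda>q. \<sigma> q = 0))"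
  by (rule orbit_transfer[OF B_D near_Fs]) (simp_all add: B_cong B_T_0 B_T_1)

section \<open>Generators, linear independence and dimension\<close>

abbreviation "C1 \<equiv> bracket Xfield K"
abbreviation "C2 \<equiv> bracket Xfield C1"
abbreviation "C3 \<equiv> bracket Xfield C2"
abbreviation "KC1 \<equiv> bracket K C1"

lemma la_C1: "la_field (P m) C1" and la_C2: "la_field (P m) C2"
  and la_C3: "la_field (P m) C3" and la_KC1: "la_field (P m) KC1"
  by (rule la_field_bracket la_K la_field_Xfield)+

lemma bracket_Xfield:
  assumes "la_field (P m) V"
  shows "germ_eq (P m) (bracket Xfield V j) (X (V j))"
proof -
  have "vf_app V (Xfield j) q = 0" for q by (simp add: Xfield_def)
  with vf_app_Xfield[OF la_fieldD[OF assms]] show ?thesis by (simp add: bracket_def)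
qed

lemma K_simps: "K Vx = (\<lambda>q. 1)" "K Vtx = (\<lambda>q. 0)"
  by (auto simp: fun_eq_iff)

lemma C1_simps: "germ_eq (P m) (C1 Vx) (\<lambda>q. 0)" "germ_eq (P m) (C1 Vtx) (\<lambda>q. 0)" "germ_eq (P m) (C1 (Vt k)) (X (T k))"
  using bracket_Xfield[OF la_K[of m], where j = Vx] bracket_Xfield[OF la_K[of m], where j = Vtx]
    bracket_Xfield[OF la_K[of m], where j = "Vt k"]
  by (simp_all add: K_simps)

lemma bracket_Xfield_step:
  assumes "la_field (P m) V" "germ_eq (P m) (V j) h"
  shows "germ_eq (P m) (bracket Xfield V j) (X h)"
  using bracket_Xfield[OF assms(1), where j = j] near_pd_cong[OF assms(2), of Vtx] by eventually_elim simp

lemma C2_simps: "germ_eq (P m) (C2 Vx) (\<lambda>q. 0)" "germ_eq (P m) (C2 Vtx) (\<lambda>q. 0)" "germ_eq (P m) (C2 (Vt k)) (X (X (T k)))"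
  using bracket_Xfield_step[OF la_C1 C1_simps(1)] bracket_Xfield_step[OF la_C1 C1_simps(2)]
    bracket_Xfield_step[OF la_C1 C1_simps(3)] by auto

lemma C3_simps: "germ_eq (P m) (C3 Vx) (\<lambda>q. 0)" "germ_eq (P m) (C3 Vtx) (\<lambda>q. 0)" "germ_eq (P m) (C3 (Vt k)) (X (X (X (T k))))"
  using bracket_Xfield_step[OF la_C2 C2_simps(1)] bracket_Xfield_step[OF la_C2 C2_simps(2)]
    bracket_Xfield_step[OF la_C2 C2_simps(3)] by auto

lemma KC1_simps: "germ_eq (P m) (KC1 Vx) (\<lambda>q. 0)" "germ_eq (P m) (KC1 Vtx) (\<lambda>q. 0)"
  "germ_eq (P m) (KC1 (Vt k)) (\<lambda>q. 2 * vf_app K (X (T k)) q - X (vf_app K (T k)) q)"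
proof -
  have Kc: "germ_eq (P m) (vf_app K (C1 j)) (vf_app K h)" if "germ_eq (P m) (C1 j) h" for j h
    by (rule vf_app_germ_cong[OF that])
  show "germ_eq (P m) (KC1 Vx) (\<lambda>q. 0)"
    using Kc[OF C1_simps(1)] by eventually_elim (simp add: bracket_def[of K] K_simps)
  show "germ_eq (P m) (KC1 Vtx) (\<lambda>q. 0)"
    using Kc[OF C1_simps(2)] by eventually_elim (simp add: bracket_def[of K] K_simps)
  show "germ_eq (P m) (KC1 (Vt k)) (\<lambda>q. 2 * vf_app K (X (T k)) q - X (vf_app K (T k)) q)"
    using Kc[OF C1_simps(3)[where m = m and k = k]] vf_app_bracket[OF la_field_Xfield la_K la_T[where m = m and k = k]]
      vf_app_Xfield[OF la_vf_app[OF la_K la_T[where m = m and k = k]]] vf_app_germ_cong[OF vf_app_Xfield[OF la_T[where m = m and k = k]], of K]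
    by eventually_elim (simp add: bracket_def[of K])
qed

lemma C2_T_1: "near (P m) (\<lambda>q. C2 (Vt 1) q = Fss q)"
  using C2_simps(3)[where m = m and k = 1] by (simp add: T_1)

text \<open>Only \<open>X\<close> has a component along \<open>t_x\<close> and only \<open>K\<close>
  one along \<open>x\<close>; with these removed, along \<open>t_0\<close> only \<open>C1\<close>
  survives, with coefficient \<open>X (T 0) = 1\<close>. The slot \<open>Z\<close> is for a fifth
  field.\<close>

lemma relation_components:
  assumes a: "\<And>j. near (P m) (\<lambda>q. a0 q * Xfield j q + a1 q * K j q + a2 q * C1 j q + a3 q * C2 j q + a4 q * Z j q = 0)"
    and Z: "germ_eq (P m) (Z Vx) (\<lambda>q. 0)" "germ_eq (P m) (Z Vtx) (\<lambda>q. 0)" "germ_eq (P m) (Z (Vt 0)) (\<lambda>q. 0)"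
  shows "near (P m) (\<lambda>q. a0 q = 0)" "near (P m) (\<lambda>q. a1 q = 0)" "near (P m) (\<lambda>q. a2 q = 0)"
    "near (P m) (\<lambda>q. a3 q * C2 (Vt k) q + a4 q * Z (Vt k) q = 0)"
proof -
  show a0: "near (P m) (\<lambda>q. a0 q = 0)"
    using a[of Vtx] C1_simps(2) C2_simps(2) Z(2) by eventually_elim (simp add: Xfield_def K_simps)
  show a1: "near (P m) (\<lambda>q. a1 q = 0)"
    using a[of Vx] C1_simps(1) C2_simps(1) Z(1) by eventually_elim (simp add: Xfield_def K_simps)
  show a2: "near (P m) (\<lambda>q. a2 q = 0)"
    using a[of "Vt 0"] a0 a1 C1_simps(3)[where m = m and k = 0] C2_simps(3)[where m = m and k = 0] Z(3) by eventually_elim (simp add: X_T_0)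
  show "near (P m) (\<lambda>q. a3 q * C2 (Vt k) q + a4 q * Z (Vt k) q = 0)"
    using a[of "Vt k"] a0 a1 a2 by eventually_elim simp
qed

lemma lin_indep_generators: "lin_indep (P m) [Xfield, K, C1, C2]"
  unfolding lin_indep_def
proof (intro allI impI)
  fix a i assume a: "(\<forall>i<length [Xfield, K, C1, C2]. locally_analytic (P m) (a i)) \<and>
      vf_eq (P m) (lincomb a [Xfield, K, C1, C2]) (\<lambda>j q. 0)" and i: "i < length [Xfield, K, C1, C2]"
  \<comment> \<open>The summand \<open>0 * 0\<close> fills the slot of the fifth field in
    \<open>relation_components\<close>.\<close>
  have rel: "near (P m) (\<lambda>q. a 0 q * Xfield j q + a 1 q * K j q + a 2 q * C1 j q + a 3 q * C2 j q + 0 * 0 = 0)" for j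
    using conjunct2[OF a, THEN vf_eqD, of j]
    by (simp add: lincomb_def eval_nat_numeral lessThan_Suc add_ac)
  have z: "near (P m) (\<lambda>q. (0::real) = 0)" by simp
  note r = relation_components[where Z = "\<lambda>j q. 0" and ?a4.0 = "\<lambda>q. 0", OF rel z z z]
  have "near (P m) (\<lambda>q. a 3 q = 0)"
    using r(4)[of 1] C2_T_1 near_Fss by eventually_elim simp
  moreover have "i = 0 \<or> i = 1 \<or> i = 2 \<or> i = 3" using i by auto
  ultimately show "near (P m) (\<lambda>q. a i q = 0)" using r(1-3) by auto
qed

lemma generators_in_Lx:
  "Xfield \<in> Lx f g p" "K \<in> Lx f g p" "C1 \<in> Lx f g p" "C2 \<in> Lx f g p" "C3 \<in> Lx f g p" "KC1 \<in> Lx f g p"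
  by (intro Lx.intros)+

text \<open>Five elements are dependent. The coefficient of \<open>Z\<close> is a nonzero germ, as
  otherwise all coefficients would vanish; along \<open>t_1\<close> it determines that of
  \<open>C2\<close>, and \<open>la_domain\<close> then cancels it along every
  \<open>t_k\<close>.\<close>

lemma dimension_relation:
  assumes dim: "has_dimension (P m) (Lx f g (P m)) 4"
    and Z: "Z \<in> Lx f g (P m)" "la_field (P m) Z"
    and Z0: "germ_eq (P m) (Z Vx) (\<lambda>q. 0)" "germ_eq (P m) (Z Vtx) (\<lambda>q. 0)" "germ_eq (P m) (Z (Vt 0)) (\<lambda>q. 0)"
    and \<nu>: "locally_analytic (P m) \<nu>" "near (P m) (\<lambda>q. Z (Vt 1) q = \<nu> q * Fss q)"
  shows "near (P m) (\<lambda>q. Z (Vt k) q = \<nu> q * X (X (T k)) q)"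
proof -
  let ?Vs = "[Xfield, K, C1, C2, Z]"
  have sub: "set ?Vs \<subseteq> Lx f g (P m)" using generators_in_Lx Z(1) by simp
  have "\<not> lin_indep (P m) ?Vs"
  proof
    assume "lin_indep (P m) ?Vs"
    then have "length ?Vs \<le> 4" using dim sub unfolding has_dimension_def by blast
    then show False by simp
  qed
  then obtain a i where a: "\<forall>i<length ?Vs. locally_analytic (P m) (a i)" "vf_eq (P m) (lincomb a ?Vs) (\<lambda>j q. 0)"
    and i: "i < length ?Vs" "\<not> near (P m) (\<lambda>q. a i q = 0)" unfolding lin_indep_def by blast
  have rel: "near (P m) (\<lambda>q. a 0 q * Xfield j q + a 1 q * K j q + a 2 q * C1 j q + a 3 q * C2 j q + a 4 q * Z j q = 0)" for j
    using vf_eqD[OF a(2), of j]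
    by (simp add: lincomb_def eval_nat_numeral lessThan_Suc add_ac)
  note r = relation_components[OF rel Z0]
  have a3: "near (P m) (\<lambda>q. a 3 q = - a 4 q * \<nu> q)"
    using r(4)[of 1] C2_T_1 near_Fss \<nu>(2)
  proof eventually_elim
    case (elim q)
    then have "(a 3 q + a 4 q * \<nu> q) * Fss q = 0" by (simp add: algebra_simps)
    then show ?case using elim(3) by (simp add: add_eq_0_iff)
  qed
  have "\<not> near (P m) (\<lambda>q. a 4 q = 0)"
  proof
    assume a4: "near (P m) (\<lambda>q. a 4 q = 0)"
    then have "near (P m) (\<lambda>q. a 3 q = 0)" using a3 by eventually_elim simp
    moreover have "i = 0 \<or> i = 1 \<or> i = 2 \<or> i = 3 \<or> i = 4" using i(1) by auto
    ultimately show False using i(2) r(1-3) a4 by auto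
  qed
  moreover have "near (P m) (\<lambda>q. a 4 q * (Z (Vt k) q - \<nu> q * C2 (Vt k) q) = 0)"
    using r(4)[of k] a3 by eventually_elim (simp add: algebra_simps)
  moreover have "locally_analytic (P m) (a 4)" using a(1) by simp
  moreover have "locally_analytic (P m) (\<lambda>q. Z (Vt k) q - \<nu> q * C2 (Vt k) q)"
    by (intro la_diff la_mult \<nu>(1) la_fieldD[OF Z(2)] la_fieldD[OF la_C2])
  ultimately have "near (P m) (\<lambda>q. Z (Vt k) q - \<nu> q * C2 (Vt k) q = 0)" using la_domain by blast
  then show ?thesis using C2_simps(3)[where m = m and k = k] by eventually_elim simp
qed

lemma dimension_imp_relations:
  assumes dim: "has_dimension (P m) (Lx f g (P m)) 4"
  shows "near (P m) (\<lambda>q. A (T k) q = 0)" "near (P m) (\<lambda>q. B (T k) q = 0)"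
proof -
  have "near (P m) (\<lambda>q. C3 (Vt k) q = lam q * X (X (T k)) q)"
  proof (rule dimension_relation[OF dim generators_in_Lx(5) la_C3 C3_simps(1,2)])
    show "near (P m) (\<lambda>q. C3 (Vt 0) q = 0)" using C3_simps(3)[where m = m and k = 0] by (simp add: X_T_0)
    show "near (P m) (\<lambda>q. C3 (Vt 1) q = lam q * Fss q)"
      using C3_simps(3)[where m = m and k = 1] near_Fss by eventually_elim (simp add: T_1 lam_def)
  qed (rule la_lam)
  then show "near (P m) (\<lambda>q. A (T k) q = 0)"
    using C3_simps(3)[where m = m and k = k] by eventually_elim (simp add: A_def)
  have "near (P m) (\<lambda>q. KC1 (Vt k) q = mu F q * X (X (T k)) q)"
  proof (rule dimension_relation[OF dim generators_in_Lx(6) la_KC1 KC1_simps(1,2)])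
    show "near (P m) (\<lambda>q. KC1 (Vt 0) q = 0)"
      using KC1_simps(3)[where m = m and k = 0] by eventually_elim (use B_T_0 in \<open>simp add: B_def X_T_0\<close>)
    show "near (P m) (\<lambda>q. KC1 (Vt 1) q = mu F q * Fss q)"
      using KC1_simps(3)[where m = m and k = 1] mu_eq by eventually_elim (simp add: T_1 \<kappa>_def)
  qed (rule la_mu)
  then show "near (P m) (\<lambda>q. B (T k) q = 0)"
    using KC1_simps(3)[where m = m and k = k] by eventually_elim (simp add: B_def)
qed

lemma relations_imp_basis:
  assumes A: "\<And>k. near (P m) (\<lambda>q. A (T k) q = 0)" and B: "\<And>k. near (P m) (\<lambda>q. B (T k) q = 0)"
  shows "is_basis (P m) (Lx f g (P m)) [Xfield, K, C1, C2]"
proof -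
  let ?Vs = "[Xfield, K, C1, C2]"
  let ?S = "span_germs (P m) ?Vs"
  have C3: "vf_eq (P m) C3 (\<lambda>j q. lam q * C2 j q)"
    unfolding vf_eq_def
  proof
    fix j show "germ_eq (P m) (C3 j) (\<lambda>q. lam q * C2 j q)"
    proof (cases j)
      case Vx
      show ?thesis unfolding Vx using C3_simps(1) C2_simps(1) by eventually_elim simp
    next
      case Vtx
      show ?thesis unfolding Vtx using C3_simps(2) C2_simps(2) by eventually_elim simp
    next
      case (Vt k)
      show ?thesis unfolding Vt using C3_simps(3)[where m = m and k = k] C2_simps(3)[where m = m and k = k] A[of k]
        by eventually_elim (simp add: A_def)
    qed
  qed
  have KC1: "vf_eq (P m) KC1 (\<lambda>j q. mu F q * C2 j q)"
    unfolding vf_eq_def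
  proof
    fix j show "germ_eq (P m) (KC1 j) (\<lambda>q. mu F q * C2 j q)"
    proof (cases j)
      case Vx
      show ?thesis unfolding Vx using KC1_simps(1) C2_simps(1) by eventually_elim simp
    next
      case Vtx
      show ?thesis unfolding Vtx using KC1_simps(2) C2_simps(2) by eventually_elim simp
    next
      case (Vt k)
      show ?thesis unfolding Vt using KC1_simps(3)[where m = m and k = k] C2_simps(3)[where m = m and k = k] B[of k]
        by eventually_elim (simp add: B_def)
    qed
  qed
  have la: "la_field (P m) V" if "V \<in> set ?Vs" for V
    using that la_K la_C1 la_C2 by auto
  have base: "V \<in> ?S" if "V \<in> set ?Vs" for V using that by (rule span_base)
  have zero: "bracket V V \<in> ?S" for V using span_zero by (simp add: bracket_def)
  have anti: "bracket W V \<in> ?S" if "bracket V W \<in> ?S" for V W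
    using span_scale[OF la_const[of _ "-1"] that] by (subst bracket_antisym) simp
  have add_span: "Z \<in> ?S" if "vf_eq (P m) Z (\<lambda>j q. V j q + W j q)" "V \<in> ?S" "W \<in> ?S" for Z V W
    by (rule span_vf_eq[OF span_add[OF that(2,3)] that(1)])
  have XK: "C1 \<in> ?S" and XC1: "C2 \<in> ?S" using base by auto
  have XC2: "C3 \<in> ?S" by (rule span_vf_eq[OF span_scale[OF la_lam XC1] C3])
  have KC1_S: "KC1 \<in> ?S" by (rule span_vf_eq[OF span_scale[OF la_mu XC1] KC1])
  have XS: "bracket Xfield Z \<in> ?S" if "Z \<in> ?S" for Z
  proof (rule anti, rule span_bracket_left[OF la la_field_Xfield _ that])
    show "bracket V Xfield \<in> ?S" if "V \<in> set ?Vs" for V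
      using that zero anti[OF XK] anti[OF XC1] anti[OF XC2] by auto
  qed
  have KC2: "bracket K C2 \<in> ?S"
  proof -
    \<comment> \<open>Since \<open>C2 = [X, C1]\<close>, the first summand is
      \<open>[-C1, C1]\<close>, the zero germ; the second is in the span because \<open>KC1\<close>
      is.\<close>
    have j: "vf_eq (P m) (bracket K C2) (\<lambda>j q. bracket (bracket K Xfield) C1 j q + bracket Xfield KC1 j q)"
      by (rule bracket_jacobi[OF la_K la_field_Xfield la_C1])
    have "bracket K Xfield = (\<lambda>j q. - 1 * C1 j q)" by (rule bracket_antisym)
    moreover have "bracket (\<lambda>j q. - 1 * C1 j q) C1 \<in> ?S"
    proof (rule add_span[OF bracket_scale_left[OF la_const la_C1]])
      show "(\<lambda>j q. - 1 * bracket C1 C1 j q) \<in> ?S" by (rule span_scale[OF la_const zero])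
      show "(\<lambda>j q. - vf_app C1 (\<lambda>q. - 1) q * C1 j q) \<in> ?S" using span_zero by simp
    qed
    ultimately show ?thesis using add_span[OF j _ XS[OF KC1_S]] by simp
  qed
  have C1C2: "bracket C1 C2 \<in> ?S"
  proof -
    \<comment> \<open>Bracketing \<open>X\<close> with \<open>[K, C2]\<close> isolates
      \<open>[C1, C2]\<close>. The term \<open>[K, C3]\<close> is in the span because
      \<open>C3\<close> is a multiple of \<open>C2\<close> and \<open>[K, C2]\<close> has already
      been placed there.\<close>
    have j: "vf_eq (P m) (bracket Xfield (bracket K C2)) (\<lambda>j q. bracket C1 C2 j q + bracket K C3 j q)"
      by (rule bracket_jacobi[OF la_field_Xfield la_K la_C2])
    have KC3: "bracket K C3 \<in> ?S"
    proof (rule anti, rule span_bracket_left[OF la la_K _ XC2])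
      show "bracket V K \<in> ?S" if "V \<in> set ?Vs" for V
        using that zero XK anti[OF KC1_S] anti[OF KC2] by auto
    qed
    have 1: "bracket Xfield (bracket K C2) \<in> ?S" by (rule XS[OF KC2])
    have 2: "(\<lambda>j q. - 1 * bracket K C3 j q) \<in> ?S" by (rule span_scale[OF la_const KC3])
    have "vf_eq (P m) (bracket C1 C2) (\<lambda>j q. bracket Xfield (bracket K C2) j q + - 1 * bracket K C3 j q)"
      unfolding vf_eq_def
    proof
      fix i
      show "germ_eq (P m) (bracket C1 C2 i) (\<lambda>q. bracket Xfield (bracket K C2) i q + - 1 * bracket K C3 i q)"
        using vf_eqD[OF j, of i] by eventually_elim simp
    qed
    then show ?thesis by (rule add_span[OF _ 1 2])
  qed
  have gen: "bracket V W \<in> ?S" if "V \<in> set ?Vs" "W \<in> set ?Vs" for V W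
    using that XK XC1 XC2 KC1_S KC2 C1C2 zero anti[OF XK] anti[OF XC1] anti[OF XC2] anti[OF KC1_S]
      anti[OF KC2] anti[OF C1C2] by auto
  have "Z \<in> ?S" if "Z \<in> Lx f g (P m)" for Z
    using that
  proof induction
    case (bracket V W)
    then show ?case using span_bracket[OF la gen] by blast
  qed (use base in \<open>auto intro: span_add span_scale\<close>)
  moreover have "set ?Vs \<subseteq> Lx f g (P m)" using generators_in_Lx by simp
  ultimately show ?thesis
    unfolding is_basis_def span_germs_def using lin_indep_generators by blast
qed

lemma dimension_iff:
  "has_dimension (P 0) (Lx f g (P 0)) 4 \<longleftrightarrow> (\<forall>m. near (P m) (\<lambda>q. \<tau> q = 0 \<and> \<sigma> q = 0))"
proof
  assume "has_dimension (P 0) (Lx f g (P 0)) 4"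
  from dimension_imp_relations[OF this] have "\<forall>m. near (P m) (\<lambda>q. \<tau> q = 0)" "\<forall>m. near (P m) (\<lambda>q. \<sigma> q = 0)"
    unfolding A_iff[symmetric] B_iff[symmetric] by auto
  then show "\<forall>m. near (P m) (\<lambda>q. \<tau> q = 0 \<and> \<sigma> q = 0)" by (simp add: eventually_conj_iff)
next
  assume "\<forall>m. near (P m) (\<lambda>q. \<tau> q = 0 \<and> \<sigma> q = 0)"
  then have "\<forall>m. near (P m) (\<lambda>q. \<tau> q = 0)" "\<forall>m. near (P m) (\<lambda>q. \<sigma> q = 0)"
    by (simp_all add: eventually_conj_iff)
  then have "is_basis (P 0) (Lx f g (P 0)) [Xfield, K, C1, C2]"
    unfolding A_iff[symmetric] B_iff[symmetric] by (intro relations_imp_basis) auto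
  from basis_dimension[OF this] show "has_dimension (P 0) (Lx f g (P 0)) 4" by (simp add: eval_nat_numeral)
qed

end

theorem theorem5:
  fixes f g :: "real \<Rightarrow> real \<Rightarrow> real \<Rightarrow> real \<Rightarrow> real"
    and U :: "(real \<times> real \<times> real \<times> real) set"
    and P :: "int \<Rightarrow> jet"
  assumes "open U"
    and f_analytic: "\<forall>q\<in>jets_over U. analytic_in {Vx, Vt 0, Vt 1, Vtx} (on_jets f 0) q"
    and f_tx: "\<forall>q\<in>jets_over U. pd Vtx (on_jets f 0) q \<noteq> 0"
    and f_txtx: "\<forall>q\<in>jets_over U. pd Vtx (pd Vtx (on_jets f 0)) q \<noteq> 0"
    and g_inverse: "\<forall>(x, t, t1, s)\<in>U. g x t t1 (f x t t1 s) = s"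
    and orbit: "\<forall>m. P (m + 1) = shift f (P m)"
    and orbit_in_domain: "\<forall>m. P m \<in> jets_over U"
  shows
    "(has_dimension (P 0) (Lx f g (P 0)) 4 \<longleftrightarrow>
       (\<forall>m. \<forall>\<^sub>F q in nhds (P m).
          (let F = on_jets f 0; F_s = pd Vtx F; F_ss = pd Vtx F_s; F_sss = pd Vtx F_ss in
             D f (\<lambda>q. F_sss q / F_ss q) q
               = (F_sss q * F_s q - 3 * (F_ss q)\<^sup>2) / (F_ss q * (F_s q)\<^sup>2) \<and>
             D f (mu F) q
               = mu F q * F_s q - (pd Vx F q + q Vtx * pd (Vt 0) F q + F q * pd (Vt 1) F q)))) \<and>
     (has_dimension (P 0) (Lx f g (P 0)) 4 \<longrightarrow>
       (let C1 = bracket Xfield (Kfield f g); C2 = bracket Xfield C1 in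
          is_basis (P 0) (Lx f g (P 0)) [Xfield, Kfield f g, C1, C2]))"
proof -
  interpret chain f g U P by unfold_locales fact+
  have "\<tau> q = 0 \<and> \<sigma> q = 0 \<longleftrightarrow>
      (let F = on_jets f 0; F_s = pd Vtx F; F_ss = pd Vtx F_s; F_sss = pd Vtx F_ss in
         D f (\<lambda>q. F_sss q / F_ss q) q
           = (F_sss q * F_s q - 3 * (F_ss q)\<^sup>2) / (F_ss q * (F_s q)\<^sup>2) \<and>
         D f (mu F) q
           = mu F q * F_s q - (pd Vx F q + q Vtx * pd (Vt 0) F q + F q * pd (Vt 1) F q))" for q
    by (simp add: Let_def \<tau>_def \<sigma>_def \<kappa>_eq lam_def[abs_def])
  then have "has_dimension (P 0) (Lx f g (P 0)) 4 \<longleftrightarrow> (\<forall>m. \<forall>\<^sub>F q in nhds (P m).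
      (let F = on_jets f 0; F_s = pd Vtx F; F_ss = pd Vtx F_s; F_sss = pd Vtx F_ss in
         D f (\<lambda>q. F_sss q / F_ss q) q
           = (F_sss q * F_s q - 3 * (F_ss q)\<^sup>2) / (F_ss q * (F_s q)\<^sup>2) \<and>
         D f (mu F) q
           = mu F q * F_s q - (pd Vx F q + q Vtx * pd (Vt 0) F q + F q * pd (Vt 1) F q)))"
    unfolding dimension_iff by (simp only:)
  moreover have "is_basis (P 0) (Lx f g (P 0)) [Xfield, K, C1, C2]"
    if "has_dimension (P 0) (Lx f g (P 0)) 4"
    by (intro relations_imp_basis dimension_imp_relations that)
  ultimately show ?thesis unfolding Let_def by blast
qed

end
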